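(* Let $m>1$ be an integer, let $\ell$ be an odd integer, and let $H$, $\nu$, $\Gamma$, $\Sigma_1$ be as defined in the context. The canonical map $\zeta:\mathrm{Aut}(H)\to\mathrm{Aut}(H/Z_3(H))$ has kernel $\mathrm{Aut}_3(H)$ and image $\langle\Sigma_1,\nu\rangle^\zeta$ (the image of the subgroup $\langle\Sigma_1,\nu\rangle$ under $\zeta$), so that $$\mathrm{Aut}(H)=\mathrm{Aut}_3(H)\langle\Sigma_1,\nu\rangle=\mathrm{Aut}_2(H)\mathrm{Inn}(H)\langle\Gamma,\Sigma_1,\nu\rangle.$$ Moreover, $\mathrm{Aut}(H)/\mathrm{Aut}_3(H)\cong(\mathbb{Z}/2\mathbb{Z})^2$ if $m>2$ and $\mathrm{Aut}(H)/\mathrm{Aut}_3(H)\cong\mathbb{Z}/2\mathbb{Z}$ if $m=2$. Thus the order of $\mathrm{Aut}(H)$ is $2^{8m-2}$ if $m>2$ and $2^{13}$ if $m=2$.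
   Context: Notation: $[a,b]=a^{-1}b^{-1}ab$, $b^a=a^{-1}ba$, $\alpha=1+2^m\ell$, $s=2^{m-1}$, $r=2^{m-2}$. Let $$J=\langle A,B\mid A^{[A,B]}=A^{\alpha},\ B^{[B,A]}=B^{\alpha},\ A^{2^{3m-1}}=B^{2^{3m-1}}=1\rangle$$ and $H=J/Z(J)$, which has the presentation $$H=\langle A,B\mid A^{[A,B]}=A^{\alpha},\ B^{[B,A]}=B^{\alpha},\ A^{2^{2m-1}}=B^{2^{2m-1}}=1\rangle.$$ For a group $T$, $Z_0(T)=1, Z_1(T),Z_2(T),\dots$ denotes the upper central series, and $\mathrm{Aut}_i(T)$ is the kernel of the canonical map $\mathrm{Aut}(T)\to\mathrm{Aut}(T/Z_i(T))$. The following automorphisms of $H$ exist: $\nu$, given by $A\mapsto B$, $B\mapsto A$; $\Gamma\in\mathrm{Aut}_3(H)$, given by $A\mapsto A^{1+s}$, $B\mapsto BA^s$; and, if $m>2$, $\Sigma$, given by $A\mapsto A^{1+r}B^r$, $B\mapsto B^{1+r}A^r$. Set $\Sigma_1=\Sigma$ if $m>2$, and let $\Sigma_1$ be the identity automorphism of $H$ if $m=2$. *)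

theory Defs
  imports "HOL-Algebra.Bij" "HOL-Algebra.Elementary_Groups"
begin

section \<open>Groups given by generators and relations\<close>

text \<open>
  A letter \<open>(False, x)\<close> stands for the generator \<open>x\<close> and \<open>(True, x)\<close> for its inverse.
  All elements of the type \<open>'x\<close> are generators.
\<close>

type_synonym 'x word = "(bool \<times> 'x) list"

definition letter :: "'x \<Rightarrow> 'x word" where
  "letter x = [(False, x)]"

definition word_inv :: "'x word \<Rightarrow> 'x word" where
  "word_inv w = rev (map (\<lambda>(e, x). (\<not> e, x)) w)"

definition word_pow :: "'x word \<Rightarrow> int \<Rightarrow> 'x word" where
  "word_pow w k = (if 0 \<le> k then concat (replicate (nat k) w)
                   else concat (replicate (nat (- k)) (word_inv w)))"

definition word_conj :: "'x word \<Rightarrow> 'x word \<Rightarrow> 'x word" where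
  "word_conj b a = word_inv a @ b @ a"

definition word_comm :: "'x word \<Rightarrow> 'x word \<Rightarrow> 'x word" where
  "word_comm a b = word_inv a @ word_inv b @ a @ b"

text \<open>
  The congruence on words generated by free cancellation and by the relations \<open>l = r\<close>,
  \<open>(l, r) \<in> R\<close>; its classes are the elements of \<open>\<langle>'x | R\<rangle>\<close>.
\<close>

inductive word_eq :: "('x word \<times> 'x word) set \<Rightarrow> 'x word \<Rightarrow> 'x word \<Rightarrow> bool"
  for R :: "('x word \<times> 'x word) set" where
  refl: "word_eq R u u"
| sym: "word_eq R u v \<Longrightarrow> word_eq R v u"
| trans: "word_eq R u v \<Longrightarrow> word_eq R v w \<Longrightarrow> word_eq R u w"
| cancel: "word_eq R (u @ [(e, x), (\<not> e, x)] @ v) (u @ v)"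
| relation: "(l, r) \<in> R \<Longrightarrow> word_eq R (u @ l @ v) (u @ r @ v)"

definition word_class :: "('x word \<times> 'x word) set \<Rightarrow> 'x word \<Rightarrow> 'x word set" where
  "word_class R u = {v. word_eq R u v}"

definition presented_group :: "('x word \<times> 'x word) set \<Rightarrow> 'x word set monoid" where
  "presented_group R =
     \<lparr>carrier = range (word_class R),
      mult = (\<lambda>X Y. \<Union>u\<in>X. \<Union>v\<in>Y. word_class R (u @ v)),
      one = word_class R []\<rparr>"

lemma word_class_eq_iff: "word_class R u = word_class R v \<longleftrightarrow> word_eq R u v"
  unfolding word_class_def using word_eq.refl word_eq.sym word_eq.trans by blast

lemma word_eq_append_left:
  assumes "word_eq R u v"
  shows "word_eq R (w @ u) (w @ v)"
  using assms
proof (induction rule: word_eq.induct)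
  case (cancel u e x v)
  then show ?case using word_eq.cancel[of R "w @ u" e x v] by simp
next
  case (relation l r u v)
  then show ?case using word_eq.relation[of l r R "w @ u" v] by simp
qed (auto intro: word_eq.refl word_eq.sym word_eq.trans)

lemma word_eq_append_right:
  assumes "word_eq R u v"
  shows "word_eq R (u @ w) (v @ w)"
  using assms
proof (induction rule: word_eq.induct)
  case (cancel u e x v)
  then show ?case using word_eq.cancel[of R u e x "v @ w"] by simp
next
  case (relation l r u v)
  then show ?case using word_eq.relation[of l r R u "v @ w"] by simp
qed (auto intro: word_eq.refl word_eq.sym word_eq.trans)

lemma word_eq_append:
  "word_eq R u u' \<Longrightarrow> word_eq R v v' \<Longrightarrow> word_eq R (u @ v) (u' @ v')"
  by (meson word_eq.trans word_eq_append_left word_eq_append_right)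

lemma presented_group_mult:
  "word_class R u \<otimes>\<^bsub>presented_group R\<^esub> word_class R v = word_class R (u @ v)"
proof -
  have "word_class R (u' @ v') = word_class R (u @ v)"
    if "u' \<in> word_class R u" "v' \<in> word_class R v" for u' v'
    using that word_eq_append[of R u u' v v'] word_class_eq_iff[of R "u @ v" "u' @ v'"]
    by (simp add: word_class_def)
  moreover have "u \<in> word_class R u" "v \<in> word_class R v"
    by (auto simp: word_class_def intro: word_eq.refl)
  ultimately have "(\<Union>u'\<in>word_class R u. \<Union>v'\<in>word_class R v. word_class R (u' @ v')) = word_class R (u @ v)"
    by blast
  then show ?thesis by (simp add: presented_group_def)
qed

lemma word_eq_inv_left: "word_eq R (word_inv w @ w) []"
proof (induction w)
  case Nil
  then show ?case by (simp add: word_inv_def word_eq.refl)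
next
  case (Cons a w)
  obtain e x where a: "a = (e, x)" by (cases a)
  have "word_eq R (word_inv w @ [(\<not> e, x), (\<not> \<not> e, x)] @ w) (word_inv w @ w)"
    by (rule word_eq.cancel)
  then show ?case using Cons word_eq.trans by (fastforce simp: word_inv_def a)
qed

lemma group_presented_group: "group (presented_group R)"
proof (rule groupI)
  fix X Y Z
  assume "X \<in> carrier (presented_group R)"
  then obtain u where u: "X = word_class R u" by (auto simp: presented_group_def)
  have one: "\<one>\<^bsub>presented_group R\<^esub> = word_class R []" by (simp add: presented_group_def)
  have car: "word_class R w \<in> carrier (presented_group R)" for w
    by (simp add: presented_group_def)
  show "\<one>\<^bsub>presented_group R\<^esub> \<otimes>\<^bsub>presented_group R\<^esub> X = X"
    by (simp add: one u presented_group_mult)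
  have "word_class R (word_inv u) \<otimes>\<^bsub>presented_group R\<^esub> X = \<one>\<^bsub>presented_group R\<^esub>"
    unfolding u one presented_group_mult word_class_eq_iff by (rule word_eq_inv_left)
  then show "\<exists>Y\<in>carrier (presented_group R). Y \<otimes>\<^bsub>presented_group R\<^esub> X = \<one>\<^bsub>presented_group R\<^esub>"
    using car by blast
  assume "Y \<in> carrier (presented_group R)"
  then obtain v where v: "Y = word_class R v" by (auto simp: presented_group_def)
  show "X \<otimes>\<^bsub>presented_group R\<^esub> Y \<in> carrier (presented_group R)"
    by (simp add: u v presented_group_mult car)
  assume "Z \<in> carrier (presented_group R)"
  then obtain w where w: "Z = word_class R w" by (auto simp: presented_group_def)
  show "X \<otimes>\<^bsub>presented_group R\<^esub> Y \<otimes>\<^bsub>presented_group R\<^esub> Z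
      = X \<otimes>\<^bsub>presented_group R\<^esub> (Y \<otimes>\<^bsub>presented_group R\<^esub> Z)"
    by (simp add: u v w presented_group_mult)
qed (simp add: presented_group_def)


section \<open>Upper central series and automorphisms\<close>

definition center :: "('a, 'b) monoid_scheme \<Rightarrow> 'a set" where
  "center G = {z \<in> carrier G. \<forall>x\<in>carrier G. z \<otimes>\<^bsub>G\<^esub> x = x \<otimes>\<^bsub>G\<^esub> z}"

primrec upper_central :: "('a, 'b) monoid_scheme \<Rightarrow> nat \<Rightarrow> 'a set" where
  "upper_central G 0 = {\<one>\<^bsub>G\<^esub>}"
| "upper_central G (Suc i) =
     {x \<in> carrier G. upper_central G i #>\<^bsub>G\<^esub> x \<in> center (G Mod upper_central G i)}"

text \<open>
  For a characteristic subgroup \<open>N\<close>, the automorphism of \<open>G/N\<close> induced by \<open>f\<close> sends the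
  coset \<open>Nx\<close> to \<open>N f(x)\<close>, which is the image of the set \<open>Nx\<close> under \<open>f\<close>.
\<close>

definition canonical_map :: "('a, 'b) monoid_scheme \<Rightarrow> 'a set \<Rightarrow> ('a \<Rightarrow> 'a) \<Rightarrow> 'a set \<Rightarrow> 'a set" where
  "canonical_map G N f = (\<lambda>X\<in>carrier (G Mod N). f ` X)"

definition Aut_upper :: "('a, 'b) monoid_scheme \<Rightarrow> nat \<Rightarrow> ('a \<Rightarrow> 'a) set" where
  "Aut_upper G i = kernel (AutoGroup G) (AutoGroup (G Mod upper_central G i))
                     (canonical_map G (upper_central G i))"

definition Inn :: "('a, 'b) monoid_scheme \<Rightarrow> ('a \<Rightarrow> 'a) set" where
  "Inn G = (\<lambda>a. \<lambda>x\<in>carrier G. inv\<^bsub>G\<^esub> a \<otimes>\<^bsub>G\<^esub> x \<otimes>\<^bsub>G\<^esub> a) ` carrier G"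

text \<open>
  The automorphism of \<open>G\<close> with \<open>a \<mapsto> a'\<close> and \<open>b \<mapsto> b'\<close>.  This is only meaningful when such an
  automorphism exists; it is unique when \<open>a\<close> and \<open>b\<close> generate \<open>G\<close>.
\<close>

definition auto_sending :: "('a, 'b) monoid_scheme \<Rightarrow> 'a \<Rightarrow> 'a \<Rightarrow> 'a \<Rightarrow> 'a \<Rightarrow> 'a \<Rightarrow> 'a" where
  "auto_sending G a b a' b' = (THE f. f \<in> auto G \<and> f a = a' \<and> f b = b')"

lemma (in group) center_normal: "center G \<lhd> G"
proof -
  have "subgroup (center G) G"
  proof (rule subgroupI)
    show "center G \<noteq> {}" using one_closed by (force simp: center_def)
  next
    fix a assume "a \<in> center G"
    then have a: "a \<in> carrier G" "\<And>x. x \<in> carrier G \<Longrightarrow> a \<otimes> x = x \<otimes> a"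
      by (auto simp: center_def)
    have "inv a \<otimes> x = x \<otimes> inv a" if x: "x \<in> carrier G" for x
    proof -
      have "inv a \<otimes> x = inv a \<otimes> (x \<otimes> a) \<otimes> inv a"
        using a(1) x by (simp add: m_assoc)
      also have "\<dots> = inv a \<otimes> (a \<otimes> x) \<otimes> inv a" by (simp only: a(2)[OF x])
      also have "\<dots> = x \<otimes> inv a" using a(1) x by (simp flip: m_assoc)
      finally show ?thesis .
    qed
    then show "inv a \<in> center G" using a(1) by (simp add: center_def)
  next
    fix a b assume "a \<in> center G" "b \<in> center G"
    then have a: "a \<in> carrier G" "\<And>x. x \<in> carrier G \<Longrightarrow> a \<otimes> x = x \<otimes> a"
      and b: "b \<in> carrier G" "\<And>x. x \<in> carrier G \<Longrightarrow> b \<otimes> x = x \<otimes> b"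
      by (auto simp: center_def)
    have "a \<otimes> b \<otimes> x = x \<otimes> (a \<otimes> b)" if x: "x \<in> carrier G" for x
    proof -
      have "a \<otimes> b \<otimes> x = a \<otimes> (b \<otimes> x)" using a(1) b(1) x by (simp add: m_assoc)
      also have "\<dots> = a \<otimes> (x \<otimes> b)" by (simp only: b(2)[OF x])
      also have "\<dots> = (a \<otimes> x) \<otimes> b" using a(1) b(1) x by (simp add: m_assoc)
      also have "\<dots> = (x \<otimes> a) \<otimes> b" by (simp only: a(2)[OF x])
      finally show ?thesis using a(1) b(1) x by (simp add: m_assoc)
    qed
    then show "a \<otimes> b \<in> center G" using a(1) b(1) by (simp add: center_def)
  qed (auto simp: center_def)
  moreover have "x \<otimes> h \<otimes> inv x \<in> center G" if x: "x \<in> carrier G" and h: "h \<in> center G" for x h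
  proof -
    have comm: "x \<otimes> h = h \<otimes> x" and hc: "h \<in> carrier G" using x h by (auto simp: center_def)
    have "x \<otimes> h \<otimes> inv x = h \<otimes> x \<otimes> inv x" by (simp only: comm)
    also have "\<dots> = h" using x hc by (simp add: m_assoc)
    finally have "x \<otimes> h \<otimes> inv x = h" .
    then show ?thesis using h by simp
  qed
  ultimately show ?thesis unfolding normal_inv_iff by blast
qed

lemma (in normal) rcos_in_center_iff:
  assumes "x \<in> carrier G"
  shows "H #> x \<in> center (G Mod H) \<longleftrightarrow> (\<forall>y\<in>carrier G. H #> (x \<otimes> y) = H #> (y \<otimes> x))"
  using assms by (auto simp: center_def FactGroup_def RCOSETS_def rcos_sum)

lemma (in group) upper_central_normal: "upper_central G i \<lhd> G"
proof (induction i)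
  case 0
  then show ?case by (simp add: one_is_normal)
next
  case (Suc i)
  let ?Z = "upper_central G i"
  interpret N: normal ?Z G by (rule Suc)
  interpret Q: group "G Mod ?Z" by (rule N.factorgroup_is_group)
  interpret C: normal "center (G Mod ?Z)" "G Mod ?Z" by (rule Q.center_normal)
  interpret h: group_hom G "G Mod ?Z" "\<lambda>x. ?Z #> x"
    using N.r_coset_hom_Mod by unfold_locales
  have mult: "(?Z #> x) \<otimes>\<^bsub>G Mod ?Z\<^esub> (?Z #> y) = ?Z #> (x \<otimes> y)"
    if "x \<in> carrier G" "y \<in> carrier G" for x y
    using that by simp
  show ?case unfolding upper_central.simps normal_inv_iff
  proof (intro conjI ballI subgroupI)
    show "{x \<in> carrier G. ?Z #> x \<in> center (G Mod ?Z)} \<noteq> {}"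
      using C.one_closed h.hom_one by (metis (mono_tags, lifting) empty_iff mem_Collect_eq one_closed)
  next
    fix a assume "a \<in> {x \<in> carrier G. ?Z #> x \<in> center (G Mod ?Z)}"
    then show "inv a \<in> {x \<in> carrier G. ?Z #> x \<in> center (G Mod ?Z)}"
      using C.m_inv_closed by (auto simp del: FactGroup_def)
  next
    fix a b assume "a \<in> {x \<in> carrier G. ?Z #> x \<in> center (G Mod ?Z)}"
      "b \<in> {x \<in> carrier G. ?Z #> x \<in> center (G Mod ?Z)}"
    then show "a \<otimes> b \<in> {x \<in> carrier G. ?Z #> x \<in> center (G Mod ?Z)}"
      using C.m_closed mult by auto
  next
    fix x h assume *: "x \<in> carrier G" "h \<in> {x \<in> carrier G. ?Z #> x \<in> center (G Mod ?Z)}"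
    then have "(?Z #> x) \<otimes>\<^bsub>G Mod ?Z\<^esub> (?Z #> h) \<otimes>\<^bsub>G Mod ?Z\<^esub> inv\<^bsub>G Mod ?Z\<^esub> (?Z #> x)
        \<in> center (G Mod ?Z)"
      using C.inv_op_closed2 by auto
    then show "x \<otimes> h \<otimes> inv x \<in> {x \<in> carrier G. ?Z #> x \<in> center (G Mod ?Z)}"
      using * by (auto simp flip: h.hom_inv)
  qed auto
qed

lemma (in group) image_rcoset_auto:
  assumes "f \<in> auto G" "N \<subseteq> carrier G" "f ` N = N" "x \<in> carrier G"
  shows "f ` (N #> x) = N #> f x"
proof -
  have "f (n \<otimes> x) = f n \<otimes> f x" if "n \<in> N" for n
    using assms that by (auto simp: auto_def hom_def)
  then have "f ` (N #> x) = (\<lambda>n. n \<otimes> f x) ` f ` N"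
    unfolding r_coset_def by force
  then show ?thesis by (auto simp: r_coset_def assms(3))
qed

lemma (in group) auto_upper_central:
  assumes f: "f \<in> auto G"
  shows "f ` upper_central G i = upper_central G i"
proof (induction i)
  case 0
  have "f \<one> = \<one>" using f hom_one[OF _ is_group is_group] by (auto simp: auto_def)
  then show ?case by simp
next
  case (Suc i)
  let ?Z = "upper_central G i"
  interpret N: normal ?Z G by (rule upper_central_normal)
  have img: "f ` carrier G = carrier G" using f by (auto simp: auto_def Bij_def bij_betw_def)
  have inj: "inj_on f (carrier G)" using f by (auto simp: auto_def Bij_def bij_betw_def)
  have fc: "f x \<in> carrier G" if "x \<in> carrier G" for x using that img by blast
  have fm: "f (x \<otimes> y) = f x \<otimes> f y" if "x \<in> carrier G" "y \<in> carrier G" for x y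
    using that f by (auto simp: auto_def hom_def)
  have sub: "?Z #> x \<subseteq> carrier G" if "x \<in> carrier G" for x
    using that N.subset r_coset_subset_G by blast
  have eq: "?Z #> f x = ?Z #> f y \<longleftrightarrow> ?Z #> x = ?Z #> y"
    if "x \<in> carrier G" "y \<in> carrier G" for x y
    using image_rcoset_auto[OF f N.subset Suc] that inj_on_image_eq_iff[OF inj sub sub] by metis
  have "?Z #> f x \<in> center (G Mod ?Z) \<longleftrightarrow> ?Z #> x \<in> center (G Mod ?Z)"
    if x: "x \<in> carrier G" for x
  proof -
    have "?Z #> f x \<in> center (G Mod ?Z)
        \<longleftrightarrow> (\<forall>y\<in>f ` carrier G. ?Z #> (f x \<otimes> y) = ?Z #> (y \<otimes> f x))"
      using N.rcos_in_center_iff[OF fc[OF x]] img by simp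
    also have "\<dots> \<longleftrightarrow> (\<forall>y\<in>carrier G. ?Z #> (x \<otimes> y) = ?Z #> (y \<otimes> x))"
      using eq x by (auto simp flip: fm)
    finally show ?thesis using N.rcos_in_center_iff[OF x] by simp
  qed
  then show ?case using img fc by (auto simp: image_iff) (metis imageE)
qed

lemma (in group) canonical_map_hom:
  "canonical_map G (upper_central G i) \<in> hom (AutoGroup G) (AutoGroup (G Mod upper_central G i))"
proof -
  let ?Z = "upper_central G i" and ?Q = "G Mod upper_central G i"
  let ?c = "canonical_map G ?Z"
  interpret N: normal ?Z G by (rule upper_central_normal)
  have carQ: "carrier ?Q = (\<lambda>x. ?Z #> x) ` carrier G"
    by (auto simp: FactGroup_def RCOSETS_def)
  have val: "?c f (?Z #> x) = ?Z #> f x" if "f \<in> auto G" "x \<in> carrier G" for f x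
    using that image_rcoset_auto[OF that(1) N.subset auto_upper_central[OF that(1)] that(2)]
    by (simp add: canonical_map_def carQ)
  have fc: "f x \<in> carrier G" if "f \<in> auto G" "x \<in> carrier G" for f x
    using that by (auto simp: auto_def hom_def)
  have fm: "f (x \<otimes> y) = f x \<otimes> f y" if "f \<in> auto G" "x \<in> carrier G" "y \<in> carrier G" for f x y
    using that by (auto simp: auto_def hom_def)
  have sub: "X \<subseteq> carrier G" if "X \<in> carrier ?Q" for X
    using that N.subset r_coset_subset_G unfolding carQ by blast
  have car: "?c f \<in> auto ?Q" if f: "f \<in> auto G" for f
  proof -
    have img: "f ` carrier G = carrier G" and inj: "inj_on f (carrier G)"
      using f by (auto simp: auto_def Bij_def bij_betw_def)
    have "?c f \<in> hom ?Q ?Q"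
    proof (rule homI)
      fix X assume "X \<in> carrier ?Q"
      then show "?c f X \<in> carrier ?Q" using f fc by (auto simp: carQ val)
    next
      fix X Y assume "X \<in> carrier ?Q" "Y \<in> carrier ?Q"
      then obtain x y where "X = ?Z #> x" "x \<in> carrier G" "Y = ?Z #> y" "y \<in> carrier G"
        by (auto simp: carQ)
      then show "?c f (X \<otimes>\<^bsub>?Q\<^esub> Y) = ?c f X \<otimes>\<^bsub>?Q\<^esub> ?c f Y"
        using f fc by (simp add: val fm N.rcos_sum)
    qed
    moreover have "?c f \<in> extensional (carrier ?Q)" by (simp add: canonical_map_def)
    moreover have "inj_on (?c f) (carrier ?Q)"
      by (rule inj_onI) (use inj_on_image_eq_iff[OF inj sub sub] in \<open>simp add: canonical_map_def\<close>)
    moreover have "?c f ` carrier ?Q = (\<lambda>x. ?Z #> x) ` f ` carrier G"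
      unfolding carQ image_image using val[OF f] by simp
    then have "?c f ` carrier ?Q = carrier ?Q" by (simp add: img carQ)
    ultimately show ?thesis by (simp add: auto_def Bij_def bij_betw_def)
  qed
  have "?c (compose (carrier G) f g) = compose (carrier ?Q) (?c f) (?c g)"
    if f: "f \<in> auto G" and g: "g \<in> auto G" for f g
  proof
    fix X
    have "(\<lambda>x. compose (carrier G) f g x) ` X = f ` g ` X" if "X \<in> carrier ?Q"
      using sub[OF that] by (force simp: compose_def)
    moreover have "g ` X \<in> carrier ?Q" if "X \<in> carrier ?Q"
    proof -
      have "?c g X \<in> carrier ?Q" using car[OF g] that by (auto simp: auto_def hom_def)
      then show ?thesis using that by (simp add: canonical_map_def)
    qed
    ultimately show "?c (compose (carrier G) f g) X = compose (carrier ?Q) (?c f) (?c g) X"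
      by (simp add: canonical_map_def compose_def)
  qed
  then show ?thesis
    using car by (auto simp: hom_def AutoGroup_def BijGroup_def auto_def)
qed


section \<open>The groups \<open>J\<close> and \<open>H = J/Z(J)\<close> and their automorphisms\<close>

datatype gen = GenA | GenB

definition J_alpha :: "nat \<Rightarrow> int \<Rightarrow> int" where
  "J_alpha m l = 1 + 2 ^ m * l"

definition J_relations :: "nat \<Rightarrow> int \<Rightarrow> (gen word \<times> gen word) set" where
  "J_relations m l =
     (let A = letter GenA; B = letter GenB in
      {(word_conj A (word_comm A B), word_pow A (J_alpha m l)),
       (word_conj B (word_comm B A), word_pow B (J_alpha m l)),
       (word_pow A (2 ^ (3 * m - 1)), []),
       (word_pow B (2 ^ (3 * m - 1)), [])})"

definition J_group :: "nat \<Rightarrow> int \<Rightarrow> gen word set monoid" where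
  "J_group m l = presented_group (J_relations m l)"

definition H_group :: "nat \<Rightarrow> int \<Rightarrow> gen word set set monoid" where
  "H_group m l = J_group m l Mod center (J_group m l)"

text \<open>The images in \<open>H\<close> of the generators \<open>A\<close> and \<open>B\<close> of \<open>J\<close>.\<close>

definition H_gen :: "nat \<Rightarrow> int \<Rightarrow> gen \<Rightarrow> gen word set set" where
  "H_gen m l x =
     center (J_group m l) #>\<^bsub>J_group m l\<^esub> word_class (J_relations m l) (letter x)"

definition H_auto :: "nat \<Rightarrow> int \<Rightarrow> gen word set set \<Rightarrow> gen word set set
    \<Rightarrow> gen word set set \<Rightarrow> gen word set set" where
  "H_auto m l = auto_sending (H_group m l) (H_gen m l GenA) (H_gen m l GenB)"

definition nu :: "nat \<Rightarrow> int \<Rightarrow> gen word set set \<Rightarrow> gen word set set" where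
  "nu m l = H_auto m l (H_gen m l GenB) (H_gen m l GenA)"

definition Gamma :: "nat \<Rightarrow> int \<Rightarrow> gen word set set \<Rightarrow> gen word set set" where
  "Gamma m l =
     (let H = H_group m l; A = H_gen m l GenA; B = H_gen m l GenB; s = (2::nat) ^ (m - 1)
      in H_auto m l (A [^]\<^bsub>H\<^esub> (1 + s)) (B \<otimes>\<^bsub>H\<^esub> A [^]\<^bsub>H\<^esub> s))"

definition Sigma1 :: "nat \<Rightarrow> int \<Rightarrow> gen word set set \<Rightarrow> gen word set set" where
  "Sigma1 m l =
     (let H = H_group m l; A = H_gen m l GenA; B = H_gen m l GenB; r = (2::nat) ^ (m - 2)
      in if m > 2
         then H_auto m l (A [^]\<^bsub>H\<^esub> (1 + r) \<otimes>\<^bsub>H\<^esub> B [^]\<^bsub>H\<^esub> r) (B [^]\<^bsub>H\<^esub> (1 + r) \<otimes>\<^bsub>H\<^esub> A [^]\<^bsub>H\<^esub> r)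
         else \<one>\<^bsub>AutoGroup H\<^esub>)"

lemma group_J_group: "group (J_group m l)"
  by (simp add: J_group_def group_presented_group)

lemma group_H_group: "group (H_group m l)"
  by (simp add: H_group_def group.center_normal group_J_group normal.factorgroup_is_group)

end

theory Submission
  imports Defs "HOL-Number_Theory.Cong"
begin

text \<open>
  Both \<open>J\<close> and \<open>H\<close> are described by coordinates: every element is
  \<open>A^i C^k B^j\<close> with \<open>C=[A,B]\<close>. All statements about automorphisms then
  become congruences between integers modulo powers of \<open>2\<close>, and these are decided by
  polynomial identities.

  \<^bold>\<open>The group \<open>J\<close>.\<close> The first relation says
  \<open>AC=CA^\<alpha>\<close> and the second \<open>CB=B^\<alpha> C\<close>. They allow one to
  collect a word into the form \<open>A^i C^k B^j\<close>, and right multiplication by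
  \<open>A\<close>, \<open>B\<close> and \<open>C\<close> acts on the exponents by explicit
  polynomial maps (\<open>actA\<close>, \<open>actB\<close>, \<open>actC\<close>). Conversely
  these maps act on \<open>\<int>^3\<close> modulo a lattice and satisfy the relations of
  \<open>J\<close> (\<open>act_relations\<close>), so there is no collapse: triples that the
  lattice separates give distinct elements (\<open>E_eq_imp_eqv\<close>). Collecting
  \<open>B^\<alpha> AC\<close> in two ways shows that \<open>A^q\<close> and \<open>B^q\<close>
  are central for \<open>q=2^(2m-1)\<close>, and the model shows that \<open>Z(J)\<close> is no
  larger (\<open>center_eq\<close>).

  \<^bold>\<open>The group \<open>H\<close>.\<close> Consequently \<open>H\<close> is the set of
  triples modulo \<open>q\<close> with a polynomial multiplication (locale
  \<open>macdonald_H\<close>, lemma \<open>macdonald_H_H_group\<close>). Since \<open>Z(J)\<close>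
  is generated by \<open>A^q\<close> and \<open>B^q\<close>, a pair \<open>(X,Y)\<close> of
  elements of \<open>H\<close> is the image of \<open>(A,B)\<close> under an endomorphism if and
  only if it satisfies the two relations and \<open>X^q=Y^q=1\<close>. The upper central series is
  read off from the multiplication: its terms are given by divisibility of the exponents, and
  \<open>H/Z_3(H)\<close> is \<open>(\<int>/2^(m-1))^2\<close>, with the exponents of
  \<open>A\<close> and \<open>B\<close> as coordinates (\<open>upper_central_eqs\<close>).

  \<^bold>\<open>Admissible pairs.\<close> For \<open>X=A^a C^k B^b\<close> and \<open>Y=A^c
  C^(k') B^d\<close> the relations become congruences (\<open>pair_iff\<close>), and an
  endomorphism is bijective if and only if \<open>ad-bc\<close> is odd (\<open>pair_auto\<close>,
  \<open>auto_det_odd\<close>). So an automorphism is seen through its matrix modulo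
  \<open>2^m\<close> (\<open>mat\<close>), and these matrices multiply (\<open>mat_mult\<close>).
  The congruences force the matrix to be congruent modulo \<open>2\<close> to the identity or to
  the swap, so composing with \<open>\<nu>\<close> makes the diagonal odd. They then force
  \<open>2b \<equiv> 0\<close> modulo \<open>2^(m-1)\<close>, so composing with
  \<open>\<Sigma>\<close> makes \<open>b\<close> divisible by \<open>2^(m-1)\<close>. After that
  they leave exactly \<open>a \<equiv> d \<equiv> 1\<close> and \<open>b \<equiv> c \<equiv>
  0\<close> modulo \<open>2^(m-1)\<close> together with \<open>a-1 \<equiv> c\<close> and
  \<open>d-1 \<equiv> b\<close> modulo \<open>2^m\<close>, with \<open>k\<close> and
  \<open>k'\<close> arbitrary (\<open>pair_nec\<close>, \<open>pair_suf\<close>). This is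
  \<open>Aut_3(H)\<close>, whence the image of \<open>\<zeta>\<close> and, by counting solutions,
  \<open>|Aut_3(H)|=q^4=2^(8m-4)\<close> (\<open>card_Aut3\<close>).

  \<^bold>\<open>From \<open>Aut_3\<close> to \<open>Aut_2\<close>.\<close> Modulo
  \<open>2^m\<close> the matrices just found depend on two bits, which \<open>\<Gamma>\<close> and
  its conjugate under \<open>\<nu>\<close> switch off. An automorphism whose matrix is trivial
  modulo \<open>2^m\<close> agrees modulo \<open>Z_2(H)\<close> with conjugation by \<open>A^(-k')
  B^k\<close> (\<open>near_identity\<close>).
\<close>

section \<open>Arithmetic of the exponents\<close>

lemma even_square_add: "even (j ^ 2 + j :: int)" and even_square_diff: "even (j ^ 2 - j :: int)"
  by (auto simp: power2_eq_square)

lemma six_dvd_cube_diff: "6 dvd (j ^ 3 - j :: int)"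
proof -
  have "even (j ^ 3 - j)" by simp
  moreover have "(3::int) dvd j ^ 3 - j"
  proof -
    have "j mod 3 = 0 \<or> j mod 3 = 1 \<or> j mod 3 = 2" by presburger
    then obtain t where "j = 3 * t \<or> j = 3 * t + 1 \<or> j = 3 * t + 2"
      by (metis mult_div_mod_eq add.right_neutral)
    then show ?thesis
    proof (elim disjE)
      assume "j = 3 * t"
      then have "j ^ 3 - j = 3 * (9 * t ^ 3 - t)" by (simp add: power3_eq_cube)
      then show ?thesis by simp
    next
      assume "j = 3 * t + 1"
      then have "j ^ 3 - j = 3 * (9 * t ^ 3 + 9 * t ^ 2 + 2 * t)"
        by (simp add: power3_eq_cube power2_eq_square algebra_simps)
      then show ?thesis by simp
    next
      assume "j = 3 * t + 2"
      then have "j ^ 3 - j = 3 * (9 * t ^ 3 + 18 * t ^ 2 + 11 * t + 2)"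
        by (simp add: power3_eq_cube power2_eq_square algebra_simps)
      then show ?thesis by simp
    qed
  qed
  ultimately show ?thesis by presburger
qed

lemma binomials:
  "2 * int (n choose 2) = int n ^ 2 - int n" "6 * int (n choose 3) = int n * (int n - 1) * (int n - 2)"
proof -
  show b2: "2 * int (n choose 2) = int n ^ 2 - int n" for n
  proof (induction n)
    case (Suc n)
    then show ?case by (simp add: numeral_2_eq_2 algebra_simps power2_eq_square)
  qed simp
  show "6 * int (n choose 3) = int n * (int n - 1) * (int n - 2)"
  proof (induction n)
    case (Suc n)
    have "int (Suc n choose 3) = int (n choose 2) + int (n choose 3)"
      by (simp add: numeral_3_eq_3 numeral_2_eq_2)
    then show ?case using Suc b2[of n] by (simp add: algebra_simps power2_eq_square)
  qed simp
qed

lemma choose_Suc: "int (Suc n choose 2) = int n + int (n choose 2)"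
  "int (Suc n choose 3) = int (n choose 2) + int (n choose 3)"
  by (simp_all add: numeral_2_eq_2 numeral_3_eq_3)

lemma cong_trans_dvd: "[x = y] (mod k) \<Longrightarrow> k dvd y - z \<Longrightarrow> [x = z] (mod k :: int)"
  using cong_trans cong_iff_dvd_diff by blast

text \<open>
  The parameter is \<open>\<nu>=2^(m-2)l\<close>, so that \<open>\<alpha>=1+4\<nu>\<close>. Only
  \<open>\<alpha>\<close> modulo the order \<open>2^(3m-1)\<close> of the generators matters, so
  \<open>\<nu>\<close> may be taken positive; \<open>\<alpha>\<close> is then a natural number and
  raising to the power \<open>\<alpha>\<close> is iteration.
\<close>

locale macdonald_params =
  fixes m :: nat and \<nu> :: int
  assumes m_ge_2: "m \<ge> 2" and nu_form: "\<exists>h. odd h \<and> \<nu> = 2 ^ (m - 2) * h" and nu_pos: "\<nu> > 0"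
begin

definition q :: int where "q = 2 ^ (2 * m - 1)"
definition M :: int where "M = 2 ^ (3 * m - 1)"
definition s :: int where "s = 2 ^ (m - 1)"
definition w :: int where "w = 2 ^ m"

text \<open>
  \<open>P k\<close> is \<open>\<alpha>^k\<close> and \<open>g j\<close> is
  \<open>\<alpha>+\<alpha>^2+...+\<alpha>^j\<close>, both modulo \<open>M\<close>: the binomial
  expansions stop where \<open>32 \<nu>\<^sup>3\<close>, a multiple of \<open>M\<close>, appears.
  The polynomials make sense for negative arguments too. They are the exponents in \<open>C^k
  A=A^(\<alpha>^(-k)) C^k\<close> and \<open>B^j A=AC^(-j) B^(g(j))\<close>.
\<close>

definition P :: "int \<Rightarrow> int" where
  "P k = 1 + 4 * \<nu> * k + 8 * \<nu> ^ 2 * (k ^ 2 - k)"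

definition g :: "int \<Rightarrow> int" where
  "g j = j + 2 * \<nu> * (j ^ 2 + j) + 16 * \<nu> ^ 2 * ((j ^ 3 - j) div 6)"

lemma two_powers: "w = 4 * 2 ^ (m - 2)" "s = 2 * 2 ^ (m - 2)" "q = 8 * (2 ^ (m - 2)) ^ 2"
  "M = 32 * (2 ^ (m - 2)) ^ 3"
proof -
  obtain k where "m = k + 2" using m_ge_2 by (metis add.commute le_Suc_ex)
  then show "w = 4 * 2 ^ (m - 2)" "s = 2 * 2 ^ (m - 2)" "q = 8 * (2 ^ (m - 2)) ^ 2"
    "M = 32 * (2 ^ (m - 2)) ^ 3"
    unfolding w_def s_def q_def M_def
    by (simp_all add: power_add power_mult power2_eq_square power3_eq_cube mult.commute
        flip: power_mult_distrib)
qed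

lemma q_dvd: "q dvd 8 * \<nu> ^ 2" and M_dvd: "M dvd 32 * \<nu> ^ 3" and w_dvd: "w dvd 4 * \<nu>"
  and s_dvd: "s dvd 2 * \<nu>"
proof -
  obtain h where "\<nu> = 2 ^ (m - 2) * h" using nu_form by blast
  then have "8 * \<nu> ^ 2 = q * h ^ 2" "32 * \<nu> ^ 3 = M * h ^ 3" "4 * \<nu> = w * h" "2 * \<nu> = s * h"
    by (simp_all add: two_powers power_mult_distrib)
  then show "q dvd 8 * \<nu> ^ 2" "M dvd 32 * \<nu> ^ 3" "w dvd 4 * \<nu>" "s dvd 2 * \<nu>" by simp_all
qed

lemma M_eq: "M = w * q" and q_eq: "q = w * s" and w_eq: "w = 2 * s"
  by (simp_all add: two_powers power2_eq_square power3_eq_cube)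

lemma positive [simp]: "w > 0" "s > 0" "q > 0" "M > 0" and even_s: "even s"
  using m_ge_2 by (simp_all add: w_def s_def q_def M_def)

lemma nonzero [simp]: "w \<noteq> 0" "s \<noteq> 0" "q \<noteq> 0" "M \<noteq> 0"
  using positive by (metis less_irrefl)+

lemma dvd_4nu_iff: "q dvd 4 * \<nu> * x \<longleftrightarrow> s dvd x" and dvd_2nu_iff: "q dvd 2 * \<nu> * x \<longleftrightarrow> w dvd x"
  and M_dvd_4nu_iff: "M dvd 4 * \<nu> * x \<longleftrightarrow> q dvd x"
proof -
  obtain h where h: "odd h" "\<nu> = 2 ^ (m - 2) * h" using nu_form by blast
  have c: "coprime (2 ^ n) h" for n using h(1) by simp
  have "4 * \<nu> * x = w * (h * x)" by (simp add: two_powers h)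
  then have "q dvd 4 * \<nu> * x \<longleftrightarrow> s dvd h * x" "M dvd 4 * \<nu> * x \<longleftrightarrow> q dvd h * x"
    unfolding q_eq M_eq by (simp_all only: dvd_mult_cancel_left nonzero simp_thms)
  then show "q dvd 4 * \<nu> * x \<longleftrightarrow> s dvd x" "M dvd 4 * \<nu> * x \<longleftrightarrow> q dvd x"
    unfolding s_def q_def coprime_dvd_mult_right_iff[OF c] by simp_all
  have "2 * \<nu> * x = s * (h * x)" "q = s * w" by (simp_all add: q_eq two_powers h)
  then have "q dvd 2 * \<nu> * x \<longleftrightarrow> w dvd h * x" using dvd_mult_cancel_left[of s] by (simp only: dvd_mult_cancel_left nonzero simp_thms)
  then show "q dvd 2 * \<nu> * x \<longleftrightarrow> w dvd x" unfolding w_def coprime_dvd_mult_right_iff[OF c] .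
qed

lemma cube6: "6 * ((j ^ 3 - j) div 6) = (j ^ 3 - j :: int)"
  using six_dvd_cube_diff by simp

lemma P_0 [simp]: "P 0 = 1" and P_1: "P 1 = 1 + 4 * \<nu>" and P_m1: "P (- 1) = 1 - 4 * \<nu> + 16 * \<nu> ^ 2"
  by (simp_all add: P_def)

lemma g_0 [simp]: "g 0 = 0" by (simp add: g_def)

lemma P_add: "[P (k + k') = P k * P k'] (mod M)"
proof -
  have "P k * P k' - P (k + k')
      = 32 * \<nu> ^ 3 * (k * (k' ^ 2 - k') + k' * (k ^ 2 - k) + 2 * \<nu> * (k ^ 2 - k) * (k' ^ 2 - k'))"
    by (simp add: P_def algebra_simps power2_eq_square power3_eq_cube)
  then have "M dvd P k * P k' - P (k + k')" using M_dvd by (metis dvd_mult2)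
  then show ?thesis by (metis cong_iff_dvd_diff cong_sym)
qed

lemma g_Suc: "[g (j + 1) = (1 + 4 * \<nu>) * (g j + 1)] (mod M)"
proof -
  have c: "((j + 1) ^ 3 - (j + 1)) div 6 = (j ^ 3 - j) div 6 + (j ^ 2 + j) div 2"
  proof -
    have "6 * ((j ^ 3 - j) div 6 + (j ^ 2 + j) div 2) = (j ^ 3 - j) + 3 * (2 * ((j ^ 2 + j) div 2))"
      by (simp only: distrib_left cube6)
    also have "\<dots> = (j + 1) ^ 3 - (j + 1)"
      using even_square_add[of j] by (simp add: algebra_simps power2_eq_square power3_eq_cube)
    also have "\<dots> = 6 * (((j + 1) ^ 3 - (j + 1)) div 6)" by (simp only: cube6)
    finally show ?thesis by simp
  qed
  obtain p where p: "j ^ 2 + j = 2 * p" using even_square_add[of j] by blast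
  then have "j ^ 2 = 2 * p - j" by simp
  then have "(1 + 4 * \<nu>) * (g j + 1) - g (j + 1) = 32 * \<nu> ^ 3 * (2 * ((j ^ 3 - j) div 6))"
    unfolding g_def c using p
    by (simp add: algebra_simps power2_eq_square power3_eq_cube)
  then have "M dvd (1 + 4 * \<nu>) * (g j + 1) - g (j + 1)" using M_dvd by (metis dvd_mult2)
  then show ?thesis by (metis cong_iff_dvd_diff cong_sym)
qed

lemma three_g: "3 * g j = 3 * j + 6 * \<nu> * (j ^ 2 + j) + 8 * \<nu> ^ 2 * (j ^ 3 - j)"
proof -
  have "3 * g j = 3 * j + 6 * \<nu> * (j ^ 2 + j) + 8 * \<nu> ^ 2 * (6 * ((j ^ 3 - j) div 6))"
    by (simp add: g_def algebra_simps)
  then show ?thesis by (simp only: cube6)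
qed

text \<open>
  Formulas with a denominator \<open>3\<close> or \<open>6\<close> are proved after multiplication
  by \<open>3\<close>, which is a unit modulo a power of \<open>2\<close>.
\<close>

lemma dvd_third: "q dvd 3 * x \<Longrightarrow> q dvd x" "M dvd 3 * x \<Longrightarrow> M dvd x" "2 * q dvd 3 * x \<Longrightarrow> 2 * q dvd x"
proof -
  have "coprime (2 ^ n) (3::int)" for n by simp
  moreover have "2 * q = 2 ^ (2 * m)" unfolding q_def using m_ge_2 by (simp flip: power_Suc)
  ultimately show "q dvd 3 * x \<Longrightarrow> q dvd x" "M dvd 3 * x \<Longrightarrow> M dvd x" "2 * q dvd 3 * x \<Longrightarrow> 2 * q dvd x"
    unfolding q_def M_def by (metis coprime_dvd_mult_right_iff)+
qed

lemma M_dvdI: "x = 32 * \<nu> ^ 3 * y \<Longrightarrow> M dvd x" and q_dvdI: "x = 8 * \<nu> ^ 2 * y \<Longrightarrow> q dvd x"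
  using M_dvd q_dvd by (metis dvd_mult2)+

lemma two_q_dvdI: "x = 16 * \<nu> ^ 2 * y \<Longrightarrow> 2 * q dvd x"
proof -
  assume "x = 16 * \<nu> ^ 2 * y"
  then have "x = 2 * (8 * \<nu> ^ 2 * y)" by simp
  then show ?thesis using q_dvd by (metis dvd_mult2 mult_dvd_mono dvd_refl)
qed

lemma q_dvd_M: "q dvd M" and two_q_dvd_M: "2 * q dvd M"
  by (simp_all add: M_eq w_eq)

lemma cong_M_imp_q: "[x = y] (mod M) \<Longrightarrow> [x = y] (mod q)"
  and cong_M_imp_2q: "[x = y] (mod M) \<Longrightarrow> [x = y] (mod 2 * q)"
  and cong_2q_imp_q: "[x = y] (mod 2 * q) \<Longrightarrow> [x = y] (mod q)"
  using q_dvd_M two_q_dvd_M by (auto intro: cong_dvd_modulus)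

lemma cong_times_nu:
  assumes "[x = y] (mod q)"
  shows "[4 * \<nu> * x = 4 * \<nu> * y] (mod M)"
  using assms M_dvd_4nu_iff[of "x - y"] by (simp add: cong_iff_dvd_diff right_diff_distrib)

lemma P_cong:
  assumes "[x = y] (mod q)"
  shows "[P x = P y] (mod M)"
proof -
  have "[x + 2 * \<nu> * (x ^ 2 - x) = y + 2 * \<nu> * (y ^ 2 - y)] (mod q)"
    using assms by (intro cong_add cong_mult cong_diff cong_pow cong_refl)
  then have "[1 + 4 * \<nu> * (x + 2 * \<nu> * (x ^ 2 - x)) = 1 + 4 * \<nu> * (y + 2 * \<nu> * (y ^ 2 - y))] (mod M)"
    by (intro cong_add[OF cong_refl] cong_times_nu)
  then show ?thesis by (simp add: P_def algebra_simps power2_eq_square)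
qed

lemma g_cong:
  assumes "[x = y] (mod M)"
  shows "[g x = g y] (mod M)"
proof -
  have "[3 * g x = 3 * g y] (mod M)"
    unfolding three_g using assms by (intro cong_add cong_mult cong_diff cong_pow cong_refl)
  then show ?thesis using dvd_third(2)[of "g x - g y"] by (simp add: cong_iff_dvd_diff right_diff_distrib)
qed

text \<open>
  The data of \<open>n\<close> right multiplications by \<open>A\<close>: the exponent of
  \<open>B\<close> runs through the iterates of \<open>g\<close>, the exponent of \<open>C\<close>
  drops by \<open>g_sum\<close>, and the exponent of \<open>A\<close> grows by a multiple of
  \<open>P_sum\<close>. The next three lemmas give these quantities in closed form. The sum is
  needed modulo \<open>2 * q\<close>, because the exponent of \<open>C\<close> enters the lattice
  of the model multiplied by \<open>s\<close> and \<open>s * (2 * q) = M\<close>.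
\<close>

definition g_sum :: "nat \<Rightarrow> int \<Rightarrow> int" where "g_sum n j = (\<Sum>t<n. (g ^^ t) j)"
definition P_sum :: "nat \<Rightarrow> int \<Rightarrow> int" where "P_sum n j = (\<Sum>t<n. P (g_sum t j))"

lemma g_iterate:
  assumes "j ^ 2 + j = 2 * p"
  shows "[(g ^^ n) j = j + 4 * \<nu> * int n * p + 16 * \<nu> ^ 2 * int n * ((j ^ 3 - j) div 6)
      + 8 * \<nu> ^ 2 * int (n choose 2) * p * (2 * j + 1)
      + 16 * \<nu> ^ 3 * int (n choose 3) * p * (2 * j + 1) ^ 2] (mod M)" (is "[_ = ?f n] (mod M)")
proof (induction n)
  case (Suc n)
  define c D where "c = (j ^ 3 - j) div 6" and "D = 2 * j + 1"
  \<comment> \<open>The \<open>n\<close>-th iterate has the form \<open>j + 4 * \<nu> * y\<close>, so \<open>g\<close> is expanded around \<open>j\<close> in powers of \<open>4 * \<nu> * y\<close>.\<close>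
  define y where "y = int n * p + 4 * \<nu> * int n * c + 2 * \<nu> * int (n choose 2) * p * D
      + 4 * \<nu> ^ 2 * int (n choose 3) * p * D ^ 2"
  have fn: "?f n = j + 4 * \<nu> * y"
    by (simp add: y_def c_def D_def algebra_simps power2_eq_square power3_eq_cube)
  have fS: "?f (Suc n) = j + 4 * \<nu> * y + 4 * \<nu> * p + 16 * \<nu> ^ 2 * c + 8 * \<nu> ^ 2 * int n * p * D
      + 16 * \<nu> ^ 3 * int (n choose 2) * p * D ^ 2"
    unfolding choose_Suc y_def c_def[symmetric] D_def[symmetric]
    by (simp add: algebra_simps power2_eq_square power3_eq_cube)
  have j3: "j ^ 3 - j = 6 * c" by (simp add: c_def cube6)
  have "3 * g (j + 4 * \<nu> * y) = 3 * j + 12 * \<nu> * y + 6 * \<nu> * (j ^ 2 + j) + 8 * \<nu> ^ 2 * (j ^ 3 - j)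
      + 24 * \<nu> ^ 2 * y * (D + 4 * \<nu> * y)
      + 32 * \<nu> ^ 3 * y * (3 * j ^ 2 - 1 + 12 * \<nu> * j * y + 16 * \<nu> ^ 2 * y ^ 2)"
    unfolding three_g D_def by (simp add: algebra_simps power2_eq_square power3_eq_cube)
  then have "3 * g (?f n) - 3 * ?f (Suc n) = 24 * \<nu> ^ 2 * D * (y - int n * p - 2 * \<nu> * int (n choose 2) * p * D)
      + 32 * \<nu> ^ 3 * (3 * y ^ 2 + y * (3 * j ^ 2 - 1 + 12 * \<nu> * j * y + 16 * \<nu> ^ 2 * y ^ 2))"
    unfolding fS fn unfolding assms j3 by (simp add: algebra_simps power2_eq_square power3_eq_cube)
  also have "\<dots> = 32 * \<nu> ^ 3 * (3 * D * (int n * c + \<nu> * int (n choose 3) * p * D ^ 2) + 3 * y ^ 2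
      + y * (3 * j ^ 2 - 1 + 12 * \<nu> * j * y + 16 * \<nu> ^ 2 * y ^ 2))"
    by (simp add: y_def algebra_simps power2_eq_square power3_eq_cube)
  finally have "M dvd 3 * (g (?f n) - ?f (Suc n))" unfolding right_diff_distrib by (rule M_dvdI)
  then have "[g (?f n) = ?f (Suc n)] (mod M)" unfolding cong_iff_dvd_diff by (rule dvd_third)
  from cong_trans[OF g_cong[OF Suc] this] show ?case by (simp only: funpow.simps o_apply)
qed (simp add: binomial_eq_0)

lemma g_sum_cong:
  assumes "j ^ 2 + j = 2 * p"
  shows "[g_sum n j = int n * j + 4 * \<nu> * int (n choose 2) * p
      + 8 * \<nu> ^ 2 * int (n choose 3) * p * (2 * j + 1)] (mod 2 * q)" (is "[_ = ?f n] (mod _)")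
proof (induction n)
  case (Suc n)
  let ?h = "j + 4 * \<nu> * int n * p + 8 * \<nu> ^ 2 * int (n choose 2) * p * (2 * j + 1)"
  let ?d = "16 * \<nu> ^ 2 * int n * ((j ^ 3 - j) div 6)
      + 16 * \<nu> ^ 3 * int (n choose 3) * p * (2 * j + 1) ^ 2"
  have "[(g ^^ n) j = ?h + ?d] (mod 2 * q)"
    using cong_M_imp_2q[OF g_iterate[OF assms, of n]] by (simp add: algebra_simps)
  moreover have "2 * q dvd ?d"
    by (rule two_q_dvdI[of _ "int n * ((j ^ 3 - j) div 6) + \<nu> * int (n choose 3) * p * (2 * j + 1) ^ 2"])
      (simp add: algebra_simps power2_eq_square power3_eq_cube)
  then have "[?h + ?d = ?h] (mod 2 * q)" by (simp add: cong_iff_dvd_diff)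
  ultimately have "[(g ^^ n) j = ?h] (mod 2 * q)" by (rule cong_trans)
  then have "[g_sum (Suc n) j = ?f n + ?h] (mod 2 * q)" using Suc by (simp add: g_sum_def cong_add)
  then show ?case unfolding choose_Suc by (simp add: algebra_simps)
qed (simp add: g_sum_def binomial_eq_0)

lemma P_sum_cong:
  assumes "j ^ 2 + j = 2 * p"
  shows "[P_sum n j = int n + 4 * \<nu> * j * int (n choose 2) + 16 * \<nu> ^ 2 * p * int (n choose 3)
      + 8 * \<nu> ^ 2 * (2 * j ^ 2 * int (n choose 3) + (j ^ 2 - j) * int (n choose 2))] (mod M)"
    (is "[_ = ?f n] (mod _)")
proof (induction n)
  case (Suc n)
  define b where "b = int (n choose 2)"
  have b: "int n ^ 2 = 2 * b + int n" using binomials(1)[of n] by (simp add: b_def)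
  let ?h = "int n * j + 4 * \<nu> * b * p"
  have "[g_sum n j = ?h + 8 * \<nu> ^ 2 * (int (n choose 3) * p * (2 * j + 1))] (mod q)"
    using cong_2q_imp_q[OF g_sum_cong[OF assms, of n]] by (simp add: algebra_simps b_def)
  moreover have "[?h + 8 * \<nu> ^ 2 * (int (n choose 3) * p * (2 * j + 1)) = ?h] (mod q)"
    using q_dvd by (simp add: cong_iff_dvd_diff)
  ultimately have 1: "[P (g_sum n j) = P ?h] (mod M)" by (meson P_cong cong_trans)
  let ?e = "1 + 4 * \<nu> * j * int n + 16 * \<nu> ^ 2 * p * b + 8 * \<nu> ^ 2 * (2 * j ^ 2 * b + (j ^ 2 - j) * int n)"
  have "P ?h - ?e = 8 * \<nu> ^ 2 * (j ^ 2 * (int n ^ 2 - 2 * b - int n))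
      + 32 * \<nu> ^ 3 * (b * p * (2 * int n * j + 4 * \<nu> * b * p - 1))"
    unfolding P_def by (simp add: algebra_simps power2_eq_square power3_eq_cube)
  then have "P ?h - ?e = 32 * \<nu> ^ 3 * (b * p * (2 * int n * j + 4 * \<nu> * b * p - 1))"
    by (simp add: b)
  then have "[P ?h = ?e] (mod M)" unfolding cong_iff_dvd_diff by (rule M_dvdI)
  with 1 have "[P (g_sum n j) = ?e] (mod M)" by (rule cong_trans)
  then have "[P_sum (Suc n) j = ?f n + ?e] (mod M)" using Suc by (simp add: P_sum_def cong_add)
  then show ?case unfolding choose_Suc by (simp add: algebra_simps b_def)
qed (simp add: P_sum_def binomial_eq_0)

definition alpha :: nat where "alpha = nat (1 + 4 * \<nu>)"
definition M_nat :: nat where "M_nat = nat M"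

lemma int_alpha: "int alpha = 1 + 4 * \<nu>" and int_M_nat: "int M_nat = M"
  using nu_pos less_imp_le[OF positive(4)] by (auto simp: alpha_def M_nat_def)

lemma choose_alpha: "int (alpha choose 2) = 2 * \<nu> * (1 + 4 * \<nu>)"
  "3 * int (alpha choose 3) = 2 * \<nu> * (16 * \<nu> ^ 2 - 1)"
  using binomials[of alpha] unfolding int_alpha
  by (simp_all add: algebra_simps power2_eq_square)

text \<open>
  With \<open>n=\<alpha>\<close> the closed forms give the exponents of \<open>A^i C^k B^j
  A^\<alpha>\<close>, which the relation \<open>AC=CA^\<alpha>\<close> compares with one
  multiplication by \<open>A\<close>. The terms in \<open>8 * \<nu> ^ 2\<close> and \<open>16 *
  \<nu> ^ 3\<close> are the defects that survive modulo \<open>M\<close>.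
\<close>

lemma g_sum_alpha:
  assumes "j ^ 2 + j = 2 * p"
  shows "[g_sum alpha j = (1 + 4 * \<nu>) * j + 8 * \<nu> ^ 2 * p] (mod 2 * q)"
proof -
  let ?x = "int alpha * j + 4 * \<nu> * int (alpha choose 2) * p + 8 * \<nu> ^ 2 * int (alpha choose 3) * p * (2 * j + 1)"
  have "3 * (?x - ((1 + 4 * \<nu>) * j + 8 * \<nu> ^ 2 * p))
      = 96 * \<nu> ^ 3 * p + 8 * \<nu> ^ 2 * (3 * int (alpha choose 3)) * p * (2 * j + 1)"
    unfolding int_alpha choose_alpha(1) by (simp add: algebra_simps power2_eq_square power3_eq_cube)
  also have "\<dots> = 16 * \<nu> ^ 2 * (6 * \<nu> * p + \<nu> * (16 * \<nu> ^ 2 - 1) * p * (2 * j + 1))"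
    unfolding choose_alpha(2) by (simp add: algebra_simps power2_eq_square power3_eq_cube)
  finally have "2 * q dvd ?x - ((1 + 4 * \<nu>) * j + 8 * \<nu> ^ 2 * p)"
    by (rule dvd_third(3)[OF two_q_dvdI])
  then show ?thesis by (rule cong_trans_dvd[OF g_sum_cong[OF assms]])
qed

lemma P_sum_alpha: "[P (- 1) * P_sum alpha j = 1 + 8 * \<nu> ^ 2 * j] (mod M)"
proof -
  obtain p where p: "j ^ 2 + j = 2 * p" using even_square_add[of j] by blast
  then have jj: "j ^ 2 - j = 2 * (p - j)" by simp
  let ?x = "int alpha + 4 * \<nu> * j * int (alpha choose 2) + 16 * \<nu> ^ 2 * p * int (alpha choose 3)
      + 8 * \<nu> ^ 2 * (2 * j ^ 2 * int (alpha choose 3) + (j ^ 2 - j) * int (alpha choose 2))"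
  have "3 * (?x - (1 + 4 * \<nu> + 8 * \<nu> ^ 2 * j))
      = 96 * \<nu> ^ 3 * j + 16 * \<nu> ^ 2 * p * (3 * int (alpha choose 3))
        + 16 * \<nu> ^ 2 * j ^ 2 * (3 * int (alpha choose 3)) + 48 * \<nu> ^ 2 * (p - j) * int (alpha choose 2)"
    unfolding int_alpha jj unfolding choose_alpha(1)
    by (simp add: algebra_simps power2_eq_square power3_eq_cube)
  also have "\<dots> = 32 * \<nu> ^ 3 * (3 * j + (p + j ^ 2) * (16 * \<nu> ^ 2 - 1) + 3 * (p - j) * (1 + 4 * \<nu>))"
    unfolding choose_alpha by (simp add: algebra_simps power2_eq_square power3_eq_cube)
  finally have "M dvd ?x - (1 + 4 * \<nu> + 8 * \<nu> ^ 2 * j)"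
    by (rule dvd_third(2)[OF M_dvdI])
  then have "[P_sum alpha j = 1 + 4 * \<nu> + 8 * \<nu> ^ 2 * j] (mod M)"
    by (rule cong_trans_dvd[OF P_sum_cong[OF p]])
  then have "[P (- 1) * P_sum alpha j = P (- 1) * (1 + 4 * \<nu> + 8 * \<nu> ^ 2 * j)] (mod M)"
    by (intro cong_mult cong_refl)
  also have "P (- 1) * (1 + 4 * \<nu> + 8 * \<nu> ^ 2 * j) - (1 + 8 * \<nu> ^ 2 * j)
      = 32 * \<nu> ^ 3 * (2 - j + 4 * \<nu> * j)"
    unfolding P_m1 by (simp add: algebra_simps power2_eq_square power3_eq_cube)
  then have "[P (- 1) * (1 + 4 * \<nu> + 8 * \<nu> ^ 2 * j) = 1 + 8 * \<nu> ^ 2 * j] (mod M)"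
    unfolding cong_iff_dvd_diff by (rule M_dvdI)
  finally show ?thesis .
qed

lemma g_alpha:
  assumes "j ^ 2 + j = 2 * p"
  shows "[P (- 1) * g ((1 + 4 * \<nu>) * j) = (g ^^ alpha) j - 8 * \<nu> ^ 2 * j - 16 * \<nu> ^ 3 * p] (mod M)"
proof -
  let ?c = "(j ^ 3 - j) div 6" and ?D = "2 * j + 1"
  let ?x = "j + 4 * \<nu> * int alpha * p + 16 * \<nu> ^ 2 * int alpha * ?c + 8 * \<nu> ^ 2 * int (alpha choose 2) * p * ?D
      + 16 * \<nu> ^ 3 * int (alpha choose 3) * p * ?D ^ 2"
  let ?y = "j + 4 * \<nu> * (1 + 4 * \<nu>) * p + 16 * \<nu> ^ 2 * ?c + 16 * \<nu> ^ 3 * p"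
  have "3 * (?x - ?y) = 192 * \<nu> ^ 3 * ?c + 48 * \<nu> ^ 3 * p * (2 * (j + 2 * \<nu> * ?D))
      + 16 * \<nu> ^ 3 * (3 * int (alpha choose 3)) * p * ?D ^ 2"
    unfolding int_alpha choose_alpha(1) by (simp add: algebra_simps power2_eq_square power3_eq_cube)
  also have "\<dots> = 32 * \<nu> ^ 3 * (6 * ?c + 3 * p * (j + 2 * \<nu> * ?D) + \<nu> * (16 * \<nu> ^ 2 - 1) * p * ?D ^ 2)"
    unfolding choose_alpha(2) by (simp add: algebra_simps power2_eq_square power3_eq_cube)
  finally have "M dvd ?x - ?y" by (rule dvd_third(2)[OF M_dvdI])
  then have x: "[(g ^^ alpha) j = ?y] (mod M)"
    by (rule cong_trans_dvd[OF g_iterate[OF assms]])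
  have "3 * (P (- 1) * g ((1 + 4 * \<nu>) * j) - (?y - 8 * \<nu> ^ 2 * j - 16 * \<nu> ^ 3 * p))
      = P (- 1) * (3 * g ((1 + 4 * \<nu>) * j))
        - (3 * j + 6 * \<nu> * (1 + 4 * \<nu>) * (2 * p) + 8 * \<nu> ^ 2 * (6 * ?c) - 24 * \<nu> ^ 2 * j)"
    by (simp add: algebra_simps)
  also have "\<dots> = 32 * \<nu> ^ 3 * (6 * j + 12 * j * \<nu> - 16 * j * \<nu> ^ 2 + 12 * j ^ 2 * \<nu> + 48 * j ^ 2 * \<nu> ^ 2
      + 2 * j ^ 3 + 4 * j ^ 3 * \<nu> + 16 * j ^ 3 * \<nu> ^ 2 + 128 * j ^ 3 * \<nu> ^ 3 + 256 * j ^ 3 * \<nu> ^ 4)"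
    unfolding three_g P_m1 cube6 assms[symmetric]
    by (simp add: algebra_simps power2_eq_square power3_eq_cube power4_eq_xxxx)
  finally have "M dvd P (- 1) * g ((1 + 4 * \<nu>) * j) - (?y - 8 * \<nu> ^ 2 * j - 16 * \<nu> ^ 3 * p)"
    by (rule dvd_third(2)[OF M_dvdI])
  then have "[P (- 1) * g ((1 + 4 * \<nu>) * j) = ?y - 8 * \<nu> ^ 2 * j - 16 * \<nu> ^ 3 * p] (mod M)"
    by (simp only: cong_iff_dvd_diff)
  moreover have "[?y - 8 * \<nu> ^ 2 * j - 16 * \<nu> ^ 3 * p
      = (g ^^ alpha) j - 8 * \<nu> ^ 2 * j - 16 * \<nu> ^ 3 * p] (mod M)"
    using x by (intro cong_diff cong_refl) (rule cong_sym)
  ultimately show ?thesis by (rule cong_trans)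
qed

lemma iterate_M: "[(g ^^ M_nat) j = j] (mod M)" "[g_sum M_nat j = 0] (mod 2 * q)" "[P_sum M_nat j = 0] (mod M)"
proof -
  obtain p where p: "j ^ 2 + j = 2 * p" using even_square_add[of j] by blast
  let ?b = "int (M_nat choose 2)" and ?d = "int (M_nat choose 3)" and ?D = "2 * j + 1"
  have b: "M dvd 2 * ?b" "M dvd 3 * (2 * ?d)"
    using binomials[of M_nat] unfolding int_M_nat by (simp_all add: power2_eq_square mult.assoc)
  from dvd_third(2)[OF b(2)] have d: "M dvd 2 * ?d" .
  have "M dvd 4 * \<nu> * int M_nat * p + 16 * \<nu> ^ 2 * int M_nat * ((j ^ 3 - j) div 6)
      + 4 * \<nu> ^ 2 * p * ?D * (2 * ?b) + 8 * \<nu> ^ 3 * p * ?D ^ 2 * (2 * ?d)"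
    unfolding int_M_nat by (intro dvd_add; (rule dvd_mult[OF b(1)] | rule dvd_mult[OF d] | simp))
  then show "[(g ^^ M_nat) j = j] (mod M)"
    by (intro cong_trans_dvd[OF g_iterate[OF p]]) (simp add: algebra_simps)
  have "M dvd int M_nat * j + 2 * \<nu> * p * (2 * ?b) + 4 * \<nu> ^ 2 * p * ?D * (2 * ?d)"
    unfolding int_M_nat by (intro dvd_add; (rule dvd_mult[OF b(1)] | rule dvd_mult[OF d] | simp))
  then have "2 * q dvd int M_nat * j + 2 * \<nu> * p * (2 * ?b) + 4 * \<nu> ^ 2 * p * ?D * (2 * ?d)"
    by (rule dvd_trans[OF two_q_dvd_M])
  then show "[g_sum M_nat j = 0] (mod 2 * q)"
    by (intro cong_trans_dvd[OF g_sum_cong[OF p]]) (simp add: algebra_simps)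
  have "M dvd int M_nat + 2 * \<nu> * j * (2 * ?b) + 8 * \<nu> ^ 2 * p * (2 * ?d)
      + (8 * \<nu> ^ 2 * j ^ 2 * (2 * ?d) + 4 * \<nu> ^ 2 * (j ^ 2 - j) * (2 * ?b))"
    unfolding int_M_nat by (intro dvd_add; (rule dvd_mult[OF b(1)] | rule dvd_mult[OF d] | simp))
  then show "[P_sum M_nat j = 0] (mod M)"
    by (intro cong_trans_dvd[OF P_sum_cong[OF p]]) (simp add: algebra_simps)
qed

text \<open>
  Modulo \<open>q\<close> everything beyond the first order in \<open>\<nu>\<close> disappears.
  These formulas yield the multiplication of \<open>H\<close>.
\<close>

lemma iterate_mod_q:
  "[(g ^^ n) j = j + 2 * \<nu> * int n * (j ^ 2 + j)] (mod q)"
  "[g_sum n j = int n * j + \<nu> * (int n ^ 2 - int n) * (j ^ 2 + j)] (mod q)"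
  "[P_sum n j = int n + 2 * \<nu> * j * (int n ^ 2 - int n)] (mod q)"
proof -
  obtain p where p: "j ^ 2 + j = 2 * p" using even_square_add[of j] by blast
  note b = binomials(1)[of n, symmetric]
  have eq: "[x = y] (mod q)" if "[x = z] (mod q)" "z - y = 8 * \<nu> ^ 2 * u" for x y z u
    using that(1) q_dvdI[OF that(2)] by (rule cong_trans_dvd)
  show "[(g ^^ n) j = j + 2 * \<nu> * int n * (j ^ 2 + j)] (mod q)"
    by (rule eq[where u = "2 * int n * ((j ^ 3 - j) div 6) + int (n choose 2) * p * (2 * j + 1)
          + 2 * \<nu> * int (n choose 3) * p * (2 * j + 1) ^ 2", OF cong_M_imp_q[OF g_iterate[OF p]]])
      (simp only: p, simp add: algebra_simps power2_eq_square power3_eq_cube)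
  show "[g_sum n j = int n * j + \<nu> * (int n ^ 2 - int n) * (j ^ 2 + j)] (mod q)"
    by (rule eq[where u = "int (n choose 3) * p * (2 * j + 1)", OF cong_2q_imp_q[OF g_sum_cong[OF p]]])
      (unfold p b, simp add: algebra_simps power2_eq_square)
  show "[P_sum n j = int n + 2 * \<nu> * j * (int n ^ 2 - int n)] (mod q)"
    by (rule eq[where u = "2 * p * int (n choose 3)
          + (2 * j ^ 2 * int (n choose 3) + (j ^ 2 - j) * int (n choose 2))", OF cong_M_imp_q[OF P_sum_cong[OF p]]])
      (simp only: b, simp add: algebra_simps)
qed

end

section \<open>A model of J on triples of integers\<close>

text \<open>
  The triple \<open>(i,k,j)\<close> stands for \<open>A^i C^k B^j\<close>, and the maps below are
  right multiplication by \<open>A\<close>, \<open>B\<close> and \<open>C\<close>. The relation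
  \<open>eqv\<close> is congruence modulo the lattice generated by \<open>(M,0,0)\<close>,
  \<open>(q,0,q)\<close> and \<open>(-sq,q,0)\<close>. The last two vectors impose the identities
  \<open>A^q B^q=1\<close> and \<open>C^q=A^(sq)\<close>, on which \<open>actA_relation\<close>
  depends.
\<close>

fun (in macdonald_params) eqv :: "int \<times> int \<times> int \<Rightarrow> int \<times> int \<times> int \<Rightarrow> bool" where
  "eqv (i, k, j) (i', k', j') \<longleftrightarrow>
     q dvd k - k' \<and> q dvd j - j' \<and> M dvd (i - i') - (j - j') + s * (k - k')"
fun (in macdonald_params) actA :: "int \<times> int \<times> int \<Rightarrow> int \<times> int \<times> int" where
  "actA (i, k, j) = (i + P (- k), k - j, g j)"
fun (in macdonald_params) actB :: "int \<times> int \<times> int \<Rightarrow> int \<times> int \<times> int" where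
  "actB (i, k, j) = (i, k, j + 1)"
fun (in macdonald_params) actC :: "int \<times> int \<times> int \<Rightarrow> int \<times> int \<times> int" where
  "actC (i, k, j) = (i, k + 1, P (- 1) * j)"

context macdonald_params begin

lemma eqv_refl [simp]: "eqv x x" by (cases x) simp

lemma eqv_sym: "eqv x y \<Longrightarrow> eqv y x"
proof (cases x; cases y)
  fix i k j i' k' j'
  assume "eqv x y" and xy: "x = (i, k, j)" "y = (i', k', j')"
  then have "q dvd - (k - k')" "q dvd - (j - j')" "M dvd - ((i - i') - (j - j') + s * (k - k'))"
    by (simp_all only: eqv.simps dvd_minus_iff)
  then show "eqv y x" by (simp add: xy algebra_simps)
qed

lemma eqv_trans [trans]: "eqv x y \<Longrightarrow> eqv y z \<Longrightarrow> eqv x z"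
proof (cases x; cases y; cases z)
  fix i k j i' k' j' a b c
  assume "eqv x y" "eqv y z" and xyz: "x = (i, k, j)" "y = (i', k', j')" "z = (a, b, c)"
  then have "q dvd (k - k') + (k' - b)" "q dvd (j - j') + (j' - c)"
    "M dvd ((i - i') - (j - j') + s * (k - k')) + ((i' - a) - (j' - c) + s * (k' - b))"
    by (simp_all only: eqv.simps dvd_add)
  then show "eqv x z" by (simp add: xyz algebra_simps)
qed

lemma eqv_fst: "[i = i'] (mod M) \<Longrightarrow> eqv (i, k, j) (i', k, j)"
  by (simp add: cong_iff_dvd_diff)

lemma eqv_all: "[i = i'] (mod M) \<Longrightarrow> [k = k'] (mod 2 * q) \<Longrightarrow> [j = j'] (mod M) \<Longrightarrow> eqv (i, k, j) (i', k', j')"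
proof -
  assume a: "[i = i'] (mod M)" "[k = k'] (mod 2 * q)" "[j = j'] (mod M)"
  have "s * (2 * q) dvd s * (k - k')" using a(2) by (simp add: cong_iff_dvd_diff)
  then have "M dvd s * (k - k')" by (simp add: M_eq w_eq mult.commute mult.left_commute)
  then show ?thesis
    using a cong_2q_imp_q[OF a(2)] cong_M_imp_q[OF a(3)] by (simp add: cong_iff_dvd_diff)
qed

lemma eqv_thd: "[j = j'] (mod M) \<Longrightarrow> eqv (i, k, j) (i, k, j')"
  by (intro eqv_all cong_refl)

lemma q_dvd_8nu: "q dvd 8 * \<nu> ^ 2 * x" and M_dvd_w: "M dvd 8 * \<nu> ^ 2 * (w * x)"
proof -
  show "q dvd 8 * \<nu> ^ 2 * x" using q_dvd by simp
  have "w * q dvd w * (8 * \<nu> ^ 2) * x" using q_dvd by simp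
  then show "M dvd 8 * \<nu> ^ 2 * (w * x)" by (simp add: M_eq mult.left_commute mult.commute)
qed

lemma actB_cong: "eqv x y \<Longrightarrow> eqv (actB x) (actB y)"
  by (cases x; cases y) simp

lemma s_mult_q: "2 * (s * q) = M" by (simp add: M_eq w_eq)

text \<open>
  Every value of \<open>P\<close> is \<open>1\<close> modulo \<open>2^m\<close>, and \<open>M = w
  * q\<close>.
\<close>

lemma P_times_q_multiple: "q dvd x \<Longrightarrow> [P z * x = x] (mod M)"
proof -
  assume "q dvd x"
  then obtain y where y: "x = q * y" by blast
  have "w dvd P z - 1"
  proof -
    have "P z - 1 = 4 * \<nu> * (z + 2 * \<nu> * (z ^ 2 - z))"
      by (simp add: P_def algebra_simps power2_eq_square)
    then show ?thesis using w_dvd by simp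
  qed
  then have "w * q dvd (P z - 1) * x" unfolding y by (simp add: mult_dvd_mono)
  then show ?thesis by (simp add: M_eq cong_iff_dvd_diff algebra_simps)
qed

lemma actC_cong: "eqv x y \<Longrightarrow> eqv (actC x) (actC y)"
proof (cases x; cases y)
  fix i k j i' k' j'
  assume "eqv x y" and xy: "x = (i, k, j)" "y = (i', k', j')"
  then have h: "q dvd k - k'" "q dvd j - j'" "M dvd (i - i') - (j - j') + s * (k - k')" by simp_all
  have "M dvd P (- 1) * (j - j') - (j - j')"
    using P_times_q_multiple[OF h(2)] by (simp add: cong_iff_dvd_diff)
  from dvd_diff[OF h(3) this] have "M dvd i - i' - P (- 1) * (j - j') + s * (k - k')"
    by (simp add: algebra_simps)
  moreover have "q dvd P (- 1) * (j - j')" using h(2) by simp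
  ultimately show "eqv (actC x) (actC y)" using h by (simp add: xy algebra_simps)
qed

text \<open>
  This is where the summand \<open>s * (k - k')\<close> of \<open>eqv\<close> comes from. Shifting
  \<open>j\<close> by \<open>q * t\<close> changes \<open>g j\<close> by \<open>q * t\<close> and
  an extra \<open>2 * \<nu> * (q * t)\<close>. As \<open>2 * \<nu>\<close> is an odd multiple of
  \<open>s\<close>, the extra term is \<open>s * (q * t)\<close> modulo \<open>M\<close>;
  multiplication by \<open>A\<close> at the same time subtracts \<open>q * t\<close> from the
  exponent of \<open>C\<close>.
\<close>

lemma g_shift: "[g (j + q * t) = g j + q * t + s * (q * t)] (mod M)"
proof -
  obtain h where h: "odd h" "\<nu> = 2 ^ (m - 2) * h" using nu_form by blast
  have nu2: "2 * \<nu> = s * h" by (simp add: h two_powers)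
  have "3 * (g (j + q * t) - (g j + q * t + s * (q * t)))
      = 3 * (2 * \<nu> - s) * (q * t) + 6 * \<nu> * (2 * j + q * t) * (q * t)
        + 8 * \<nu> ^ 2 * (3 * j ^ 2 + 3 * j * (q * t) + (q * t) ^ 2 - 1) * (q * t)"
    by (simp add: right_diff_distrib distrib_left three_g)
      (simp add: algebra_simps power2_eq_square power3_eq_cube)
  moreover have "M dvd 3 * (2 * \<nu> - s) * (q * t)"
  proof -
    have "2 * \<nu> - s = s * (h - 1)" by (simp add: nu2 right_diff_distrib)
    moreover have "even (h - 1)" using h(1) by simp
    ultimately have "s * 2 dvd 2 * \<nu> - s" by (metis dvd_refl mult_dvd_mono)
    then have "w * q dvd (2 * \<nu> - s) * (q * t)" by (intro mult_dvd_mono) (simp_all add: w_eq mult.commute)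
    then have "M dvd 3 * ((2 * \<nu> - s) * (q * t))" unfolding M_eq by (rule dvd_mult)
    then show ?thesis by (simp only: mult.assoc)
  qed
  moreover have "M dvd 6 * \<nu> * (2 * j + q * t) * (q * t)"
  proof -
    have "even (q * t)" by (simp add: q_eq w_eq)
    then obtain z where "q * t = 2 * z" by blast
    then have "6 * \<nu> * (2 * j + q * t) = 4 * \<nu> * (3 * (j + z))" by (simp only: distrib_left)
    then have "w dvd 6 * \<nu> * (2 * j + q * t)" using dvd_mult2[OF w_dvd] by (simp only:)
    then show ?thesis unfolding M_eq by (intro mult_dvd_mono) simp_all
  qed
  moreover have "M dvd 8 * \<nu> ^ 2 * (3 * j ^ 2 + 3 * j * (q * t) + (q * t) ^ 2 - 1) * (q * t)"
  proof -
    have "8 * \<nu> ^ 2 * x = 4 * \<nu> * (2 * \<nu> * x)" for x by (simp add: power2_eq_square)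
    then have "w dvd 8 * \<nu> ^ 2 * x" for x using dvd_mult2[OF w_dvd] by (simp only:)
    then show ?thesis unfolding M_eq by (intro mult_dvd_mono) simp_all
  qed
  ultimately have "M dvd 3 * (g (j + q * t) - (g j + q * t + s * (q * t)))"
    by (simp only: dvd_add)
  then show ?thesis unfolding cong_iff_dvd_diff by (rule dvd_third(2))
qed

lemma actA_cong: "eqv x y \<Longrightarrow> eqv (actA x) (actA y)"
proof (cases x; cases y)
  fix i k j i' k' j'
  assume "eqv x y" and xy: "x = (i, k, j)" "y = (i', k', j')"
  then have h: "q dvd k - k'" "q dvd j - j'" "M dvd (i - i') - (j - j') + s * (k - k')" by simp_all
  from h(2) obtain t where "j - j' = q * t" by blast
  then have t: "j = j' + q * t" by simp
  have "[P (- k) = P (- k')] (mod M)"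
    using h(1) by (intro P_cong) (simp add: cong_iff_dvd_diff dvd_diff_commute)
  then have 1: "M dvd P (- k) - P (- k')" by (simp add: cong_iff_dvd_diff)
  have 2: "M dvd g j - (g j' + q * t + s * (q * t))" using g_shift[of j' t] by (simp add: t cong_iff_dvd_diff)
  \<comment> \<open>The shift of \<open>j\<close> enters once through \<open>g j\<close> and once through \<open>k - j\<close>; the two contributions add up to a multiple of \<open>M\<close>.\<close>
  have 3: "M dvd 2 * (s * q) * t" by (simp add: s_mult_q)
  have "M dvd (i - i' - (j - j') + s * (k - k')) + (P (- k) - P (- k'))
      - (g j - (g j' + q * t + s * (q * t))) - 2 * (s * q) * t"
    by (rule dvd_diff[OF dvd_diff[OF dvd_add[OF h(3) 1] 2] 3])
  moreover have "q dvd g j - g j'"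
    using dvd_add[OF dvd_trans[OF q_dvd_M 2] dvd_triv_left[of q "t + s * t"]] by (simp add: algebra_simps)
  moreover have "q dvd (k - k') - (j - j')" using h(1,2) by (rule dvd_diff)
  ultimately show "eqv (actA x) (actA y)"
    by (simp add: xy t algebra_simps)
qed

lemma actA_iterate:
  "\<exists>i'. [i' = i + P (- k) * P_sum n j] (mod M) \<and> (actA ^^ n) (i, k, j) = (i', k - g_sum n j, (g ^^ n) j)"
proof (induction n)
  case 0
  show ?case by (simp add: g_sum_def P_sum_def)
next
  case (Suc n)
  then obtain i' where i': "[i' = i + P (- k) * P_sum n j] (mod M)"
    "(actA ^^ n) (i, k, j) = (i', k - g_sum n j, (g ^^ n) j)" by blast
  have "[P (- (k - g_sum n j)) = P (- k) * P (g_sum n j)] (mod M)"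
    using P_add[of "- k" "g_sum n j"] by simp
  from cong_add[OF i'(1) this]
  have "[i' + P (- (k - g_sum n j)) = i + P (- k) * P_sum (Suc n) j] (mod M)"
    by (simp add: P_sum_def distrib_left add.assoc)
  moreover have "(actA ^^ Suc n) (i, k, j) = (i' + P (- (k - g_sum n j)), k - g_sum (Suc n) j, (g ^^ Suc n) j)"
    by (simp add: i'(2) g_sum_def)
  ultimately show ?case by blast
qed

lemma actA_iterate_eqv: "eqv ((actA ^^ n) (i, k, j)) (i + P (- k) * P_sum n j, k - g_sum n j, (g ^^ n) j)"
  using actA_iterate[of i k n j] eqv_fst by (metis (no_types))

lemma actB_iterate: "(actB ^^ n) (i, k, j) = (i, k, j + int n)"
  by (induction n) simp_all

lemma actA_M: "eqv ((actA ^^ M_nat) x) x"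
proof (cases x)
  fix i k j assume x: "x = (i, k, j)"
  have "[P (- k) * P_sum M_nat j = P (- k) * 0] (mod M)" by (intro cong_mult cong_refl iterate_M)
  then have "[i + P (- k) * P_sum M_nat j = i + P (- k) * 0] (mod M)" by (intro cong_add cong_refl)
  moreover have "[k - g_sum M_nat j = k - 0] (mod 2 * q)" by (intro cong_diff cong_refl iterate_M)
  ultimately have "eqv (i + P (- k) * P_sum M_nat j, k - g_sum M_nat j, (g ^^ M_nat) j) (i, k, j)"
    by (intro eqv_all iterate_M) simp_all
  then show ?thesis using eqv_trans[OF actA_iterate_eqv] x by blast
qed

lemma actB_M: "eqv ((actB ^^ M_nat) x) x"
  by (cases x) (simp add: actB_iterate int_M_nat q_dvd_M)

lemma alpha_inverse: "[(1 + 4 * \<nu>) * (P (- 1) * x) = x] (mod M)"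
proof -
  have "(1 + 4 * \<nu>) * (P (- 1) * x) - x = 32 * \<nu> ^ 3 * (2 * x)"
    by (simp add: P_m1 algebra_simps power2_eq_square power3_eq_cube)
  then show ?thesis unfolding cong_iff_dvd_diff by (rule M_dvdI)
qed

text \<open>
  The identity \<open>BA[A,B]=AB\<close> in the model: it shows that the word \<open>[A,B]\<close>
  acts as \<open>actC\<close>.
\<close>

lemma actC_comm: "eqv (actC (actA (actB x))) (actB (actA x))"
proof (cases x)
  fix i k j assume x: "x = (i, k, j)"
  have "[P (- 1) * g (j + 1) = P (- 1) * ((1 + 4 * \<nu>) * (g j + 1))] (mod M)"
    by (intro cong_mult cong_refl g_Suc)
  also have "[P (- 1) * ((1 + 4 * \<nu>) * (g j + 1)) = g j + 1] (mod M)"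
    using alpha_inverse[of "g j + 1"] by (simp only: mult.left_commute)
  finally show ?thesis using eqv_thd by (simp add: x del: eqv.simps)
qed

lemma actB_relation: "eqv (actB (actC x)) (actC ((actB ^^ alpha) x))"
proof (cases x)
  fix i k j assume x: "x = (i, k, j)"
  have "[P (- 1) * (1 + 4 * \<nu>) = 1] (mod M)"
    using alpha_inverse[of 1] by (simp add: mult.commute)
  then have "[P (- 1) * j + 1 = P (- 1) * j + P (- 1) * (1 + 4 * \<nu>)] (mod M)"
    by (intro cong_add cong_refl) (rule cong_sym)
  then have "[P (- 1) * j + 1 = P (- 1) * (j + (1 + 4 * \<nu>))] (mod M)" by (simp add: algebra_simps)
  then show ?thesis using eqv_thd by (simp add: x actB_iterate int_alpha del: eqv.simps)
qed

text \<open>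
  The one relation whose verification uses the lattice. The defects of \<open>g_sum_alpha\<close>,
  \<open>P_sum_alpha\<close> and \<open>g_alpha\<close> combine to \<open>8 * \<nu> ^ 2 * p * (2 *
  \<nu> + s)\<close> in the third condition of \<open>eqv\<close>. This vanishes modulo
  \<open>M\<close> because \<open>2 * \<nu> + s\<close> is an even multiple of \<open>s\<close>.
\<close>

lemma actA_relation: "eqv (actC (actA x)) ((actA ^^ alpha) (actC x))"
proof (cases x)
  fix i k j assume x: "x = (i, k, j)"
  define J where "J = P (- 1) * j"
  obtain p where p: "J ^ 2 + J = 2 * p" using even_square_add[of J] by blast
  have J: "[(1 + 4 * \<nu>) * J = j] (mod M)" unfolding J_def by (rule alpha_inverse)
  have 1: "M dvd P (- 1) * g j - ((g ^^ alpha) J - 8 * \<nu> ^ 2 * J - 16 * \<nu> ^ 3 * p)"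
    using cong_trans[OF cong_mult[OF cong_refl g_cong[OF cong_sym[OF J]]] g_alpha[OF p]]
    by (simp add: cong_iff_dvd_diff)
  have "[g_sum alpha J = j + 8 * \<nu> ^ 2 * p] (mod 2 * q)"
    using cong_trans[OF g_sum_alpha[OF p] cong_add[OF cong_M_imp_2q[OF J] cong_refl]] .
  then have 2: "2 * q dvd g_sum alpha J - (j + 8 * \<nu> ^ 2 * p)" by (simp add: cong_iff_dvd_diff)
  then have "s * (2 * q) dvd s * (g_sum alpha J - (j + 8 * \<nu> ^ 2 * p))" by (rule mult_dvd_mono[OF dvd_refl])
  then have sk: "M dvd s * (g_sum alpha J - (j + 8 * \<nu> ^ 2 * p))" using s_mult_q by (simp only: mult.left_commute)
  have q2: "q dvd g_sum alpha J - (j + 8 * \<nu> ^ 2 * p)" using 2 by (rule dvd_mult_right)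
  have "[P (- (k + 1)) * P_sum alpha J = P (- k) * (P (- 1) * P_sum alpha J)] (mod M)"
    using cong_mult[OF P_add[of "- k" "- 1"] cong_refl] by (simp add: mult.assoc)
  also have "[P (- k) * (P (- 1) * P_sum alpha J) = P (- k) * (1 + 8 * \<nu> ^ 2 * J)] (mod M)"
    by (intro cong_mult cong_refl P_sum_alpha)
  also have "P (- k) * (1 + 8 * \<nu> ^ 2 * J) = P (- k) + P (- k) * (8 * \<nu> ^ 2 * J)" by (simp add: distrib_left)
  also have "[P (- k) + P (- k) * (8 * \<nu> ^ 2 * J) = P (- k) + 8 * \<nu> ^ 2 * J] (mod M)"
    by (intro cong_add cong_refl P_times_q_multiple q_dvd_8nu)
  finally have 3: "M dvd P (- (k + 1)) * P_sum alpha J - (P (- k) + 8 * \<nu> ^ 2 * J)" by (simp only: cong_iff_dvd_diff)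
  have 4: "M dvd 8 * \<nu> ^ 2 * p * (2 * \<nu> + s)"
  proof -
    obtain h where h: "odd h" "\<nu> = 2 ^ (m - 2) * h" using nu_form by blast
    then have "2 * \<nu> + s = s * (h + 1)" by (simp add: two_powers algebra_simps)
    moreover obtain z where "h + 1 = 2 * z" using h(1) by (metis evenE even_add odd_one)
    ultimately have "2 * \<nu> + s = w * z" by (simp add: w_eq)
    then have "8 * \<nu> ^ 2 * p * (2 * \<nu> + s) = 8 * \<nu> ^ 2 * (w * (p * z))" by (simp only: ac_simps)
    then show ?thesis using M_dvd_w by (simp only:)
  qed
  have "M dvd - (P (- (k + 1)) * P_sum alpha J - (P (- k) + 8 * \<nu> ^ 2 * J))
      - (P (- 1) * g j - ((g ^^ alpha) J - 8 * \<nu> ^ 2 * J - 16 * \<nu> ^ 3 * p))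
      + s * (g_sum alpha J - (j + 8 * \<nu> ^ 2 * p)) + 8 * \<nu> ^ 2 * p * (2 * \<nu> + s)"
    by (rule dvd_add[OF dvd_add[OF dvd_diff[OF dvd_minus_iff[THEN iffD2, OF 3] 1] sk] 4])
  moreover have "q dvd P (- 1) * g j - (g ^^ alpha) J"
    using dvd_add[OF dvd_trans[OF q_dvd_M 1] q_dvd_8nu[of "- J - 2 * \<nu> * p"]]
    by (simp add: algebra_simps power2_eq_square power3_eq_cube)
  moreover have "q dvd g_sum alpha J - j"
    using dvd_add[OF q2 q_dvd_8nu[of p]] by (simp add: algebra_simps)
  ultimately have "eqv (actC (actA x)) (i + P (- (k + 1)) * P_sum alpha J, k + 1 - g_sum alpha J, (g ^^ alpha) J)"
    by (simp add: x algebra_simps power2_eq_square power3_eq_cube)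
  moreover have "eqv ((actA ^^ alpha) (actC x)) (i + P (- (k + 1)) * P_sum alpha J, k + 1 - g_sum alpha J, (g ^^ alpha) J)"
    unfolding x actC.simps J_def[symmetric] by (rule actA_iterate_eqv)
  ultimately show ?thesis using eqv_sym eqv_trans by blast
qed

end

section \<open>Words, presentations and evaluation\<close>

primrec word_eval :: "('a, 'b) monoid_scheme \<Rightarrow> ('x \<Rightarrow> 'a) \<Rightarrow> 'x word \<Rightarrow> 'a" where
  "word_eval G h [] = \<one>\<^bsub>G\<^esub>"
| "word_eval G h (a # u) =
     (if fst a then inv\<^bsub>G\<^esub> h (snd a) else h (snd a)) \<otimes>\<^bsub>G\<^esub> word_eval G h u"

definition (in group) comm :: "'a \<Rightarrow> 'a \<Rightarrow> 'a" where
  "comm x y = inv x \<otimes> inv y \<otimes> x \<otimes> y"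

context group begin

lemma comm_closed [simp]: "x \<in> carrier G \<Longrightarrow> y \<in> carrier G \<Longrightarrow> comm x y \<in> carrier G"
  by (simp add: comm_def)

lemma comm_swap: "x \<in> carrier G \<Longrightarrow> y \<in> carrier G \<Longrightarrow> comm y x = inv (comm x y)"
  by (simp add: comm_def inv_mult_group m_assoc)

lemma comm_eq: "x \<in> carrier G \<Longrightarrow> y \<in> carrier G \<Longrightarrow> y \<otimes> x \<otimes> comm x y = x \<otimes> y"
  by (simp add: comm_def m_assoc[symmetric]) (simp add: m_assoc)

context
  fixes h :: "'x \<Rightarrow> 'a"
  assumes h: "\<And>x. h x \<in> carrier G"
begin

lemma word_eval_closed [simp]: "word_eval G h u \<in> carrier G"
  by (induction u) (simp_all add: h)

lemma word_eval_append: "word_eval G h (u @ v) = word_eval G h u \<otimes> word_eval G h v"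
  by (induction u) (simp_all add: h m_assoc)

lemma word_eval_inv: "word_eval G h (word_inv u) = inv word_eval G h u"
proof (induction u)
  case (Cons a u)
  have "word_inv (a # u) = word_inv u @ [(\<not> fst a, snd a)]"
    by (simp add: word_inv_def split_def)
  then show ?case using Cons by (simp add: word_eval_append h inv_mult_group)
qed (simp add: word_inv_def)

lemma word_eval_pow: "word_eval G h (word_pow u n) = word_eval G h u [^] n"
proof -
  have rep: "word_eval G h (concat (replicate k v)) = word_eval G h v [^] k" for k :: nat and v
  proof (induction k)
    case (Suc k)
    then show ?case using nat_pow_Suc2[of "word_eval G h v" k] by (simp add: word_eval_append)
  qed simp
  show ?thesis
  proof (cases "0 \<le> n")
    case True
    then have "\<not> n < 0" by simp
    with True show ?thesis by (simp only: word_pow_def rep int_pow_def2 if_True if_False)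
  next
    case False
    then have "n < 0" by simp
    then show ?thesis
      by (simp only: word_pow_def rep int_pow_def2 if_True False if_False word_eval_inv nat_pow_inv word_eval_closed)
  qed
qed

lemma word_eval_letter: "word_eval G h (letter x) = h x"
  by (simp add: letter_def h)

lemma word_eval_comm: "word_eval G h (word_comm u v) = comm (word_eval G h u) (word_eval G h v)"
  by (simp add: word_comm_def word_eval_append word_eval_inv comm_def m_assoc)

lemma word_eval_conj: "word_eval G h (word_conj u v) = inv word_eval G h v \<otimes> word_eval G h u \<otimes> word_eval G h v"
  by (simp add: word_conj_def word_eval_append word_eval_inv m_assoc)

lemma word_eval_word_eq:
  assumes "\<And>l r. (l, r) \<in> R \<Longrightarrow> word_eval G h l = word_eval G h r" and "word_eq R u v"
  shows "word_eval G h u = word_eval G h v"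
  using assms(2)
proof (induction rule: word_eq.induct)
  case (cancel u e x v)
  have "word_eval G h ([(e, x), (\<not> e, x)]) = \<one>" by (cases e) (simp_all add: h)
  then show ?case unfolding word_eval_append by simp
next
  case (relation l r u v)
  then show ?case using assms(1) by (simp add: word_eval_append)
qed simp_all

text \<open>
  The universal property of a group given by generators and relations.
\<close>

lemma presented_group_lift:
  assumes "\<And>l r. (l, r) \<in> R \<Longrightarrow> word_eval G h l = word_eval G h r"
  shows "\<exists>f \<in> hom (presented_group R) G. \<forall>u. f (word_class R u) = word_eval G h u"
proof
  define f where "f = (\<lambda>X. word_eval G h (SOME u. word_class R u = X))"
  show f: "\<forall>u. f (word_class R u) = word_eval G h u"
  proof
    fix u
    have "word_class R (SOME v. word_class R v = word_class R u) = word_class R u"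
      by (rule someI[of _ u]) simp
    then show "f (word_class R u) = word_eval G h u"
      using word_eval_word_eq[OF assms] unfolding f_def word_class_eq_iff by blast
  qed
  have "carrier (presented_group R) = range (word_class R)" by (simp add: presented_group_def)
  then show "f \<in> hom (presented_group R) G"
    using f by (auto simp: hom_def presented_group_mult word_eval_append)
qed

end

end

lemma word_class_eval:
  "word_class R u = word_eval (presented_group R) (\<lambda>x. word_class R (letter x)) u"
proof (induction u)
  case Nil
  show ?case by (simp add: presented_group_def)
next
  case (Cons a u)
  interpret group "presented_group R" by (rule group_presented_group)
  have car: "word_class R v \<in> carrier (presented_group R)" for v by (simp add: presented_group_def)
  obtain e x where a: "a = (e, x)" by (cases a)
  have "word_class R [(True, x)] = inv\<^bsub>presented_group R\<^esub> word_class R (letter x)"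
  proof (rule inv_equality[symmetric])
    show "word_class R [(True, x)] \<otimes>\<^bsub>presented_group R\<^esub> word_class R (letter x) = \<one>\<^bsub>presented_group R\<^esub>"
      using word_eq.cancel[of R "[]" True x "[]"]
      by (simp add: presented_group_mult letter_def word_class_eq_iff) (simp add: presented_group_def word_class_eq_iff)
  qed (simp_all add: car)
  then have "word_class R [a] = (if e then inv\<^bsub>presented_group R\<^esub> word_class R (letter x) else word_class R (letter x))"
    by (cases e) (simp_all add: a letter_def)
  moreover have "word_class R (a # u) = word_class R [a] \<otimes>\<^bsub>presented_group R\<^esub> word_class R u"
    by (simp add: presented_group_mult)
  ultimately show ?case using Cons by (simp add: a)
qed

lemma presented_group_generated:
  "carrier (presented_group R) = generate (presented_group R) (range (\<lambda>x. word_class R (letter x)))"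
proof
  interpret group "presented_group R" by (rule group_presented_group)
  let ?h = "\<lambda>x. word_class R (letter x)"
  have car: "?h x \<in> carrier (presented_group R)" for x by (simp add: presented_group_def)
  then show "generate (presented_group R) (range ?h) \<subseteq> carrier (presented_group R)"
    by (intro generate_incl) auto
  have "word_eval (presented_group R) ?h u \<in> generate (presented_group R) (range ?h)" for u
  proof (induction u)
    case (Cons a u)
    have "?h (snd a) \<in> range ?h" by (rule rangeI)
    then have "(if fst a then inv\<^bsub>presented_group R\<^esub> ?h (snd a) else ?h (snd a))
        \<in> generate (presented_group R) (range ?h)"
      by (cases "fst a") (simp_all only: if_True if_False generate.inv generate.incl)
    from generate.eng[OF this Cons] show ?case by (simp only: word_eval.simps)
  qed (simp add: generate.one)
  then show "carrier (presented_group R) \<subseteq> generate (presented_group R) (range ?h)"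
    unfolding word_class_eval[of R, symmetric] by (simp add: presented_group_def image_subset_iff)
qed

section \<open>Normal form and centre of J\<close>

text \<open>
  The way to see that the products \<open>A^i C^k B^j\<close> exhaust \<open>J\<close>: their set
  is closed under right multiplication by the generators and their inverses.
\<close>

lemma (in group) generated_by_right_mult:
  assumes "carrier G = generate G S" "S \<subseteq> carrier G" "\<one> \<in> T"
    and "\<And>x y. x \<in> T \<Longrightarrow> y \<in> S \<Longrightarrow> x \<otimes> y \<in> T \<and> x \<otimes> inv y \<in> T" and "T \<subseteq> carrier G"
  shows "carrier G = T"
proof -
  have "x \<otimes> y \<in> T" if "y \<in> generate G S" "x \<in> T" for x y
    using that
  proof (induction arbitrary: x)
    case (eng h1 h2)
    then have "h1 \<in> carrier G" "h2 \<in> carrier G" "x \<in> carrier G" using assms(1,5) by auto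
    then show ?case using eng by (simp add: m_assoc[symmetric])
  next
    case one
    then show ?case using assms(5) by auto
  qed (use assms(4) in blast)+
  then show ?thesis using assms(1,3,5) by (metis l_one subsetI subset_antisym)
qed

lemma (in group) intertwine_inv:
  assumes "x \<otimes> c = c \<otimes> y" "x \<in> carrier G" "y \<in> carrier G" "c \<in> carrier G"
  shows "inv x \<otimes> c = c \<otimes> inv y" "inv c \<otimes> x = y \<otimes> inv c"
proof -
  have "inv x \<otimes> c = inv x \<otimes> (c \<otimes> y) \<otimes> inv y" using assms(2-4) by (simp add: m_assoc)
  also have "\<dots> = inv x \<otimes> (x \<otimes> c) \<otimes> inv y" by (simp only: assms(1))
  also have "\<dots> = c \<otimes> inv y" using assms(2-4) by (simp add: m_assoc[symmetric])
  finally show "inv x \<otimes> c = c \<otimes> inv y" .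
  have "inv c \<otimes> x = inv c \<otimes> (x \<otimes> c) \<otimes> inv c" using assms(2-4) by (simp add: m_assoc)
  also have "\<dots> = inv c \<otimes> (c \<otimes> y) \<otimes> inv c" by (simp only: assms(1))
  also have "\<dots> = y \<otimes> inv c" using assms(2-4) by (simp add: m_assoc[symmetric])
  finally show "inv c \<otimes> x = y \<otimes> inv c" .
qed

lemma (in group) central_if_commutes_with_generators:
  assumes "carrier G = generate G S" "S \<subseteq> carrier G" "z \<in> carrier G"
    and "\<And>y. y \<in> S \<Longrightarrow> z \<otimes> y = y \<otimes> z"
  shows "z \<in> center G"
proof -
  have c: "y \<in> carrier G" if "y \<in> generate G S" for y using that assms(1) by simp
  have "z \<otimes> x = x \<otimes> z" if "x \<in> generate G S" for x
    using that
  proof induction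
    case (inv h)
    then have h: "h \<in> carrier G" "z \<otimes> h = h \<otimes> z" using assms(2,4) by auto
    show ?case using intertwine_inv(1)[OF h(2)[symmetric] h(1) h(1) assms(3)] by simp
  next
    case (eng h1 h2)
    then show ?case using c[OF eng(1)] c[OF eng(2)] assms(3) by (metis m_assoc)
  qed (use assms(3,4) in auto)
  then show ?thesis using assms(1,3) by (simp add: center_def)
qed

text \<open>
  A group with the relations of \<open>J\<close>, written without inverses, together with the
  position \<open>pt x\<close> that an element reaches in the model from the origin. The
  assumptions on \<open>pt\<close> express that the group acts on the model.
\<close>

locale macdonald_J = macdonald_params m \<nu> + group J for m \<nu> and J (structure) +
  fixes A B :: 'a and pt :: "'a \<Rightarrow> int \<times> int \<times> int"
  assumes A_closed [simp]: "A \<in> carrier J" and B_closed [simp]: "B \<in> carrier J"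
    and rel_A: "A \<otimes> comm A B = comm A B \<otimes> A [^] (1 + 4 * \<nu>)"
    and rel_B: "comm A B \<otimes> B = B [^] (1 + 4 * \<nu>) \<otimes> comm A B"
    and A_M: "A [^] M = \<one>" and B_M: "B [^] M = \<one>"
    and generated: "carrier J = generate J {A, B}"
    and pt_one: "eqv (pt \<one>) (0, 0, 0)"
    and pt_A: "x \<in> carrier J \<Longrightarrow> eqv (pt (x \<otimes> A)) (actA (pt x))"
    and pt_B: "x \<in> carrier J \<Longrightarrow> eqv (pt (x \<otimes> B)) (actB (pt x))"
begin

definition C where "C = comm A B"

lemma C_closed [simp]: "C \<in> carrier J" by (simp add: C_def)

lemma pow_A_cong: "[i = i'] (mod M) \<Longrightarrow> A [^] i = A [^] i'"
  and pow_B_cong: "[i = i'] (mod M) \<Longrightarrow> B [^] i = B [^] i'"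
proof -
  have gen: "x [^] i = x [^] i'" if "[i = i'] (mod M)" "x [^] M = \<one>" "x \<in> carrier J" for x
  proof -
    obtain t where "i = i' + M * t" using \<open>[i = i'] (mod M)\<close> by (metis cong_iff_lin cong_sym)
    then have "x [^] i = x [^] i' \<otimes> (x [^] M) [^] t"
      using that(3) by (simp only: int_pow_mult int_pow_pow)
    then show ?thesis using that by simp
  qed
  show "[i = i'] (mod M) \<Longrightarrow> A [^] i = A [^] i'" "[i = i'] (mod M) \<Longrightarrow> B [^] i = B [^] i'"
    using gen A_M B_M by auto
qed

lemma conj_pow:
  assumes "x \<otimes> c = c \<otimes> y" "x \<in> carrier J" "y \<in> carrier J" "c \<in> carrier J"
  shows "x [^] (i::int) \<otimes> c = c \<otimes> y [^] i"
proof -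
  have n: "x [^] n \<otimes> c = c \<otimes> y [^] n" for n :: nat
  proof (induction n)
    case (Suc n)
    have "x [^] Suc n \<otimes> c = x [^] n \<otimes> (x \<otimes> c)" using assms by (simp add: m_assoc)
    also have "\<dots> = (x [^] n \<otimes> c) \<otimes> y" using assms by (simp add: m_assoc)
    also have "\<dots> = c \<otimes> y [^] Suc n" using assms Suc by (simp add: m_assoc)
    finally show ?case .
  qed (use assms in simp)
  show ?thesis
  proof (cases i rule: int_cases2)
    case (nonneg k)
    then show ?thesis using n by (simp add: int_pow_int)
  next
    case (nonpos k)
    have "inv (x [^] k) \<otimes> c = c \<otimes> inv (y [^] k)" using assms by (intro intertwine_inv(1) n) simp_all
    then show ?thesis using nonpos assms by (simp add: int_pow_neg_int)
  qed
qed

lemma A_C: "A [^] i \<otimes> C = C \<otimes> A [^] ((1 + 4 * \<nu>) * i)"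
  using conj_pow[of A C "A [^] (1 + 4 * \<nu>)" i] rel_A by (simp add: C_def int_pow_pow)

lemma C_B: "C \<otimes> B [^] i = B [^] ((1 + 4 * \<nu>) * i) \<otimes> C"
  using conj_pow[of "B [^] (1 + 4 * \<nu>)" C B i] rel_B by (simp add: C_def int_pow_pow)

lemma C_A: "C \<otimes> A [^] i = A [^] (P (- 1) * i) \<otimes> C"
  using A_C[of "P (- 1) * i"] pow_A_cong[OF alpha_inverse] by simp

lemma B_C: "B [^] i \<otimes> C = C \<otimes> B [^] (P (- 1) * i)"
  using C_B[of "P (- 1) * i"] pow_B_cong[OF alpha_inverse] by simp

lemma invC_A: "inv C \<otimes> A [^] i = A [^] (P 1 * i) \<otimes> inv C"
  using intertwine_inv(2)[OF A_C] by (simp add: P_1)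

lemma B_invC: "B [^] i \<otimes> inv C = inv C \<otimes> B [^] (P 1 * i)"
  using intertwine_inv(2)[OF C_B[symmetric]] by (simp add: P_1)

lemma Cpow_A: "C [^] k \<otimes> A [^] i = A [^] (P (- k) * i) \<otimes> C [^] k"
proof (induction k rule: int_induct[of _ 0])
  case base
  show ?case by simp
next
  case (step1 k)
  have "C [^] (k + 1) \<otimes> A [^] i = C \<otimes> (C [^] k \<otimes> A [^] i)"
    using int_pow_mult[of C 1 k] by (simp add: add.commute m_assoc)
  also have "\<dots> = A [^] (P (- 1) * (P (- k) * i)) \<otimes> C \<otimes> C [^] k"
    by (simp add: step1 m_assoc[symmetric] C_A)
  also have "\<dots> = A [^] (P (- 1) * (P (- k) * i)) \<otimes> C [^] (k + 1)"
    using int_pow_mult[of C 1 k] by (simp add: add.commute m_assoc)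
  also have "A [^] (P (- 1) * (P (- k) * i)) = A [^] (P (- (k + 1)) * i)"
    using cong_mult[OF P_add[of "- 1" "- k"] cong_refl[of i]]
    by (intro pow_A_cong) (simp add: mult.assoc cong_sym_eq add.commute)
  finally show ?case .
next
  case (step2 k)
  have "C [^] (k - 1) \<otimes> A [^] i = inv C \<otimes> (C [^] k \<otimes> A [^] i)"
    using int_pow_mult[of C "- 1" k] by (simp add: m_assoc int_pow_neg)
  also have "\<dots> = A [^] (P 1 * (P (- k) * i)) \<otimes> inv C \<otimes> C [^] k"
    by (simp add: step2 m_assoc[symmetric] invC_A)
  also have "\<dots> = A [^] (P 1 * (P (- k) * i)) \<otimes> C [^] (k - 1)"
    using int_pow_mult[of C "- 1" k] by (simp add: m_assoc int_pow_neg)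
  also have "A [^] (P 1 * (P (- k) * i)) = A [^] (P (- (k - 1)) * i)"
    using cong_mult[OF P_add[of 1 "- k"] cong_refl[of i]]
    by (intro pow_A_cong) (simp add: mult.assoc cong_sym_eq)
  finally show ?case .
qed

lemma Bpow_C: "B [^] i \<otimes> C [^] k = C [^] k \<otimes> B [^] (P (- k) * i)"
proof (induction k rule: int_induct[of _ 0])
  case base
  show ?case by simp
next
  case (step1 k)
  have "B [^] i \<otimes> C [^] (k + 1) = (B [^] i \<otimes> C [^] k) \<otimes> C"
    using int_pow_mult[of C k 1] by (simp add: m_assoc)
  also have "\<dots> = C [^] k \<otimes> C \<otimes> B [^] (P (- 1) * (P (- k) * i))"
    by (simp add: step1 m_assoc B_C)
  also have "\<dots> = C [^] (k + 1) \<otimes> B [^] (P (- 1) * (P (- k) * i))"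
    using int_pow_mult[of C k 1] by simp
  also have "B [^] (P (- 1) * (P (- k) * i)) = B [^] (P (- (k + 1)) * i)"
    using cong_mult[OF P_add[of "- 1" "- k"] cong_refl[of i]]
    by (intro pow_B_cong) (simp add: mult.assoc cong_sym_eq add.commute)
  finally show ?case .
next
  case (step2 k)
  have "B [^] i \<otimes> C [^] (k - 1) = (B [^] i \<otimes> C [^] k) \<otimes> inv C"
    using int_pow_mult[of C k "- 1"] by (simp add: m_assoc int_pow_neg)
  also have "\<dots> = C [^] k \<otimes> inv C \<otimes> B [^] (P 1 * (P (- k) * i))"
    by (simp add: step2 m_assoc B_invC)
  also have "\<dots> = C [^] (k - 1) \<otimes> B [^] (P 1 * (P (- k) * i))"
    using int_pow_mult[of C k "- 1"] by (simp add: int_pow_neg)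
  also have "B [^] (P 1 * (P (- k) * i)) = B [^] (P (- (k - 1)) * i)"
    using cong_mult[OF P_add[of 1 "- k"] cong_refl[of i]]
    by (intro pow_B_cong) (simp add: mult.assoc cong_sym_eq)
  finally show ?case .
qed

lemma B_A: "B \<otimes> A = A \<otimes> B \<otimes> inv C"
proof -
  have "B \<otimes> A \<otimes> C \<otimes> inv C = A \<otimes> B \<otimes> inv C"
    using comm_eq[of A B] by (simp add: C_def)
  then show ?thesis by (simp add: m_assoc)
qed

text \<open>
  Each passage of a \<open>B\<close> over \<open>A\<close> produces a factor
  \<open>C^(-1)\<close>, and moving it to the left raises the powers of \<open>B\<close> collected
  so far to the power \<open>\<alpha>\<close>; hence the recursion \<open>g_Suc\<close>.
\<close>

lemma Bpow_A: "B [^] j \<otimes> A = A \<otimes> C [^] (- j) \<otimes> B [^] g j"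
proof (induction j rule: int_induct[of _ 0])
  case base
  show ?case by simp
next
  case (step1 j)
  have "B [^] (j + 1) \<otimes> A = (B [^] j \<otimes> A) \<otimes> B \<otimes> inv C"
    using int_pow_mult[of B j 1] by (simp add: m_assoc B_A)
  also have "\<dots> = A \<otimes> C [^] (- j) \<otimes> (B [^] (g j + 1) \<otimes> inv C)"
    using int_pow_mult[of B "g j" 1] by (simp add: m_assoc step1)
  also have "\<dots> = A \<otimes> (C [^] (- j) \<otimes> inv C) \<otimes> B [^] (P 1 * (g j + 1))"
    by (simp add: B_invC m_assoc)
  also have "C [^] (- j) \<otimes> inv C = C [^] (- (j + 1))"
    using int_pow_mult[of C "- j" "- 1"] by (simp add: int_pow_neg)
  also have "B [^] (P 1 * (g j + 1)) = B [^] g (j + 1)"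
    by (rule pow_B_cong) (simp only: P_1 cong_sym[OF g_Suc])
  finally show ?case .
next
  case (step2 j)
  have "B [^] (j - 1) \<otimes> A \<otimes> B \<otimes> inv C = B [^] j \<otimes> A"
    using int_pow_mult[of B "j - 1" 1] by (simp add: m_assoc B_A)
  then have "B [^] (j - 1) \<otimes> A = B [^] j \<otimes> A \<otimes> C \<otimes> inv B"
    by (metis A_closed B_closed C_closed int_pow_closed inv_closed inv_inv inv_solve_right m_closed)
  also have "\<dots> = A \<otimes> (C [^] (- j) \<otimes> C) \<otimes> (B [^] (P (- 1) * g j) \<otimes> inv B)"
    by (simp add: step2 m_assoc B_C)
  also have "C [^] (- j) \<otimes> C = C [^] (- (j - 1))"
    using int_pow_mult[of C "- j" 1] by simp
  also have "B [^] (P (- 1) * g j) \<otimes> inv B = B [^] (P (- 1) * g j - 1)"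
    using int_pow_mult[of B "P (- 1) * g j" "- 1"] by (simp add: int_pow_neg)
  also have "B [^] (P (- 1) * g j - 1) = B [^] g (j - 1)"
  proof (rule pow_B_cong)
    have "[P (- 1) * g j = P (- 1) * ((1 + 4 * \<nu>) * (g (j - 1) + 1))] (mod M)"
      using g_Suc[of "j - 1"] by (intro cong_mult cong_refl) simp
    also have "[P (- 1) * ((1 + 4 * \<nu>) * (g (j - 1) + 1)) = g (j - 1) + 1] (mod M)"
      using alpha_inverse[of "g (j - 1) + 1"] by (simp only: mult.left_commute)
    finally show "[P (- 1) * g j - 1 = g (j - 1)] (mod M)"
      using cong_diff[OF _ cong_refl[of 1]] by fastforce
  qed
  finally show ?case .
qed

fun E :: "int \<times> int \<times> int \<Rightarrow> 'a" where "E (i, k, j) = A [^] i \<otimes> C [^] k \<otimes> B [^] j"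

lemma E_closed [simp]: "E x \<in> carrier J" by (cases x) simp

lemma E_A: "E x \<otimes> A = E (actA x)"
proof (cases x)
  fix i k j assume x: "x = (i, k, j)"
  have "E x \<otimes> A = A [^] i \<otimes> (C [^] k \<otimes> A) \<otimes> C [^] (- j) \<otimes> B [^] g j"
    by (simp add: x m_assoc Bpow_A)
  also have "C [^] k \<otimes> A = A [^] P (- k) \<otimes> C [^] k" using Cpow_A[of k 1] by simp
  finally show ?thesis
    using int_pow_mult[of A i "P (- k)"] int_pow_mult[of C k "- j"] by (simp add: x m_assoc)
qed

lemma E_B: "E x \<otimes> B = E (actB x)"
  using int_pow_mult[of B _ 1] by (cases x) (simp add: m_assoc)

lemma E_Bpow: "E (i, k, j) \<otimes> B [^] n = E (i, k, j + n)"
  using int_pow_mult[of B j n] by (simp add: m_assoc)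

lemma E_Cpow: "E (i, k, j) \<otimes> C [^] n = E (i, k + n, P (- n) * j)"
proof -
  have "E (i, k, j) \<otimes> C [^] n = A [^] i \<otimes> C [^] k \<otimes> (B [^] j \<otimes> C [^] n)" by (simp add: m_assoc)
  then show ?thesis using int_pow_mult[of C k n] by (simp add: Bpow_C m_assoc)
qed

lemma E_Apow: "E x \<otimes> A [^] (n::nat) = E ((actA ^^ n) x)"
proof (induction n)
  case (Suc n)
  have "E x \<otimes> A [^] Suc n = (E x \<otimes> A [^] n) \<otimes> A" by (simp add: m_assoc)
  then show ?case by (simp add: Suc E_A)
qed simp

lemma A_E: "A \<otimes> E (i, k, j) = E (i + 1, k, j)"
proof -
  have A: "A [^] (1 + i) = A \<otimes> A [^] i" using int_pow_mult[of A 1 i] by simp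
  show ?thesis unfolding E.simps add.commute[of i 1] A by (simp add: m_assoc)
qed

lemma E_one: "E (0, 0, 0) = \<one>" by simp

lemma carrier_E: "carrier J = range E"
proof (rule generated_by_right_mult[OF generated])
  have A: "inv A = A [^] nat (M - 1)" and B: "inv B = B [^] (M - 1)"
  proof -
    have i: "inv x = x [^] (M - 1)" if "x \<in> carrier J" "x [^] M = \<one>" for x
      using that int_pow_diff[of x M 1] by simp
    show "inv B = B [^] (M - 1)" using i B_M by simp
    have "A [^] (M - 1) = A [^] int (nat (M - 1))" using positive(4) by simp
    then show "inv A = A [^] nat (M - 1)" using i A_M by (simp only: int_pow_int A_closed)
  qed
  show "x \<otimes> y \<in> range E \<and> x \<otimes> inv y \<in> range E" if x: "x \<in> range E" and "y \<in> {A, B}" for x y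
  proof -
    obtain i k j where z: "x = E (i, k, j)" using x by (auto simp del: E.simps)
    have "x \<otimes> A = E (actA (i, k, j))" "x \<otimes> inv A = E ((actA ^^ nat (M - 1)) (i, k, j))"
      "x \<otimes> B = E (i, k, j + 1)" "x \<otimes> inv B = E (i, k, j + (M - 1))"
      unfolding z by (simp_all only: A B E_A E_B E_Apow E_Bpow actB.simps)
    moreover have "y = A \<or> y = B" using that(2) by simp
    ultimately show ?thesis by (elim disjE) (simp_all only: rangeI simp_thms)
  qed
  show "\<one> \<in> range E" using E_one by (metis rangeI)
qed (auto simp del: E.simps)

lemma pt_C: "x \<in> carrier J \<Longrightarrow> eqv (pt (x \<otimes> C)) (actC (pt x))"
proof -
  assume x: "x \<in> carrier J"
  define y where "y = x \<otimes> inv A \<otimes> inv B"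
  have y: "y \<in> carrier J" using x by (simp add: y_def)
  have "x = y \<otimes> B \<otimes> A" "x \<otimes> C = y \<otimes> A \<otimes> B" using x by (simp_all add: y_def C_def comm_def m_assoc)
  then have 1: "eqv (pt (x \<otimes> C)) (actB (actA (pt y)))" and 2: "eqv (pt x) (actA (actB (pt y)))"
    using eqv_trans[OF pt_B[of "y \<otimes> A"] actB_cong[OF pt_A[OF y]]]
      eqv_trans[OF pt_A[of "y \<otimes> B"] actA_cong[OF pt_B[OF y]]] y by simp_all
  have "eqv (actC (pt x)) (actB (actA (pt y)))"
    using eqv_trans[OF actC_cong[OF 2] actC_comm] .
  with 1 show ?thesis using eqv_sym eqv_trans by blast
qed

lemma actC_inj: "eqv (actC x) (actC y) \<Longrightarrow> eqv x y"
proof (cases x; cases y)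
  fix i k j i' k' j'
  assume "eqv (actC x) (actC y)" and xy: "x = (i, k, j)" "y = (i', k', j')"
  then have h: "q dvd k - k'" "q dvd P (- 1) * (j - j')"
    "M dvd (i - i') - P (- 1) * (j - j') + s * (k - k')"
    by (simp_all add: algebra_simps)
  have "q dvd (1 + 4 * \<nu>) * (P (- 1) * (j - j'))" using h(2) by simp
  then have j: "q dvd j - j'" using cong_M_imp_q[OF alpha_inverse] cong_dvd_iff by blast
  have "M dvd P (- 1) * (j - j') - (j - j')"
    using P_times_q_multiple[OF j] by (simp add: cong_iff_dvd_diff)
  from dvd_add[OF h(3) this] show "eqv x y" using h(1) j by (simp add: xy algebra_simps)
qed

lemma actB_inj: "eqv (actB x) (actB y) \<Longrightarrow> eqv x y"
  by (cases x; cases y) simp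

text \<open>
  The position in the model recovers the exponents up to \<open>eqv\<close>. For negative
  exponents one uses that \<open>actB\<close> and \<open>actC\<close> are injective up to
  \<open>eqv\<close>.
\<close>

lemma pt_E: "eqv (pt (E x)) x"
proof (cases x)
  fix i k j assume x: "x = (i, k, j)"
  have "eqv (pt (A [^] n)) (int n, 0, 0)" for n :: nat
  proof (induction n)
    case 0
    show ?case using pt_one by (simp del: eqv.simps)
  next
    case (Suc n)
    have "actA (int n, 0, 0) = (int (Suc n), 0, 0)" by simp
    then show ?case using eqv_trans[OF pt_A actA_cong[OF Suc]] by (simp del: eqv.simps actA.simps)
  qed
  from this[of "nat (i mod M)"] have "eqv (pt (A [^] int (nat (i mod M)))) (int (nat (i mod M)), 0, 0)"
    by (simp only: int_pow_int)
  then have "eqv (pt (A [^] (i mod M))) (i mod M, 0, 0)"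
    by (simp only: int_nat_eq pos_mod_sign[OF positive(4)] if_True)
  moreover have "A [^] (i mod M) = A [^] i" by (rule pow_A_cong) (simp add: cong_def)
  ultimately have a: "eqv (pt (A [^] i)) (i mod M, 0, 0)" by (simp only:)
  have "eqv (i mod M, 0, 0) (i, 0, 0)" by (rule eqv_fst) (simp add: cong_def)
  from eqv_trans[OF a this] have base: "eqv (pt (E (i, 0, 0))) (i, 0, 0)" by (simp del: eqv.simps)
  have C: "eqv (pt (E (i, k, 0))) (i, k, 0)"
  proof (induction k rule: int_induct[of _ 0])
    case (step1 k)
    have "eqv (pt (E (i, k, 0) \<otimes> C)) (actC (i, k, 0))"
      by (rule eqv_trans[OF pt_C[OF E_closed] actC_cong[OF step1(2)]])
    then show ?case using E_Cpow[of i k 0 1] by (simp del: eqv.simps E.simps)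
  next
    case (step2 k)
    have "E (i, k - 1, 0) \<otimes> C = E (i, k, 0)" using E_Cpow[of i "k - 1" 0 1] by (simp del: eqv.simps E.simps)
    then have "eqv (pt (E (i, k, 0))) (actC (pt (E (i, k - 1, 0))))"
      using pt_C[OF E_closed, of "(i, k - 1, 0)"] by (simp del: eqv.simps E.simps)
    from eqv_trans[OF eqv_sym[OF this] step2(2)] have "eqv (actC (pt (E (i, k - 1, 0)))) (i, k, 0)" .
    then have "eqv (actC (pt (E (i, k - 1, 0)))) (actC (i, k - 1, 0))" by (simp del: eqv.simps E.simps)
    then show ?case by (rule actC_inj)
  qed (rule base)
  show "eqv (pt (E x)) x" unfolding x
  proof (induction j rule: int_induct[of _ 0])
    case (step1 j)
    have "eqv (pt (E (i, k, j) \<otimes> B)) (actB (i, k, j))"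
      by (rule eqv_trans[OF pt_B[OF E_closed] actB_cong[OF step1(2)]])
    then show ?case by (simp only: E_B actB.simps)
  next
    case (step2 j)
    have "E (i, k, j - 1) \<otimes> B = E (i, k, j)" by (simp only: E_B actB.simps diff_add_cancel)
    then have "eqv (pt (E (i, k, j))) (actB (pt (E (i, k, j - 1))))"
      using pt_B[OF E_closed, of "(i, k, j - 1)"] by (simp del: eqv.simps E.simps)
    from eqv_trans[OF eqv_sym[OF this] step2(2)] have "eqv (actB (pt (E (i, k, j - 1)))) (i, k, j)" .
    then have "eqv (actB (pt (E (i, k, j - 1)))) (actB (i, k, j - 1))" by (simp del: eqv.simps E.simps)
    then show ?case by (rule actB_inj)
  qed (rule C)
qed

lemma E_eq_imp_eqv: "E x = E y \<Longrightarrow> eqv x y"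
  using pt_E eqv_sym eqv_trans by metis

lemma in_center: "z \<in> carrier J \<Longrightarrow> z \<otimes> A = A \<otimes> z \<Longrightarrow> z \<otimes> B = B \<otimes> z \<Longrightarrow> z \<in> center J"
  using central_if_commutes_with_generators[OF generated] by auto

lemma central_commute: "z \<in> center J \<Longrightarrow> x \<in> carrier J \<Longrightarrow> z \<otimes> x = x \<otimes> z"
  and central_closed: "z \<in> center J \<Longrightarrow> z \<in> carrier J"
  by (auto simp: center_def)

sublocale Z: normal "center J" J by (rule center_normal)

lemma central_pow: "z \<in> center J \<Longrightarrow> z [^] (n::int) \<in> center J"
  using Z.subgroup_axioms subgroup_int_pow_closed by blast

lemma C_pow_central: "q dvd k \<Longrightarrow> C [^] k \<in> center J"
proof (rule in_center)
  assume "q dvd k"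
  then have "[P (- k) = P 0] (mod M)" by (intro P_cong) (simp add: cong_iff_dvd_diff)
  then have P: "[P (- k) * 1 = 1] (mod M)" by simp
  show "C [^] k \<otimes> A = A \<otimes> C [^] k" using Cpow_A[of k 1] pow_A_cong[OF P] by simp
  show "C [^] k \<otimes> B = B \<otimes> C [^] k" using Bpow_C[of 1 k] pow_B_cong[OF P] by simp
qed simp

lemma unit_multiple:
  assumes "odd u"
  obtains x where "[q * u * x = q] (mod M)"
proof -
  have "coprime u w" using assms by (simp add: w_def)
  then obtain x where "[u * x = 1] (mod w)" using cong_solve_coprime_int by blast
  then have "q * w dvd q * (u * x - 1)" by (simp add: cong_iff_dvd_diff)
  then have "M dvd q * u * x - q" by (simp add: M_eq algebra_simps)
  then show thesis using that by (simp add: cong_iff_dvd_diff)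
qed

text \<open>
  Collection in \<open>J\<close> follows the same exponent maps as the model, so collecting
  \<open>B^\<alpha> AC=CBA^\<alpha>\<close> in two ways gives an identity between normal forms,
  whose right-hand side is \<open>A^(i') C^(1-S) B^y\<close>. It simplifies to
  \<open>A^(i'-1)=C^(S-\<alpha>) B^t\<close>, where \<open>C^(S-\<alpha>)\<close> is central, so
  \<open>A^(i'-1)\<close> commutes with \<open>B\<close> and \<open>B^t\<close> commutes with
  \<open>A\<close>. Here \<open>i'-1\<close> and \<open>t\<close> are odd multiples of
  \<open>q\<close> modulo \<open>M\<close>; therefore suitable powers are \<open>A^q\<close> and
  \<open>B^q\<close>.
\<close>

lemma A_q_central: "A [^] q \<in> center J" and B_q_central: "B [^] q \<in> center J"
proof -
  define S y where "S = g_sum alpha 1" and "y = (g ^^ alpha) 1"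
  obtain i' where i': "[i' = 0 + P (- 1) * P_sum alpha 1] (mod M)" "(actA ^^ alpha) (0, 1, 1) = (i', 1 - S, y)"
    unfolding S_def y_def using actA_iterate[of 0 1 alpha 1] by blast
  have i1: "[i' = 1 + 8 * \<nu> ^ 2] (mod M)" using cong_trans[OF i'(1)] P_sum_alpha[of 1] by simp
  have S: "[S = 1 + 4 * \<nu> + 8 * \<nu> ^ 2] (mod 2 * q)" using g_sum_alpha[of 1 1] by (simp add: S_def)
  have "q dvd S - (1 + 4 * \<nu>)"
    using dvd_add[OF cong_2q_imp_q[OF S, unfolded cong_iff_dvd_diff] q_dvd] by (simp add: algebra_simps)
  then have cen: "C [^] (S - (1 + 4 * \<nu>)) \<in> center J" by (rule C_pow_central)
  define z where "z = P (- 1) * g (1 + 4 * \<nu>)"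
  have z: "[z - y = - (8 * \<nu> ^ 2 * (1 + 2 * \<nu>))] (mod M)"
    using g_alpha[of 1 1] unfolding z_def y_def
    by (simp add: cong_iff_dvd_diff algebra_simps power2_eq_square power3_eq_cube)
  have "E (0, 0, 1 + 4 * \<nu>) \<otimes> A \<otimes> C = E (1, 1 - (1 + 4 * \<nu>), z)"
    using E_Cpow[of "1" "- (1 + 4 * \<nu>)" "g (1 + 4 * \<nu>)" 1]
    unfolding E_A by (simp add: z_def del: E.simps)
  moreover have "E (0, 0, 1 + 4 * \<nu>) \<otimes> A \<otimes> C = C \<otimes> B \<otimes> A [^] (1 + 4 * \<nu>)"
  proof -
    have "E (0, 0, 1 + 4 * \<nu>) \<otimes> A \<otimes> C = B [^] (1 + 4 * \<nu>) \<otimes> (A \<otimes> C)" by (simp add: m_assoc)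
    also have "A \<otimes> C = C \<otimes> A [^] (1 + 4 * \<nu>)" using A_C[of 1] by simp
    also have "B [^] (1 + 4 * \<nu>) \<otimes> (C \<otimes> A [^] (1 + 4 * \<nu>)) = (B [^] (1 + 4 * \<nu>) \<otimes> C) \<otimes> A [^] (1 + 4 * \<nu>)"
      by (simp add: m_assoc)
    also have "B [^] (1 + 4 * \<nu>) \<otimes> C = C \<otimes> B" using C_B[of 1] by simp
    finally show ?thesis .
  qed
  moreover have "C \<otimes> B \<otimes> A [^] (1 + 4 * \<nu>) = E (0, 1, 1) \<otimes> A [^] alpha"
    by (simp flip: int_pow_int int_alpha)
  ultimately have "E (1, 1 - (1 + 4 * \<nu>), z) = E (i', 1 - S, y)" by (simp only: E_Apow i'(2))
  then have eq: "A \<otimes> C [^] (- (4 * \<nu>)) \<otimes> B [^] z = A [^] i' \<otimes> C [^] (1 - S) \<otimes> B [^] y" by simp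
  define t where "t = P (- (S - 1)) * (z - y)"
  have "A [^] (i' - 1) = inv A \<otimes> (A [^] i' \<otimes> C [^] (1 - S) \<otimes> B [^] y) \<otimes> B [^] (- y) \<otimes> C [^] (S - 1)"
  proof -
    have "inv A \<otimes> (A [^] i' \<otimes> C [^] (1 - S) \<otimes> B [^] y) \<otimes> B [^] (- y) \<otimes> C [^] (S - 1)
        = inv A \<otimes> A [^] i' \<otimes> (C [^] (1 - S) \<otimes> (B [^] y \<otimes> B [^] (- y)) \<otimes> C [^] (S - 1))"
      by (simp only: m_assoc m_closed inv_closed int_pow_closed A_closed B_closed C_closed)
    also have "\<dots> = inv A \<otimes> A [^] i'"
      by (simp flip: int_pow_mult)
    also have "\<dots> = A [^] (i' - 1)" using int_pow_mult[of A "- 1" i'] by (simp add: int_pow_neg)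
    finally show ?thesis by simp
  qed
  also have "\<dots> = inv A \<otimes> (A \<otimes> C [^] (- (4 * \<nu>)) \<otimes> B [^] z) \<otimes> B [^] (- y) \<otimes> C [^] (S - 1)"
    by (simp only: eq)
  also have "\<dots> = inv A \<otimes> A \<otimes> (C [^] (- (4 * \<nu>)) \<otimes> ((B [^] z \<otimes> B [^] (- y)) \<otimes> C [^] (S - 1)))"
    by (simp only: m_assoc m_closed inv_closed int_pow_closed A_closed B_closed C_closed)
  also have "\<dots> = C [^] (- (4 * \<nu>)) \<otimes> (B [^] (z - y) \<otimes> C [^] (S - 1))"
    using int_pow_mult[of B z "- y"] by simp
  also have "\<dots> = C [^] (- (4 * \<nu>)) \<otimes> C [^] (S - 1) \<otimes> B [^] t"
    by (simp add: Bpow_C t_def m_assoc)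
  also have "C [^] (- (4 * \<nu>)) \<otimes> C [^] (S - 1) = C [^] (S - (1 + 4 * \<nu>))"
    using int_pow_mult[of C "- (4 * \<nu>)" "S - 1"] by (simp add: algebra_simps)
  finally have main: "A [^] (i' - 1) = C [^] (S - (1 + 4 * \<nu>)) \<otimes> B [^] t" .
  have comm_BA: "A [^] (i' - 1) \<otimes> B = B \<otimes> A [^] (i' - 1)"
  proof -
    have "B [^] t \<otimes> B = B \<otimes> B [^] t" using int_pow_mult[of B t 1] int_pow_mult[of B 1 t] by (simp add: add.commute)
    then show ?thesis unfolding main using central_commute[OF cen, of B] by (simp add: m_assoc) (simp flip: m_assoc)
  qed
  have comm_AB: "B [^] t \<otimes> A = A \<otimes> B [^] t"
  proof -
    have Bt: "B [^] t = inv (C [^] (S - (1 + 4 * \<nu>))) \<otimes> A [^] (i' - 1)"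
      unfolding main by (simp flip: m_assoc)
    have "A [^] (i' - 1) \<otimes> A = A \<otimes> A [^] (i' - 1)"
      using int_pow_mult[of A "i' - 1" 1] int_pow_mult[of A 1 "i' - 1"] by (simp add: add.commute)
    then show ?thesis unfolding Bt
      using central_commute[OF Z.m_inv_closed[OF cen], of A] by (simp add: m_assoc) (simp flip: m_assoc)
  qed
  obtain h where h: "odd h" "\<nu> = 2 ^ (m - 2) * h" using nu_form by blast
  have h2: "8 * \<nu> ^ 2 = q * h ^ 2" by (simp add: h two_powers power_mult_distrib)
  have "odd (h ^ 2)" using h(1) by simp
  then obtain x where "[q * h ^ 2 * x = q] (mod M)" using unit_multiple by blast
  moreover have "[(i' - 1) * x = q * h ^ 2 * x] (mod M)"
    using cong_mult[OF cong_diff[OF i1 cong_refl[of 1]] cong_refl[of x]] by (simp add: h2)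
  ultimately have "A [^] q = (A [^] (i' - 1)) [^] x"
    unfolding int_pow_pow[OF A_closed] using pow_A_cong cong_trans cong_sym by metis
  then have "A [^] q \<otimes> B = B \<otimes> A [^] q"
    using conj_pow[OF comm_BA, of x] by simp
  moreover have "A [^] q \<otimes> A = A \<otimes> A [^] q"
    using int_pow_mult[of A q 1] int_pow_mult[of A 1 q] by (simp add: add.commute)
  ultimately show "A [^] q \<in> center J" by (intro in_center) simp_all
  have "odd (- (h ^ 2 * (1 + 2 * \<nu>)))" using h(1) by simp
  then obtain x where "[q * - (h ^ 2 * (1 + 2 * \<nu>)) * x = q] (mod M)" using unit_multiple by blast
  moreover have "[t * x = q * - (h ^ 2 * (1 + 2 * \<nu>)) * x] (mod M)"
  proof -
    have zq: "[z - y = q * - (h ^ 2 * (1 + 2 * \<nu>))] (mod M)" using z by (simp add: h2 mult.assoc)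
    have "q dvd z - y" using cong_dvd_iff[OF cong_M_imp_q[OF zq]] by simp
    then have "[t = z - y] (mod M)" unfolding t_def by (rule P_times_q_multiple)
    from cong_mult[OF cong_trans[OF this zq] cong_refl[of x]] show ?thesis .
  qed
  ultimately have "B [^] q = (B [^] t) [^] x"
    unfolding int_pow_pow[OF B_closed] using pow_B_cong cong_trans cong_sym by metis
  then have "B [^] q \<otimes> A = A \<otimes> B [^] q"
    using conj_pow[OF comm_AB, of x] by simp
  moreover have "B [^] q \<otimes> B = B \<otimes> B [^] q"
    using int_pow_mult[of B q 1] int_pow_mult[of B 1 q] by (simp add: add.commute)
  ultimately show "B [^] q \<in> center J" by (intro in_center) simp_all
qed

text \<open>
  For the inclusion from left to right, the exponents of a central element are shown to be
  multiples of \<open>q\<close> in the order \<open>j\<close>, \<open>k\<close>, \<open>i\<close>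
  by commuting it with \<open>A\<close>, again with \<open>A\<close>, and with \<open>C\<close>;
  the factors already known to be central are removed in between.
\<close>

lemma center_eq: "center J = {E (i, k, j) | i k j. q dvd i \<and> q dvd k \<and> q dvd j}"
proof (intro equalityI subsetI)
  show "z \<in> center J" if "z \<in> {E (i, k, j) | i k j. q dvd i \<and> q dvd k \<and> q dvd j}" for z
  proof -
    from that obtain a k b where z: "z = E (q * a, k, q * b)" "q dvd k" by (auto elim!: dvdE simp del: E.simps)
    have "z = (A [^] q) [^] a \<otimes> C [^] k \<otimes> (B [^] q) [^] b"
      by (simp only: z(1) E.simps int_pow_pow A_closed B_closed)
    then show "z \<in> center J"
      using Z.m_closed[OF Z.m_closed[OF central_pow[OF A_q_central] C_pow_central[OF z(2)]] central_pow[OF B_q_central]]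
      by (simp only:)
  qed
next
  fix z assume zc: "z \<in> center J"
  note z = central_closed[OF zc] central_commute[OF zc]
  obtain x where "z = E x" using z(1) unfolding carrier_E by blast
  then obtain i k j where zE: "z = E (i, k, j)" by (cases x) (simp only:)
  have "E (i + 1, k, j) = E (actA (i, k, j))" using z(2)[OF A_closed] by (simp only: zE E_A A_E)
  then have "eqv (i + 1, k, j) (actA (i, k, j))" by (rule E_eq_imp_eqv)
  then have "q dvd k - (k - j)" by (simp only: eqv.simps actA.simps)
  then have j: "q dvd j" by simp
  then obtain b where "j = q * b" by blast
  then have Bj: "B [^] j \<in> center J"
    using central_pow[OF B_q_central, of b] by (simp only: int_pow_pow B_closed)
  have "z \<otimes> inv (B [^] j) \<in> center J" using zc Bj by simp
  moreover have "z \<otimes> inv (B [^] j) = A [^] i \<otimes> C [^] k" by (simp add: zE m_assoc)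
  ultimately have AC: "A [^] i \<otimes> C [^] k \<in> center J" by simp
  have "E (i, k, 0) \<otimes> A = A \<otimes> E (i, k, 0)" using central_commute[OF AC] by simp
  also have "A \<otimes> E (i, k, 0) = E (i + 1, k, 0)" by (rule A_E)
  finally have "E (actA (i, k, 0)) = E (i + 1, k, 0)" by (simp only: E_A)
  then have "eqv (actA (i, k, 0)) (i + 1, k, 0)" by (rule E_eq_imp_eqv)
  then have "M dvd P (- k) - 1" by simp
  also have "P (- k) - 1 = 4 * \<nu> * (- (k * (1 - 2 * \<nu> * (k + 1))))"
    by (simp add: P_def algebra_simps power2_eq_square)
  finally have "q dvd k * (1 - 2 * \<nu> * (k + 1))" unfolding M_dvd_4nu_iff by simp
  then have k: "q dvd k" unfolding q_def by (subst (asm) coprime_dvd_mult_left_iff) simp_all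
  have "A [^] i \<otimes> C [^] k \<otimes> inv (C [^] k) \<in> center J" using AC C_pow_central[OF k] by simp
  then have "A [^] i \<in> center J" by (simp add: m_assoc)
  then have "C \<otimes> A [^] ((1 + 4 * \<nu>) * i) = C \<otimes> A [^] i" using central_commute[of "A [^] i" C] by (simp flip: A_C)
  then have "E ((1 + 4 * \<nu>) * i, 0, 0) = E (i, 0, 0)" by simp
  then have "eqv ((1 + 4 * \<nu>) * i, 0, 0) (i, 0, 0)" by (rule E_eq_imp_eqv)
  then have "M dvd 4 * \<nu> * i" by (simp add: algebra_simps)
  then have "q dvd i" by (simp only: M_dvd_4nu_iff)
  then show "z \<in> {E (i, k, j) | i k j. q dvd i \<and> q dvd k \<and> q dvd j}" using zE k j by blast
qed

text \<open>
  Hence the centre is generated by \<open>A^q\<close> and \<open>B^q\<close>, and \<open>H\<close>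
  is obtained from \<open>J\<close> by adding the relations \<open>A^q=B^q=1\<close>. The proof
  compares \<open>B^q A=AC^(-q) B^(g(q))\<close> with the centrality of \<open>B^q\<close>.
\<close>

lemma C_pow_eq_B_pow:
  assumes "q dvd k"
  shows "\<exists>b. C [^] k = B [^] (q * b)"
proof -
  have "A \<otimes> B [^] q = A \<otimes> (C [^] (- q) \<otimes> B [^] g q)"
    using central_commute[OF B_q_central A_closed] Bpow_A[of q] by (simp add: m_assoc)
  then have "B [^] q = C [^] (- q) \<otimes> B [^] g q" by simp
  then have "C [^] q \<otimes> B [^] q = C [^] q \<otimes> C [^] (- q) \<otimes> B [^] g q" by (simp add: m_assoc)
  also have "C [^] q \<otimes> C [^] (- q) = \<one>" by (simp flip: int_pow_mult)
  finally have CB: "C [^] q \<otimes> B [^] q = B [^] g q" by simp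
  have "C [^] q = C [^] q \<otimes> B [^] q \<otimes> B [^] (- q)" by (simp add: m_assoc flip: int_pow_mult)
  also have "\<dots> = B [^] (g q - q)" unfolding CB by (simp flip: int_pow_mult)
  finally have Cq: "C [^] q = B [^] (g q - q)" .
  have "3 * (g q - q) = q * (6 * \<nu> * (q + 1) + 8 * \<nu> ^ 2 * (q ^ 2 - 1))"
    unfolding right_diff_distrib three_g by (simp add: algebra_simps power2_eq_square power3_eq_cube)
  then have "q dvd 3 * (g q - q)" by simp
  then obtain c where c: "g q - q = q * c" using dvd_third(1) by blast
  obtain d where d: "k = q * d" using assms by blast
  have "C [^] k = (B [^] (q * c)) [^] d"
    unfolding d int_pow_pow[OF C_closed, symmetric] Cq c ..
  also have "\<dots> = B [^] (q * (c * d))" by (simp only: int_pow_pow B_closed mult.assoc)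
  finally show ?thesis by blast
qed

definition EH :: "int \<Rightarrow> int \<Rightarrow> int \<Rightarrow> 'a set" where "EH i k j = center J #> E (i, k, j)"

lemma rcos_eq_iff: "x \<in> carrier J \<Longrightarrow> y \<in> carrier J \<Longrightarrow> center J #> x = center J #> y \<longleftrightarrow> (\<exists>z\<in>center J. x = z \<otimes> y)"
  using rcos_self[of x "center J"] repr_independence[of x "center J" y] Z.subgroup_axioms
  by (auto simp: r_coset_def)

lemma EH_eq_iff: "EH i k j = EH i' k' j' \<longleftrightarrow> q dvd i - i' \<and> q dvd k - k' \<and> q dvd j - j'"
proof
  assume "EH i k j = EH i' k' j'"
  then obtain z where z: "z \<in> center J" "E (i, k, j) = z \<otimes> E (i', k', j')"
    using rcos_eq_iff[OF E_closed E_closed] unfolding EH_def by blast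
  then obtain a b c where abc: "z = E (a, b, c)" "q dvd a" "q dvd b" "q dvd c" unfolding center_eq by blast
  have Ca: "C [^] b \<in> center J" and Bc: "B [^] c \<in> center J"
    using C_pow_central abc central_pow[OF B_q_central] by (auto simp: int_pow_pow[symmetric] elim!: dvdE)
  have "z \<otimes> E (i', k', j') = A [^] a \<otimes> (C [^] b \<otimes> (B [^] c \<otimes> (A [^] i' \<otimes> (C [^] k' \<otimes> B [^] j'))))"
    by (simp add: abc m_assoc)
  also have "B [^] c \<otimes> (A [^] i' \<otimes> (C [^] k' \<otimes> B [^] j')) = A [^] i' \<otimes> (C [^] k' \<otimes> B [^] j') \<otimes> B [^] c"
    by (rule central_commute[OF Bc]) simp
  also have "\<dots> = A [^] i' \<otimes> (C [^] k' \<otimes> B [^] (j' + c))" by (simp add: m_assoc int_pow_mult)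
  also have "C [^] b \<otimes> (A [^] i' \<otimes> (C [^] k' \<otimes> B [^] (j' + c))) = C [^] b \<otimes> A [^] i' \<otimes> (C [^] k' \<otimes> B [^] (j' + c))"
    by (simp add: m_assoc)
  also have "C [^] b \<otimes> A [^] i' = A [^] i' \<otimes> C [^] b" by (rule central_commute[OF Ca]) simp
  also have "A [^] a \<otimes> (A [^] i' \<otimes> C [^] b \<otimes> (C [^] k' \<otimes> B [^] (j' + c)))
      = (A [^] a \<otimes> A [^] i') \<otimes> (C [^] b \<otimes> C [^] k') \<otimes> B [^] (j' + c)"
    by (simp only: m_assoc m_closed int_pow_closed A_closed B_closed C_closed)
  also have "\<dots> = E (a + i', b + k', j' + c)" by (simp add: int_pow_mult)
  finally have "E (i, k, j) = E (a + i', b + k', j' + c)" using z(2) by (simp only:)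
  then have e: "eqv (i, k, j) (a + i', b + k', j' + c)" by (rule E_eq_imp_eqv)
  have "q dvd k - k'" "q dvd j - j'"
    using dvd_add[of q "k - (b + k')" b] dvd_add[of q "j - (j' + c)" c] e abc by simp_all
  moreover have "q dvd (i - (a + i')) - (j - (j' + c)) + s * (k - (b + k'))"
    using e dvd_trans[OF q_dvd_M] by simp
  then have "q dvd (i - (a + i'))"
    using e by (metis dvd_add_left_iff dvd_diff_left_iff dvd_mult eqv.simps)
  then have "q dvd i - i'" using dvd_add[of q "i - (a + i')" a] abc by simp
  ultimately show "q dvd i - i' \<and> q dvd k - k' \<and> q dvd j - j'" by blast
next
  assume "q dvd i - i' \<and> q dvd k - k' \<and> q dvd j - j'"
  then obtain a b c where "i - i' = q * a" "k - k' = q * b" "j - j' = q * c" by (auto elim!: dvdE)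
  then have abc: "i = q * a + i'" "k = q * b + k'" "j = j' + q * c" by simp_all
  have Ca: "C [^] (q * b) \<in> center J" and Bc: "B [^] (q * c) \<in> center J" and Aa: "A [^] (q * a) \<in> center J"
    using C_pow_central central_pow[OF B_q_central, of c] central_pow[OF A_q_central, of a]
    by (simp_all only: int_pow_pow A_closed B_closed dvd_triv_left)
  let ?z = "A [^] (q * a) \<otimes> C [^] (q * b) \<otimes> B [^] (q * c)"
  have "E (i, k, j) = (A [^] (q * a) \<otimes> A [^] i') \<otimes> (C [^] (q * b) \<otimes> C [^] k') \<otimes> (B [^] j' \<otimes> B [^] (q * c))"
    by (simp add: abc int_pow_mult)
  also have "\<dots> = A [^] (q * a) \<otimes> (A [^] i' \<otimes> C [^] (q * b)) \<otimes> ((C [^] k' \<otimes> B [^] j') \<otimes> B [^] (q * c))"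
    by (simp only: m_assoc m_closed int_pow_closed A_closed B_closed C_closed)
  also have "A [^] i' \<otimes> C [^] (q * b) = C [^] (q * b) \<otimes> A [^] i'"
    by (rule central_commute[OF Ca, symmetric]) simp
  also have "A [^] (q * a) \<otimes> (C [^] (q * b) \<otimes> A [^] i') \<otimes> ((C [^] k' \<otimes> B [^] j') \<otimes> B [^] (q * c))
      = A [^] (q * a) \<otimes> C [^] (q * b) \<otimes> ((A [^] i' \<otimes> C [^] k' \<otimes> B [^] j') \<otimes> B [^] (q * c))"
    by (simp only: m_assoc m_closed int_pow_closed A_closed B_closed C_closed)
  also have "(A [^] i' \<otimes> C [^] k' \<otimes> B [^] j') \<otimes> B [^] (q * c) = B [^] (q * c) \<otimes> (A [^] i' \<otimes> C [^] k' \<otimes> B [^] j')"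
    by (rule central_commute[OF Bc, symmetric]) simp
  finally have "E (i, k, j) = ?z \<otimes> E (i', k', j')"
    by (simp only: m_assoc m_closed int_pow_closed A_closed B_closed C_closed E.simps)
  moreover have "?z \<in> center J" using Aa Ca Bc by (intro Z.m_closed)
  ultimately show "EH i k j = EH i' k' j'"
    unfolding EH_def rcos_eq_iff[OF E_closed E_closed] by blast
qed

lemma EH_cong: "[i = i'] (mod q) \<Longrightarrow> [k = k'] (mod q) \<Longrightarrow> [j = j'] (mod q) \<Longrightarrow> EH i k j = EH i' k' j'"
  unfolding EH_eq_iff cong_iff_dvd_diff by simp

text \<open>
  Multiply the first factor successively by \<open>A^(i')\<close>, \<open>C^(k')\<close> and
  \<open>B^(j')\<close> and reduce the closed forms modulo \<open>q\<close>. The exponent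
  \<open>i'\<close> is first replaced by a natural number so that \<open>A^(i')\<close> is an
  iterate.
\<close>

lemma EH_mult:
  "EH i k j \<otimes>\<^bsub>J Mod center J\<^esub> EH i' k' j' =
    EH (i + i' + 2 * \<nu> * j * (i' ^ 2 - i') - 4 * \<nu> * k * i')
       (k + k' - i' * j - \<nu> * (i' ^ 2 - i') * (j ^ 2 + j))
       (j + j' + 2 * \<nu> * i' * (j ^ 2 + j) - 4 * \<nu> * k' * j)" (is "_ = EH (?I i') (?K i') (?J i')")
proof -
  define n where "n = nat (i' mod q)"
  have n: "[int n = i'] (mod q)" by (simp add: n_def cong_def)
  then have i': "EH i' k' j' = EH (int n) k' j'" by (intro EH_cong cong_refl) (rule cong_sym)
  obtain i'' where i'': "[i'' = i + P (- k) * P_sum n j] (mod M)"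
    "(actA ^^ n) (i, k, j) = (i'', k - g_sum n j, (g ^^ n) j)" using actA_iterate by blast
  have "E (i, k, j) \<otimes> E (int n, k', j') = E (i, k, j) \<otimes> A [^] n \<otimes> C [^] k' \<otimes> B [^] j'"
    by (simp add: m_assoc int_pow_int)
  also have "\<dots> = E (i'', k - g_sum n j + k', P (- k') * (g ^^ n) j + j')"
    unfolding E_Apow i'' E_Cpow E_Bpow ..
  finally have "EH i k j \<otimes>\<^bsub>J Mod center J\<^esub> EH i' k' j' = EH i'' (k - g_sum n j + k') (P (- k') * (g ^^ n) j + j')"
    unfolding i' unfolding EH_def by (simp add: Z.rcos_sum del: E.simps)
  also have "\<dots> = EH (?I (int n)) (?K (int n)) (?J (int n))"
  proof (rule EH_cong)
    have P: "[P (- x) = 1 - 4 * \<nu> * x] (mod q)" for x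
    proof -
      have "P (- x) - (1 - 4 * \<nu> * x) = 8 * \<nu> ^ 2 * (x ^ 2 + x)" by (simp add: P_def)
      then show ?thesis unfolding cong_iff_dvd_diff by (rule q_dvdI)
    qed
    have "[i'' = i + (1 - 4 * \<nu> * k) * (int n + 2 * \<nu> * j * (int n ^ 2 - int n))] (mod q)"
      using cong_trans[OF cong_M_imp_q[OF i''(1)] cong_add[OF cong_refl cong_mult[OF P iterate_mod_q(3)]]] .
    moreover have "i + (1 - 4 * \<nu> * k) * (int n + 2 * \<nu> * j * (int n ^ 2 - int n)) - ?I (int n)
        = 8 * \<nu> ^ 2 * (- (k * j * (int n ^ 2 - int n)))"
      by (simp add: algebra_simps power2_eq_square)
    ultimately show "[i'' = ?I (int n)] (mod q)" using cong_trans_dvd q_dvdI by blast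
    have "[k - g_sum n j + k' = k - (int n * j + \<nu> * (int n ^ 2 - int n) * (j ^ 2 + j)) + k'] (mod q)"
      by (intro cong_add cong_diff cong_refl iterate_mod_q)
    then show "[k - g_sum n j + k' = ?K (int n)] (mod q)" by (simp add: algebra_simps)
    have "[P (- k') * (g ^^ n) j + j' = (1 - 4 * \<nu> * k') * (j + 2 * \<nu> * int n * (j ^ 2 + j)) + j'] (mod q)"
      by (intro cong_add cong_mult cong_refl iterate_mod_q P)
    moreover have "(1 - 4 * \<nu> * k') * (j + 2 * \<nu> * int n * (j ^ 2 + j)) + j' - ?J (int n)
        = 8 * \<nu> ^ 2 * (- (k' * int n * (j ^ 2 + j)))"
      by (simp add: algebra_simps power2_eq_square)
    ultimately show "[P (- k') * (g ^^ n) j + j' = ?J (int n)] (mod q)" using cong_trans_dvd q_dvdI by blast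
  qed
  also have "\<dots> = EH (?I i') (?K i') (?J i')"
    using n by (intro EH_cong cong_add cong_diff cong_mult cong_pow cong_refl)
  finally show ?thesis .
qed

lemma carrier_quotient: "carrier (J Mod center J) = {EH i k j | i k j. True}"
proof -
  have "carrier (J Mod center J) = (\<lambda>x. center J #> x) ` range E"
    unfolding carrier_E[symmetric] by (auto simp: FactGroup_def RCOSETS_def)
  then show ?thesis unfolding EH_def by (auto simp del: E.simps)
qed

end

section \<open>Words acting on the model\<close>

context macdonald_params begin

text \<open>
  An inverse letter acts as the \<open>M - 1\<close>-st iterate, since the \<open>M\<close>-th
  iterate is the identity up to \<open>eqv\<close>. This avoids defining inverse maps on triples.
\<close>

fun act_gen :: "gen \<Rightarrow> int \<times> int \<times> int \<Rightarrow> int \<times> int \<times> int" where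
  "act_gen GenA = actA" | "act_gen GenB = actB"

primrec act :: "gen word \<Rightarrow> int \<times> int \<times> int \<Rightarrow> int \<times> int \<times> int" where
  "act [] p = p"
| "act (a # u) p = act u ((act_gen (snd a) ^^ (if fst a then M_nat - 1 else 1)) p)"

lemma act_append: "act (u @ v) p = act v (act u p)"
  by (induction u arbitrary: p) simp_all

lemma act_gen_cong: "eqv p p' \<Longrightarrow> eqv ((act_gen x ^^ n) p) ((act_gen x ^^ n) p')"
  by (induction n; cases x) (auto intro: actA_cong actB_cong simp del: actA.simps actB.simps)

lemma act_gen_M: "eqv ((act_gen x ^^ M_nat) p) p"
  by (cases x) (simp_all add: actA_M actB_M)

lemma act_cong: "eqv p p' \<Longrightarrow> eqv (act u p) (act u p')"
proof (induction u arbitrary: p p')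
  case (Cons a u)
  show ?case unfolding act.simps by (rule Cons.IH[OF act_gen_cong[OF Cons.prems]])
qed simp

lemma M_nat_pos: "M_nat > 0"
  using int_M_nat positive(4) by (metis of_nat_0_less_iff)

lemma act_cancel: "eqv (act [(e, x), (\<not> e, x)] p) p"
proof -
  have "act [(e, x), (\<not> e, x)] p = (act_gen x ^^ ((M_nat - 1) + 1)) p"
  proof (cases e)
    case True
    have "act [(e, x), (\<not> e, x)] p = (act_gen x ^^ 1) ((act_gen x ^^ (M_nat - 1)) p)" using True by simp
    then show ?thesis by (simp only: funpow_add o_apply add.commute[of "M_nat - 1"])
  next
    case False
    have "act [(e, x), (\<not> e, x)] p = (act_gen x ^^ (M_nat - 1)) ((act_gen x ^^ 1) p)" using False by simp
    then show ?thesis by (simp only: funpow_add o_apply)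
  qed
  then show ?thesis using M_nat_pos act_gen_M by simp
qed

lemma act_word_eq:
  assumes "\<And>l r p. (l, r) \<in> R \<Longrightarrow> eqv (act l p) (act r p)" and "word_eq R u v"
  shows "eqv (act u p) (act v p)"
  using assms(2)
proof (induction arbitrary: p rule: word_eq.induct)
  case (cancel u e x v)
  then show ?case unfolding act_append by (rule act_cong[OF act_cancel])
next
  case (relation l r u v)
  then show ?case unfolding act_append by (intro act_cong assms(1))
next
  case (sym u v)
  show ?case by (rule eqv_sym[OF sym.IH])
next
  case (trans u v w)
  show ?case by (rule eqv_trans[OF trans.IH])
qed (rule eqv_refl)

lemma act_inv: "eqv (act u (act (word_inv u) p)) p" "eqv (act (word_inv u) (act u p)) p"
proof -
  have 1: "eqv (act u (act (word_inv u) p)) p" for u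
    using act_word_eq[OF _ word_eq_inv_left[of "{}" u], of p] by (simp add: act_append)
  have "word_inv (word_inv u) = u" by (simp add: word_inv_def rev_map o_def split_def)
  with 1 1[of "word_inv u"] show "eqv (act u (act (word_inv u) p)) p" "eqv (act (word_inv u) (act u p)) p"
    by simp_all
qed

lemma act_gen_period:
  assumes "[int n = int n'] (mod M)"
  shows "eqv ((act_gen x ^^ n) p) ((act_gen x ^^ n') p)"
proof -
  have add: "eqv ((act_gen x ^^ (k + M_nat * t)) p) ((act_gen x ^^ k) p)" for k t
  proof (induction t)
    case (Suc t)
    have "k + M_nat * Suc t = M_nat + (k + M_nat * t)" by simp
    then have "(act_gen x ^^ (k + M_nat * Suc t)) p = (act_gen x ^^ M_nat) ((act_gen x ^^ (k + M_nat * t)) p)"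
      by (simp only: funpow_add[of M_nat] o_apply)
    then show ?case using eqv_trans[OF act_gen_M Suc] by (simp only:)
  qed simp
  have "[n = n'] (mod M_nat)" using assms by (simp add: int_M_nat[symmetric] cong_int_iff)
  then obtain t1 t2 where "M_nat * t1 + n = M_nat * t2 + n'" unfolding cong_iff_lin_nat by (metis mult.commute add.commute)
  then have "n + M_nat * t1 = n' + M_nat * t2" by simp
  then show ?thesis using eqv_trans[OF eqv_sym[OF add[of n t1]]] add[of n' t2] by (simp only:)
qed

lemma act_word_pow:
  assumes "[n = int n'] (mod M)"
  shows "eqv (act (word_pow (letter x) n) p) ((act_gen x ^^ n') p)"
proof -
  have rep: "act (concat (replicate k [(e, x)])) p = (act_gen x ^^ (k * (if e then M_nat - 1 else 1))) p" for k e
  proof (induction k arbitrary: p)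
    case (Suc k)
    then show ?case by (simp add: funpow_add add.commute[of _ "k * _"])
  qed simp
  show ?thesis
  proof (cases "n \<ge> 0")
    case True
    have "act (word_pow (letter x) n) p = (act_gen x ^^ nat n) p"
      using True rep[of "nat n" False] by (simp add: word_pow_def letter_def)
    moreover have "[int (nat n) = int n'] (mod M)" using True assms by simp
    ultimately show ?thesis by (simp only: act_gen_period)
  next
    case False
    then have "act (word_pow (letter x) n) p = (act_gen x ^^ (nat (- n) * (M_nat - 1))) p"
      using rep[of "nat (- n)" True] by (simp add: word_pow_def letter_def word_inv_def)
    moreover have "[int (nat (- n) * (M_nat - 1)) = int n'] (mod M)"
    proof -
      have "int (nat (- n) * (M_nat - 1)) = (- n) * (M - 1)"
        using False M_nat_pos by (simp add: of_nat_diff int_M_nat)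
      then have "int (nat (- n) * (M_nat - 1)) - n = M * (- n)" by (simp add: algebra_simps)
      then have "[int (nat (- n) * (M_nat - 1)) = n] (mod M)" by (simp only: cong_iff_dvd_diff dvd_triv_left)
      then show ?thesis using assms by (rule cong_trans)
    qed
    ultimately show ?thesis by (simp only: act_gen_period)
  qed
qed

lemma act_comm: "eqv (act (word_comm (letter GenA) (letter GenB)) p) (actC p)"
proof -
  let ?A = "letter GenA" and ?B = "letter GenB"
  define y where "y = act (word_inv ?A @ word_inv ?B) p"
  have "eqv (act (?B @ ?A) y) p"
    using act_inv(1)[of "?B @ ?A" p] by (simp add: y_def word_inv_def letter_def)
  then have p: "eqv (actA (actB y)) p" by (simp add: letter_def act_append del: actA.simps actB.simps)
  have "act (word_comm ?A ?B) p = actB (actA y)"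
    by (simp add: y_def word_comm_def act_append letter_def del: actA.simps actB.simps)
  also have "eqv \<dots> (actC (actA (actB y)))" by (rule eqv_sym[OF actC_comm])
  also have "eqv \<dots> (actC p)" by (rule actC_cong[OF p])
  finally show ?thesis by (simp del: eqv.simps)
qed

text \<open>
  Both relators are reduced to \<open>actA_relation\<close> and \<open>actB_relation\<close> by
  writing the argument as the image of some \<open>y\<close> under the commutator word.
\<close>

lemma act_relations:
  assumes "[J_alpha m l = 1 + 4 * \<nu>] (mod M)" and "(u, v) \<in> J_relations m l"
  shows "eqv (act u p) (act v p)"
proof -
  let ?A = "letter GenA" and ?B = "letter GenB"
  let ?c = "word_comm ?A ?B"
  have pow: "eqv (act (word_pow (letter x) (J_alpha m l)) p) ((act_gen x ^^ alpha) p)" for x p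
    using assms(1) by (intro act_word_pow) (simp add: int_alpha)
  have inv_c: "word_inv ?c = word_comm ?B ?A" "word_inv (word_comm ?B ?A) = ?c"
    by (simp_all add: word_comm_def word_inv_def letter_def)
  have A: "eqv (act (word_conj ?A ?c) p) (act (word_pow ?A (J_alpha m l)) p)"
  proof -
    define y where "y = act (word_inv ?c) p"
    have y: "eqv (actC y) p" using eqv_trans[OF eqv_sym[OF act_comm] act_inv(1)] by (simp only: y_def)
    have "act (word_conj ?A ?c) p = act ?c (actA y)"
      by (simp add: word_conj_def act_append y_def letter_def del: actA.simps)
    also have "eqv \<dots> (actC (actA y))" by (rule act_comm)
    also have "eqv \<dots> ((actA ^^ alpha) (actC y))" by (rule actA_relation)
    also have "eqv \<dots> ((actA ^^ alpha) p)" using act_gen_cong[OF y, where x = GenA] by simp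
    also have "eqv \<dots> (act (word_pow ?A (J_alpha m l)) p)" using eqv_sym[OF pow[of GenA]] by simp
    finally show ?thesis .
  qed
  have B: "eqv (act (word_conj ?B (word_comm ?B ?A)) p) (act (word_pow ?B (J_alpha m l)) p)"
  proof -
    have "act (word_conj ?B (word_comm ?B ?A)) p = act (word_comm ?B ?A) (actB (act ?c p))"
      by (simp only: word_conj_def act_append inv_c) (simp add: letter_def del: actB.simps)
    also have "eqv \<dots> (act (word_comm ?B ?A) (actB (actC p)))" by (intro act_cong actB_cong act_comm)
    also have "eqv \<dots> (act (word_comm ?B ?A) (actC ((actB ^^ alpha) p)))" by (intro act_cong actB_relation)
    also have "eqv \<dots> (act (word_comm ?B ?A) (act ?c ((actB ^^ alpha) p)))"
      by (intro act_cong) (rule eqv_sym[OF act_comm])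
    also have "eqv \<dots> ((actB ^^ alpha) p)" using act_inv(2)[of ?c] by (simp only: inv_c)
    also have "eqv \<dots> (act (word_pow ?B (J_alpha m l)) p)" using eqv_sym[OF pow[of GenB]] by simp
    finally show ?thesis .
  qed
  have M: "eqv (act (word_pow (letter x) (2 ^ (3 * m - 1))) p) (act [] p)" for x
    using act_word_pow[of "2 ^ (3 * m - 1)" 0 x p] by (simp add: M_def cong_def)
  show ?thesis using assms(2) A B M by (auto simp: J_relations_def Let_def)
qed

definition pt :: "(gen word \<times> gen word) set \<Rightarrow> gen word set \<Rightarrow> int \<times> int \<times> int" where
  "pt R X = act (SOME u. word_class R u = X) (0, 0, 0)"

lemma pt_word_class:
  assumes "[J_alpha m l = 1 + 4 * \<nu>] (mod M)"
  shows "eqv (pt (J_relations m l) (word_class (J_relations m l) u)) (act u (0, 0, 0))"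
proof -
  let ?R = "J_relations m l"
  have "word_class ?R (SOME v. word_class ?R v = word_class ?R u) = word_class ?R u"
    by (rule someI[of _ u]) simp
  then show ?thesis
    unfolding pt_def word_class_eq_iff using act_word_eq[OF act_relations[OF assms]] by blast
qed

lemma macdonald_J_J_group:
  assumes "[J_alpha m l = 1 + 4 * \<nu>] (mod M)"
  shows "macdonald_J m \<nu> (J_group m l) (word_class (J_relations m l) (letter GenA))
    (word_class (J_relations m l) (letter GenB)) (pt (J_relations m l))"
proof -
  let ?R = "J_relations m l"
  let ?h = "\<lambda>x. word_class ?R (letter x)"
  define J where "J = J_group m l"
  have J: "J = presented_group ?R" by (simp add: J_def J_group_def)
  interpret J: group J unfolding J by (rule group_presented_group)
  have h: "?h x \<in> carrier J" for x by (simp add: J presented_group_def)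
  have ev: "word_class ?R u = word_eval J ?h u" for u
    unfolding J by (rule word_class_eval)
  have rel: "word_eval J ?h u = word_eval J ?h v" if "(u, v) \<in> ?R" for u v
    unfolding ev[symmetric] word_class_eq_iff using word_eq.relation[OF that, of "[]" "[]"] by simp
  have pow_M: "?h x [^]\<^bsub>J\<^esub> M = \<one>\<^bsub>J\<^esub>" for x
  proof -
    have "(word_pow (letter x) (2 ^ (3 * m - 1)), []) \<in> ?R"
      by (cases x) (simp_all add: J_relations_def Let_def)
    from rel[OF this] show ?thesis by (simp add: J.word_eval_pow[OF h] J.word_eval_letter[OF h] M_def)
  qed
  have pow: "?h x [^]\<^bsub>J\<^esub> J_alpha m l = ?h x [^]\<^bsub>J\<^esub> (1 + 4 * \<nu>)" for x
  proof -
    obtain t where "J_alpha m l = (1 + 4 * \<nu>) + M * t" using assms by (metis cong_iff_lin cong_sym)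
    then have "?h x [^]\<^bsub>J\<^esub> J_alpha m l = ?h x [^]\<^bsub>J\<^esub> (1 + 4 * \<nu>) \<otimes>\<^bsub>J\<^esub> (?h x [^]\<^bsub>J\<^esub> M) [^]\<^bsub>J\<^esub> t"
      by (simp only: J.int_pow_mult J.int_pow_pow h)
    then show ?thesis using h by (simp add: pow_M)
  qed
  define A B where "A = ?h GenA" and "B = ?h GenB"
  have AB: "A \<in> carrier J" "B \<in> carrier J" by (simp_all add: A_def B_def h)
  have relA: "inv\<^bsub>J\<^esub> J.comm A B \<otimes>\<^bsub>J\<^esub> A \<otimes>\<^bsub>J\<^esub> J.comm A B = A [^]\<^bsub>J\<^esub> (1 + 4 * \<nu>)"
  proof -
    have "(word_conj (letter GenA) (word_comm (letter GenA) (letter GenB)), word_pow (letter GenA) (J_alpha m l)) \<in> ?R"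
      by (simp add: J_relations_def Let_def)
    from rel[OF this] show ?thesis
      by (simp add: J.word_eval_conj[OF h] J.word_eval_comm[OF h] J.word_eval_pow[OF h]
          J.word_eval_letter[OF h] A_def B_def pow)
  qed
  have relB: "inv\<^bsub>J\<^esub> J.comm B A \<otimes>\<^bsub>J\<^esub> B \<otimes>\<^bsub>J\<^esub> J.comm B A = B [^]\<^bsub>J\<^esub> (1 + 4 * \<nu>)"
  proof -
    have "(word_conj (letter GenB) (word_comm (letter GenB) (letter GenA)), word_pow (letter GenB) (J_alpha m l)) \<in> ?R"
      by (simp add: J_relations_def Let_def)
    from rel[OF this] show ?thesis
      by (simp add: J.word_eval_conj[OF h] J.word_eval_comm[OF h] J.word_eval_pow[OF h]
          J.word_eval_letter[OF h] A_def B_def pow)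
  qed
  have "macdonald_J m \<nu> J A B (pt ?R)"
  proof unfold_locales
    show "A \<in> carrier J" "B \<in> carrier J" by (fact AB)+
    show "A \<otimes>\<^bsub>J\<^esub> J.comm A B = J.comm A B \<otimes>\<^bsub>J\<^esub> A [^]\<^bsub>J\<^esub> (1 + 4 * \<nu>)"
      unfolding relA[symmetric] using AB by (simp flip: J.m_assoc)
    show "J.comm A B \<otimes>\<^bsub>J\<^esub> B = B [^]\<^bsub>J\<^esub> (1 + 4 * \<nu>) \<otimes>\<^bsub>J\<^esub> J.comm A B"
      unfolding relB[symmetric] J.comm_swap[OF AB] using AB by (simp add: J.m_assoc)
    show "A [^]\<^bsub>J\<^esub> M = \<one>\<^bsub>J\<^esub>" "B [^]\<^bsub>J\<^esub> M = \<one>\<^bsub>J\<^esub>" by (simp_all add: A_def B_def pow_M)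
    have "(UNIV :: gen set) = {GenA, GenB}" using gen.exhaust by blast
    from arg_cong[OF this, of "image ?h"] have "range ?h = {A, B}"
      by (simp only: image_insert image_empty A_def B_def)
    then show "carrier J = generate J {A, B}" using presented_group_generated[of ?R] by (simp add: J)
    have "\<one>\<^bsub>J\<^esub> = word_class ?R []" by (simp add: J presented_group_def)
    then show "eqv (pt ?R \<one>\<^bsub>J\<^esub>) (0, 0, 0)" using pt_word_class[OF assms, of "[]"] by (simp del: eqv.simps)
    have step: "eqv (pt ?R (x \<otimes>\<^bsub>J\<^esub> ?h y)) (act_gen y (pt ?R x))" if "x \<in> carrier J" for x y
    proof -
      obtain u where u: "x = word_class ?R u" using \<open>x \<in> carrier J\<close> by (auto simp: J presented_group_def)
      have "x \<otimes>\<^bsub>J\<^esub> ?h y = word_class ?R (u @ letter y)" by (simp add: J presented_group_mult u)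
      then have 1: "eqv (pt ?R (x \<otimes>\<^bsub>J\<^esub> ?h y)) (act (u @ letter y) (0, 0, 0))"
        using pt_word_class[OF assms] by (simp only:)
      have "act (u @ letter y) (0, 0, 0) = act_gen y (act u (0, 0, 0))"
        by (simp add: act_append letter_def)
      moreover have "eqv (act u (0, 0, 0)) (pt ?R x)" unfolding u by (rule eqv_sym[OF pt_word_class[OF assms]])
      then have "eqv (act_gen y (act u (0, 0, 0))) (act_gen y (pt ?R x))"
        using act_gen_cong[where n = 1] by simp
      ultimately show ?thesis using eqv_trans[OF 1] by (simp only:)
    qed
    show "eqv (pt ?R (x \<otimes>\<^bsub>J\<^esub> A)) (actA (pt ?R x))" "eqv (pt ?R (x \<otimes>\<^bsub>J\<^esub> B)) (actB (pt ?R x))"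
      if "x \<in> carrier J" for x
      using step[OF that, of GenA] step[OF that, of GenB] by (simp_all only: A_def B_def act_gen.simps)
  qed
  then show ?thesis by (simp add: A_def B_def J_def)
qed

end

section \<open>H as triples modulo q\<close>

text \<open>
  The pairs that satisfy the defining relations of \<open>H\<close>, again in the form without
  inverses.
\<close>

definition (in group) macdonald_pair :: "int \<Rightarrow> int \<Rightarrow> 'a \<Rightarrow> 'a \<Rightarrow> bool" where
  "macdonald_pair \<alpha> n x y \<longleftrightarrow> x \<in> carrier G \<and> y \<in> carrier G
    \<and> x \<otimes> comm x y = comm x y \<otimes> x [^] \<alpha> \<and> y \<otimes> comm y x = comm y x \<otimes> y [^] \<alpha>
    \<and> x [^] n = \<one> \<and> y [^] n = \<one>"

lemma (in macdonald_params) word_eval_relations: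
  fixes G (structure)
  assumes "group G" and cong: "[J_alpha m l = 1 + 4 * \<nu>] (mod M)"
    and pair: "group.macdonald_pair G (1 + 4 * \<nu>) q X Y" and uv: "(u, v) \<in> J_relations m l"
  defines "k \<equiv> (\<lambda>x. case x of GenA \<Rightarrow> X | GenB \<Rightarrow> Y)"
  shows "word_eval G k u = word_eval G k v"
proof -
  interpret group G by fact
  have XY: "X \<in> carrier G" "Y \<in> carrier G" and q: "X [^] q = \<one>" "Y [^] q = \<one>"
    using pair by (auto simp: macdonald_pair_def)
  have k: "k x \<in> carrier G" for x by (cases x) (simp_all add: k_def XY)
  have kq: "k x [^] (q * t) = \<one>" for x t
  proof -
    have "k x [^] (q * t) = (k x [^] q) [^] t" by (simp only: int_pow_pow k)
    then show ?thesis by (cases x) (simp_all only: k_def gen.case q int_pow_one)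
  qed
  have alpha: "k x [^] J_alpha m l = k x [^] (1 + 4 * \<nu>)" for x
  proof -
    obtain t where "J_alpha m l = (1 + 4 * \<nu>) + q * t"
      using cong_M_imp_q[OF cong] by (metis cong_iff_lin cong_sym)
    then have "k x [^] J_alpha m l = k x [^] (1 + 4 * \<nu>) \<otimes> k x [^] (q * t)"
      by (simp only: int_pow_mult k)
    then show ?thesis by (simp only: kq r_one int_pow_closed k)
  qed
  have "(2 ^ (3 * m - 1) :: int) = q * w" using M_eq M_def by (simp add: mult.commute)
  then have M: "k x [^] (2 ^ (3 * m - 1) :: int) = \<one>" for x by (simp only: kq)
  have conj: "inv (comm X Y) \<otimes> X \<otimes> comm X Y = X [^] (1 + 4 * \<nu>)"
    "inv (comm Y X) \<otimes> Y \<otimes> comm Y X = Y [^] (1 + 4 * \<nu>)"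
  proof -
    have "inv c \<otimes> x \<otimes> c = y" if "x \<otimes> c = c \<otimes> y" "x \<in> carrier G" "y \<in> carrier G" "c \<in> carrier G" for x y c
    proof -
      have "inv c \<otimes> x \<otimes> c = inv c \<otimes> (x \<otimes> c)" using that(2-4) by (simp add: m_assoc)
      also have "\<dots> = y" unfolding that(1) using that(3,4) by (simp flip: m_assoc)
      finally show ?thesis .
    qed
    then show "inv (comm X Y) \<otimes> X \<otimes> comm X Y = X [^] (1 + 4 * \<nu>)"
      "inv (comm Y X) \<otimes> Y \<otimes> comm Y X = Y [^] (1 + 4 * \<nu>)"
      using pair XY by (simp_all add: macdonald_pair_def)
  qed
  have kAB: "k GenA = X" "k GenB = Y" by (simp_all add: k_def)
  show ?thesis
    using uv alpha[of GenA] alpha[of GenB] M[of GenA] M[of GenB] conj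
    by (auto simp: J_relations_def Let_def word_eval_conj[OF k] word_eval_comm[OF k]
        word_eval_pow[OF k] word_eval_letter[OF k] kAB)
qed

text \<open>
  All that is used about \<open>H\<close> from here on. The last assumption is the universal
  property of its presentation, for targets inside \<open>H\<close>.
\<close>

locale macdonald_H = macdonald_params m \<nu> + group H for m \<nu> and H (structure) +
  fixes A B :: 'a and E :: "int \<Rightarrow> int \<Rightarrow> int \<Rightarrow> 'a"
  assumes carrier_E: "carrier H = {E i k j | i k j. True}"
    and E_eq_iff: "E i k j = E i' k' j' \<longleftrightarrow> q dvd i - i' \<and> q dvd k - k' \<and> q dvd j - j'"
    and E_mult: "E i k j \<otimes> E i' k' j' =
      E (i + i' + 2 * \<nu> * j * (i' ^ 2 - i') - 4 * \<nu> * k * i')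
        (k + k' - i' * j - \<nu> * (i' ^ 2 - i') * (j ^ 2 + j))
        (j + j' + 2 * \<nu> * i' * (j ^ 2 + j) - 4 * \<nu> * k' * j)"
    and E_def: "E i k j = A [^] i \<otimes> comm A B [^] k \<otimes> B [^] j"
    and A_closed [simp]: "A \<in> carrier H" and B_closed [simp]: "B \<in> carrier H"
    and pair_lift: "macdonald_pair (1 + 4 * \<nu>) q X Y \<Longrightarrow> \<exists>f \<in> hom H H. f A = X \<and> f B = Y"

lemma (in group) hom_factor_center:
  assumes "group K" "f \<in> hom G K" "\<And>z. z \<in> center G \<Longrightarrow> f z = \<one>\<^bsub>K\<^esub>"
  shows "\<exists>f' \<in> hom (G Mod center G) K. \<forall>x\<in>carrier G. f' (center G #> x) = f x"
proof
  interpret Z: normal "center G" G by (rule center_normal)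
  interpret K: group K by fact
  define f' where "f' = (\<lambda>X. f (SOME x. x \<in> carrier G \<and> center G #> x = X))"
  have val: "f' (center G #> x) = f x" if x: "x \<in> carrier G" for x
  proof -
    define y where "y = (SOME y. y \<in> carrier G \<and> center G #> y = center G #> x)"
    have y: "y \<in> carrier G \<and> center G #> y = center G #> x"
      unfolding y_def by (rule someI[of _ x]) (use x in simp)
    then have "y \<in> center G #> x" using rcos_self[of y "center G"] Z.subgroup_axioms by auto
    then obtain z where z: "z \<in> center G" "y = z \<otimes> x" by (auto simp: r_coset_def)
    have "f y = f z \<otimes>\<^bsub>K\<^esub> f x" unfolding z(2) using assms(2) x z(1) Z.subset by (auto simp: hom_def)
    then have "f y = f x" using assms(2,3) x z(1) by (simp add: hom_def Pi_iff)
    then show ?thesis by (simp add: f'_def y_def)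
  qed
  then show "\<forall>x\<in>carrier G. f' (center G #> x) = f x" by blast
  have car: "carrier (G Mod center G) = (\<lambda>x. center G #> x) ` carrier G"
    by (auto simp: FactGroup_def RCOSETS_def)
  show "f' \<in> hom (G Mod center G) K"
    using assms(2) unfolding hom_def car
    by (auto simp: val Z.rcos_sum)
qed

text \<open>
  The universal property: a pair satisfying the relations defines a homomorphism from
  \<open>J\<close> to \<open>H\<close>. It kills \<open>A^q\<close> and \<open>B^q\<close> and
  therefore, by \<open>C_pow_eq_B_pow\<close>, all of \<open>Z(J)\<close>, so it factors through
  \<open>H\<close>.
\<close>

lemma macdonald_H_H_group:
  assumes "macdonald_params m \<nu>" and cong: "[J_alpha m l = 1 + 4 * \<nu>] (mod macdonald_params.M m)"
  shows "\<exists>E. macdonald_H m \<nu> (H_group m l) (H_gen m l GenA) (H_gen m l GenB) E"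
proof -
  let ?R = "J_relations m l"
  let ?h = "\<lambda>x. word_class ?R (letter x)"
  interpret macdonald_params m \<nu> by fact
  define J where "J = J_group m l"
  interpret J: macdonald_J m \<nu> J "?h GenA" "?h GenB" "pt ?R"
    unfolding J_def by (rule macdonald_J_J_group[OF cong])
  have H: "H_group m l = J Mod center J" by (simp add: H_group_def J_def)
  interpret H: group "J Mod center J" by (rule J.Z.factorgroup_is_group)
  define \<pi> where "\<pi> = (\<lambda>x. center J #>\<^bsub>J\<^esub> x)"
  interpret \<pi>: group_hom J "J Mod center J" \<pi>
    unfolding \<pi>_def using J.Z.r_coset_hom_Mod by unfold_locales
  have gen: "H_gen m l x = \<pi> (?h x)" for x by (simp add: H_gen_def \<pi>_def J_def)
  have comm: "\<pi> (J.comm x y) = H.comm (\<pi> x) (\<pi> y)" if "x \<in> carrier J" "y \<in> carrier J" for x y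
    using that by (simp add: J.comm_def H.comm_def)
  have J_pres: "J = presented_group ?R" by (simp add: J_def J_group_def)
  have h: "?h x \<in> carrier J" for x by (simp add: J_pres presented_group_def)
  have "macdonald_H m \<nu> (J Mod center J) (\<pi> (?h GenA)) (\<pi> (?h GenB)) J.EH"
  proof unfold_locales
    show "carrier (J Mod center J) = {J.EH i k j | i k j. True}" by (rule J.carrier_quotient)
    show "J.EH i k j = J.EH i' k' j' \<longleftrightarrow> q dvd i - i' \<and> q dvd k - k' \<and> q dvd j - j'" for i k j i' k' j'
      by (rule J.EH_eq_iff)
    show "J.EH i k j \<otimes>\<^bsub>J Mod center J\<^esub> J.EH i' k' j' =
      J.EH (i + i' + 2 * \<nu> * j * (i' ^ 2 - i') - 4 * \<nu> * k * i')
        (k + k' - i' * j - \<nu> * (i' ^ 2 - i') * (j ^ 2 + j))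
        (j + j' + 2 * \<nu> * i' * (j ^ 2 + j) - 4 * \<nu> * k' * j)" for i k j i' k' j'
      by (rule J.EH_mult)
    show "J.EH i k j = \<pi> (?h GenA) [^]\<^bsub>J Mod center J\<^esub> i
        \<otimes>\<^bsub>J Mod center J\<^esub> H.comm (\<pi> (?h GenA)) (\<pi> (?h GenB)) [^]\<^bsub>J Mod center J\<^esub> k
        \<otimes>\<^bsub>J Mod center J\<^esub> \<pi> (?h GenB) [^]\<^bsub>J Mod center J\<^esub> j" for i k j
    proof -
      have "J.EH i k j = \<pi> (J.E (i, k, j))" by (simp add: J.EH_def \<pi>_def)
      then show ?thesis by (simp add: \<pi>.hom_int_pow h comm J.C_def)
    qed
    show "\<pi> (?h GenA) \<in> carrier (J Mod center J)" "\<pi> (?h GenB) \<in> carrier (J Mod center J)"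
      using \<pi>.hom_closed h by blast+
  next
    fix X Y assume pair: "H.macdonald_pair (1 + 4 * \<nu>) q X Y"
    then have XY: "X \<in> carrier (J Mod center J)" "Y \<in> carrier (J Mod center J)"
      and q: "X [^]\<^bsub>J Mod center J\<^esub> q = \<one>\<^bsub>J Mod center J\<^esub>" "Y [^]\<^bsub>J Mod center J\<^esub> q = \<one>\<^bsub>J Mod center J\<^esub>"
      by (auto simp: H.macdonald_pair_def)
    define k where "k = (\<lambda>x. case x of GenA \<Rightarrow> X | GenB \<Rightarrow> Y)"
    have k: "k x \<in> carrier (J Mod center J)" for x by (cases x) (simp_all add: k_def XY)
    have kq: "k x [^]\<^bsub>J Mod center J\<^esub> (q * t) = \<one>\<^bsub>J Mod center J\<^esub>" for x t
    proof -
      have "k x [^]\<^bsub>J Mod center J\<^esub> (q * t) = (k x [^]\<^bsub>J Mod center J\<^esub> q) [^]\<^bsub>J Mod center J\<^esub> t"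
        by (simp only: H.int_pow_pow k)
      then show ?thesis by (cases x) (simp_all only: k_def gen.case q H.int_pow_one)
    qed
    have "\<exists>f \<in> hom (presented_group ?R) (J Mod center J).
        \<forall>u. f (word_class ?R u) = word_eval (J Mod center J) k u"
      by (rule H.presented_group_lift[where h = k, OF k])
        (unfold k_def, rule word_eval_relations[OF H.group_axioms cong pair])
    then have "\<exists>f \<in> hom J (J Mod center J). \<forall>u. f (word_class ?R u) = word_eval (J Mod center J) k u"
      by (simp only: J_pres[symmetric])
    then obtain f where f: "f \<in> hom J (J Mod center J)"
      "\<forall>u. f (word_class ?R u) = word_eval (J Mod center J) k u" by (elim bexE)
    have fh: "f (?h x) = k x" for x unfolding f(2)[rule_format] by (rule H.word_eval_letter[OF k])
    interpret f: group_hom J "J Mod center J" f using f(1) by unfold_locales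
    have "f z = \<one>\<^bsub>J Mod center J\<^esub>" if "z \<in> center J" for z
    proof -
      from that[unfolded J.center_eq] obtain a c b where z: "z = J.E (q * a, c, q * b)" "q dvd c"
        by (auto elim!: dvdE simp del: J.E.simps)
      obtain d where "J.C [^]\<^bsub>J\<^esub> c = ?h GenB [^]\<^bsub>J\<^esub> (q * d)" using J.C_pow_eq_B_pow[OF z(2)] by blast
      then have "z = ?h GenA [^]\<^bsub>J\<^esub> (q * a) \<otimes>\<^bsub>J\<^esub> ?h GenB [^]\<^bsub>J\<^esub> (q * d) \<otimes>\<^bsub>J\<^esub> ?h GenB [^]\<^bsub>J\<^esub> (q * b)"
        by (simp only: z(1) J.E.simps)
      then show ?thesis
        by (simp only: f.hom_mult f.hom_int_pow h J.int_pow_closed J.m_closed fh kq H.one_closed H.l_one)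
    qed
    from J.hom_factor_center[OF H.group_axioms f(1) this] obtain f'
      where "f' \<in> hom (J Mod center J) (J Mod center J)" "\<And>x. x \<in> carrier J \<Longrightarrow> f' (\<pi> x) = f x"
      unfolding \<pi>_def by blast
    then show "\<exists>f\<in>hom (J Mod center J) (J Mod center J). f (\<pi> (?h GenA)) = X \<and> f (\<pi> (?h GenB)) = Y"
      using h fh[of GenA] fh[of GenB] by (auto simp: k_def)
  qed
  then show ?thesis unfolding H gen by blast
qed

context macdonald_H begin

lemma E_closed [simp]: "E i k j \<in> carrier H"
  unfolding carrier_E by blast

lemma E_cases:
  assumes "x \<in> carrier H"
  obtains i k j where "x = E i k j"
  using assms unfolding carrier_E by blast

lemma E_cong: "[i = i'] (mod q) \<Longrightarrow> [k = k'] (mod q) \<Longrightarrow> [j = j'] (mod q) \<Longrightarrow> E i k j = E i' k' j'"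
  unfolding E_eq_iff cong_iff_dvd_diff by blast

lemma E_one: "E 0 0 0 = \<one>" and A_eq: "A = E 1 0 0" and B_eq: "B = E 0 0 1"
  unfolding E_def by simp_all

lemma hom_E:
  assumes "group K" "f \<in> hom H K"
  shows "f (E i k j) = f A [^]\<^bsub>K\<^esub> i \<otimes>\<^bsub>K\<^esub> group.comm K (f A) (f B) [^]\<^bsub>K\<^esub> k \<otimes>\<^bsub>K\<^esub> f B [^]\<^bsub>K\<^esub> j"
proof -
  interpret K: group K by fact
  interpret f: group_hom H K f using assms(2) by unfold_locales
  have "f (comm A B) = K.comm (f A) (f B)" by (simp add: comm_def K.comm_def)
  then show ?thesis unfolding E_def by (simp add: f.hom_int_pow)
qed

lemma hom_eqI:
  assumes "group K" "f \<in> hom H K" "f' \<in> hom H K" "f A = f' A" "f B = f' B" "x \<in> carrier H"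
  shows "f x = f' x"
proof -
  obtain i k j where "x = E i k j" using assms(6) by (rule E_cases)
  then show ?thesis using hom_E[OF assms(1,2)] hom_E[OF assms(1,3)] assms(4,5) by simp
qed

section \<open>The upper central series of H\<close>

text \<open>
  Under these conditions on the moduli \<open>D\<close> for the exponents of \<open>A\<close> and
  \<open>B\<close> and \<open>D'\<close> for the exponent of \<open>C\<close>, coordinatewise
  congruence is compatible with right multiplication: in a product, the exponents of
  \<open>A\<close> and \<open>B\<close> involve \<open>k\<close> only through \<open>4 * \<nu> *
  k\<close>, and the exponent of \<open>C\<close> involves \<open>j\<close>.
\<close>

definition level :: "int \<Rightarrow> int \<Rightarrow> bool" where
  "level D D' \<longleftrightarrow> D dvd q \<and> D' dvd q \<and> D' dvd D \<and> D dvd 4 * \<nu> * D'"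

definition coord_cong :: "int \<Rightarrow> int \<Rightarrow> 'a \<Rightarrow> 'a \<Rightarrow> bool" where
  "coord_cong D D' x y \<longleftrightarrow> (\<exists>i k j i' k' j'. x = E i k j \<and> y = E i' k' j'
     \<and> D dvd i - i' \<and> D' dvd k - k' \<and> D dvd j - j')"

definition W :: "int \<Rightarrow> int \<Rightarrow> 'a set" where
  "W D D' = {E i k j | i k j. D dvd i \<and> D' dvd k \<and> D dvd j}"

lemma coord_cong_E:
  assumes "level D D'"
  shows "coord_cong D D' (E i k j) (E i' k' j') \<longleftrightarrow> D dvd i - i' \<and> D' dvd k - k' \<and> D dvd j - j'"
proof
  assume "coord_cong D D' (E i k j) (E i' k' j')"
  then obtain a b c a' b' c' where h: "E i k j = E a b c" "E i' k' j' = E a' b' c'"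
    "D dvd a - a'" "D' dvd b - b'" "D dvd c - c'" unfolding coord_cong_def by blast
  have "D dvd i - a" "D' dvd k - b" "D dvd j - c" "D dvd i' - a'" "D' dvd k' - b'" "D dvd j' - c'"
    using assms h(1,2) unfolding E_eq_iff level_def by (auto intro: dvd_trans)
  then have "D dvd (i - a) + (a - a') - (i' - a')" "D' dvd (k - b) + (b - b') - (k' - b')"
    "D dvd (j - c) + (c - c') - (j' - c')"
    using h(3-5) by (meson dvd_add dvd_diff)+
  then show "D dvd i - i' \<and> D' dvd k - k' \<and> D dvd j - j'" by simp
next
  assume "D dvd i - i' \<and> D' dvd k - k' \<and> D dvd j - j'"
  then show "coord_cong D D' (E i k j) (E i' k' j')" unfolding coord_cong_def by blast
qed

lemma mem_W_iff:
  assumes "level D D'"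
  shows "E i k j \<in> W D D' \<longleftrightarrow> D dvd i \<and> D' dvd k \<and> D dvd j"
proof
  assume "E i k j \<in> W D D'"
  then obtain a b c where "E i k j = E a b c" "D dvd a - 0" "D' dvd b - 0" "D dvd c - 0"
    unfolding W_def by auto
  then have "coord_cong D D' (E i k j) (E 0 0 0)" unfolding coord_cong_def by blast
  then show "D dvd i \<and> D' dvd k \<and> D dvd j" unfolding coord_cong_E[OF assms] by simp
qed (auto simp: W_def)

lemma coord_cong_mult_right:
  assumes l: "level D D'" and "coord_cong D D' x y" "z \<in> carrier H"
  shows "coord_cong D D' (x \<otimes> z) (y \<otimes> z)"
proof -
  obtain i k j i' k' j' where h: "x = E i k j" "y = E i' k' j'"
    "[i = i'] (mod D)" "[k = k'] (mod D')" "[j = j'] (mod D)"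
    using assms(2) unfolding coord_cong_def cong_iff_dvd_diff by blast
  obtain a b c where z: "z = E a b c" using assms(3) by (rule E_cases)
  have jD': "[j = j'] (mod D')" using h(5) l unfolding level_def by (auto intro: cong_dvd_modulus)
  have "D dvd 4 * \<nu> * (k - k')"
    using h(4) l unfolding level_def cong_iff_dvd_diff by (metis dvd_trans mult_dvd_mono dvd_refl)
  then have k: "[4 * \<nu> * k = 4 * \<nu> * k'] (mod D)" by (simp add: cong_iff_dvd_diff right_diff_distrib)
  have "[i + a + 2 * \<nu> * j * (a ^ 2 - a) - 4 * \<nu> * k * a
      = i' + a + 2 * \<nu> * j' * (a ^ 2 - a) - 4 * \<nu> * k' * a] (mod D)"
    by (intro cong_add cong_diff cong_refl cong_mult[OF k] cong_mult[OF cong_mult[OF cong_refl h(5)]] h(3))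
  moreover have "[k + b - a * j - \<nu> * (a ^ 2 - a) * (j ^ 2 + j)
      = k' + b - a * j' - \<nu> * (a ^ 2 - a) * (j' ^ 2 + j')] (mod D')"
    by (intro cong_add cong_diff cong_refl cong_mult h(4) cong_pow jD')
  moreover have "[j + c + 2 * \<nu> * a * (j ^ 2 + j) - 4 * \<nu> * b * j
      = j' + c + 2 * \<nu> * a * (j' ^ 2 + j') - 4 * \<nu> * b * j'] (mod D)"
    by (intro cong_add cong_diff cong_refl cong_mult h(5) cong_pow)
  ultimately show ?thesis unfolding h z E_mult coord_cong_E[OF l] cong_iff_dvd_diff by blast
qed

lemma rcos_W_eq_iff:
  assumes l: "level D D'" and W: "W D D' \<lhd> H" and "x \<in> carrier H" "y \<in> carrier H"
  shows "W D D' #> x = W D D' #> y \<longleftrightarrow> coord_cong D D' x y"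
proof -
  interpret W: normal "W D D'" H by (rule W)
  have W_iff: "z \<in> W D D' \<longleftrightarrow> coord_cong D D' z \<one>" if z: "z \<in> carrier H" for z
  proof -
    obtain i k j where "z = E i k j" using z by (rule E_cases)
    then show ?thesis using mem_W_iff[OF l] coord_cong_E[OF l, of i k j 0 0 0] by (simp add: E_one)
  qed
  have "W D D' #> x = W D D' #> y \<longleftrightarrow> x \<otimes> inv y \<in> W D D'"
    using W.rcos_module[OF is_group assms(4,3)] rcos_self[OF assms(3) W.subgroup_axioms]
      repr_independence[of x "W D D'" y] assms(3,4) W.subgroup_axioms by auto
  also have "\<dots> \<longleftrightarrow> coord_cong D D' (x \<otimes> inv y) \<one>" using assms(3,4) by (intro W_iff) simp
  also have "\<dots> \<longleftrightarrow> coord_cong D D' x y"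
  proof
    assume "coord_cong D D' (x \<otimes> inv y) \<one>"
    from coord_cong_mult_right[OF l this assms(4)] show "coord_cong D D' x y" using assms(3,4) by (simp add: m_assoc)
  next
    assume "coord_cong D D' x y"
    from coord_cong_mult_right[OF l this, of "inv y"] show "coord_cong D D' (x \<otimes> inv y) \<one>" using assms(4) by simp
  qed
  finally show ?thesis .
qed

lemma coprime_unit_dvd: "D dvd q \<Longrightarrow> even e \<Longrightarrow> D dvd i * (1 + e) \<Longrightarrow> D dvd i"
proof -
  assume "D dvd q" "even e" "D dvd i * (1 + e)"
  moreover have "coprime q (1 + e)" using \<open>even e\<close> by (simp add: q_def)
  ultimately have "coprime D (1 + e)" by (metis coprime_divisors dvd_refl)
  then show "D dvd i" using \<open>D dvd i * (1 + e)\<close> by (simp add: coprime_dvd_mult_left_iff)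
qed

text \<open>
  One step of the series. Commuting with \<open>A\<close> and with \<open>B\<close> yields the
  five divisibilities that are the premises of \<open>nec\<close>; the conditions
  \<open>suf\<close> make the commutator with an arbitrary element trivial at the current level.
\<close>

lemma upper_central_step:
  assumes l: "level D D'" and Z: "upper_central H n = W D D'" and lE: "level E1 E2"
    and suf: "D dvd 2 * \<nu> * E1" "D dvd 4 * \<nu> * E2" "D' dvd E1"
    and nec: "\<And>i k j. D dvd 4 * \<nu> * k \<Longrightarrow> D' dvd j \<Longrightarrow> D dvd 2 * \<nu> * (j ^ 2 + j) \<Longrightarrow> D' dvd i
      \<Longrightarrow> D dvd 2 * \<nu> * (i ^ 2 - i) \<Longrightarrow> E1 dvd i \<and> E2 dvd k \<and> E1 dvd j"
  shows "upper_central H (Suc n) = W E1 E2"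
proof -
  have N: "W D D' \<lhd> H" using upper_central_normal[of n] Z by simp
  interpret W: normal "W D D'" H by (rule N)
  have up: "x \<in> upper_central H (Suc n) \<longleftrightarrow> x \<in> carrier H \<and> (\<forall>y\<in>carrier H. coord_cong D D' (x \<otimes> y) (y \<otimes> x))" for x
    unfolding upper_central.simps Z using W.rcos_in_center_iff rcos_W_eq_iff[OF l N] by auto
  have "E i k j \<in> upper_central H (Suc n) \<longleftrightarrow> E1 dvd i \<and> E2 dvd k \<and> E1 dvd j" for i k j
  proof
    assume "E i k j \<in> upper_central H (Suc n)"
    then have "coord_cong D D' (E i k j \<otimes> E 1 0 0) (E 1 0 0 \<otimes> E i k j)" "coord_cong D D' (E i k j \<otimes> E 0 0 1) (E 0 0 1 \<otimes> E i k j)"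
      unfolding up by simp_all
    then have h: "D dvd 4 * \<nu> * k" "D' dvd j" "D dvd 2 * \<nu> * (j ^ 2 + j)" "D dvd - (2 * \<nu> * (i ^ 2 - i))"
      "D' dvd i + 2 * \<nu> * (i ^ 2 - i)"
      unfolding E_mult coord_cong_E[OF l] by (simp_all add: power2_eq_square algebra_simps)
    from h(4) have h4: "D dvd 2 * \<nu> * (i ^ 2 - i)" by (simp only: dvd_minus_iff)
    have "D' dvd i * (1 + 2 * \<nu> * (i - 1))" using h(5) by (simp add: algebra_simps power2_eq_square)
    then have "D' dvd i" by (rule coprime_unit_dvd[rotated 2]) (use l in \<open>simp_all add: level_def\<close>)
    from nec[OF h(1-3) this h4] show "E1 dvd i \<and> E2 dvd k \<and> E1 dvd j" .
  next
    assume "E1 dvd i \<and> E2 dvd k \<and> E1 dvd j"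
    then obtain i0 k0 j0 where h: "i = E1 * i0" "k = E2 * k0" "j = E1 * j0" by (auto elim!: dvdE)
    have "coord_cong D D' (E i k j \<otimes> E a b c) (E a b c \<otimes> E i k j)" for a b c
    proof -
      obtain p where p: "a ^ 2 - a = 2 * p" using even_square_diff[of a] by blast
      obtain p' where p': "c ^ 2 + c = 2 * p'" using even_square_add[of c] by blast
      have "D dvd 2 * \<nu> * E1 * (j0 * (a ^ 2 - a) - c * i0 * (i - 1) + 2 * b * i0) - 4 * \<nu> * E2 * (k0 * a)"
        by (rule dvd_diff[OF dvd_mult2[OF suf(1)] dvd_mult2[OF suf(2)]])
      moreover have "D' dvd E1 * (- (a * j0) - 2 * \<nu> * p * j0 * (j + 1) + c * i0 + 2 * \<nu> * p' * i0 * (i - 1))"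
        using suf by simp
      moreover have "D dvd 2 * \<nu> * E1 * (a * j0 * (j + 1) - 2 * b * j0 - i0 * (c ^ 2 + c)) + 4 * \<nu> * E2 * (k0 * c)"
        by (rule dvd_add[OF dvd_mult2[OF suf(1)] dvd_mult2[OF suf(2)]])
      ultimately show ?thesis
        unfolding E_mult coord_cong_E[OF l] unfolding p p' unfolding h
        by (simp add: algebra_simps power2_eq_square)
    qed
    then show "E i k j \<in> upper_central H (Suc n)" unfolding up by (metis E_cases E_closed)
  qed
  then have "E i k j \<in> upper_central H (Suc n) \<longleftrightarrow> E i k j \<in> W E1 E2" for i k j
    using mem_W_iff[OF lE] by simp
  moreover have "x \<in> carrier H" if "x \<in> upper_central H (Suc n)" for x using that up by simp
  moreover have "x \<in> carrier H" if "x \<in> W E1 E2" for x using that unfolding W_def by auto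
  ultimately show ?thesis by (intro equalityI subsetI) (metis E_cases)+
qed

lemma s_dvd_q: "s dvd q" and w_dvd_q: "w dvd q" and s_dvd_w: "s dvd w" and s_dvd_4nu: "s dvd 4 * \<nu>"
proof -
  have "s dvd 2 * (2 * \<nu>)" using s_dvd by (rule dvd_mult)
  then show "s dvd 4 * \<nu>" by simp
qed (simp_all add: q_eq w_eq)

lemma levels: "level q q" "level q s" "level w s" "level s 1" "level 1 1"
  unfolding level_def
  using s_dvd_q w_dvd_q s_dvd_w s_dvd_4nu dvd_4nu_iff w_dvd by simp_all

lemma upper_central_eqs:
  "upper_central H 1 = W q s" "upper_central H 2 = W w s" "upper_central H 3 = W s 1" "upper_central H 4 = W 1 1"
proof -
  have 0: "upper_central H 0 = W q q"
  proof -
    have "E i k j = \<one> \<longleftrightarrow> q dvd i \<and> q dvd k \<and> q dvd j" for i k j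
      unfolding E_one[symmetric] E_eq_iff by simp
    then have "W q q \<subseteq> {\<one>}" unfolding W_def by blast
    moreover have "\<one> \<in> W q q" using mem_W_iff[OF levels(1), of 0 0 0] by (simp add: E_one)
    ultimately show ?thesis by auto
  qed
  have "upper_central H (Suc 0) = W q s"
  proof (rule upper_central_step[OF levels(1) 0 levels(2)])
    show "q dvd 4 * \<nu> * s" unfolding dvd_4nu_iff by simp
  qed (simp_all only: dvd_4nu_iff, simp_all)
  then show 1: "upper_central H 1 = W q s" by simp
  have "upper_central H (Suc 1) = W w s"
  proof (rule upper_central_step[OF levels(2) 1 levels(3)])
    fix i k j assume h: "q dvd 4 * \<nu> * k" "s dvd j" "q dvd 2 * \<nu> * (j ^ 2 + j)" "s dvd i" "q dvd 2 * \<nu> * (i ^ 2 - i)"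
    have "even i" "even j" using h(2,4) even_s by (auto intro: dvd_trans)
    have "w dvd j ^ 2 + j" using h(3) unfolding dvd_2nu_iff .
    then have "w dvd j * (1 + j)" by (simp add: power2_eq_square algebra_simps)
    then have j: "w dvd j" by (rule coprime_unit_dvd[OF w_dvd_q \<open>even j\<close>])
    have "w dvd - (i ^ 2 - i)" using h(5) unfolding dvd_2nu_iff dvd_minus_iff .
    then have "w dvd i * (1 + - i)" by (simp add: power2_eq_square algebra_simps)
    have "even (- i)" using \<open>even i\<close> by simp
    from coprime_unit_dvd[OF w_dvd_q this \<open>w dvd i * (1 + - i)\<close>] have i: "w dvd i" .
    show "w dvd i \<and> s dvd k \<and> w dvd j" using i j h(1) unfolding dvd_4nu_iff by blast
  qed (simp_all add: dvd_2nu_iff dvd_4nu_iff s_dvd_w)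
  then show 2: "upper_central H 2 = W w s" by (simp add: numeral_2_eq_2)
  have "upper_central H (Suc 2) = W s 1"
  proof (rule upper_central_step[OF levels(3) 2 levels(4)])
    have "s * 2 dvd 2 * \<nu> * s" using mult_dvd_mono[OF s_dvd even_s] .
    then show "w dvd 2 * \<nu> * s" by (simp add: w_eq mult.commute)
  qed (use w_dvd in simp_all)
  then show 3: "upper_central H 3 = W s 1" by (simp add: numeral_3_eq_3 numeral_2_eq_2)
  have "upper_central H (Suc 3) = W 1 1"
    by (rule upper_central_step[OF levels(4) 3 levels(5)]) (use s_dvd s_dvd_4nu in simp_all)
  then show "upper_central H 4 = W 1 1" by (simp add: eval_nat_numeral)
qed

lemma upper_central_4: "upper_central H 4 = carrier H"
  unfolding upper_central_eqs W_def carrier_E by simp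

end

section \<open>Powers and commutators in H\<close>

lemma binomial_4: "24 * int (n choose 4) = int n * (int n - 1) * (int n - 2) * (int n - 3)"
  and choose_Suc_4: "int (Suc n choose 4) = int (n choose 3) + int (n choose 4)"
proof -
  show S: "int (Suc n choose 4) = int (n choose 3) + int (n choose 4)" for n
    by (simp add: numeral_3_eq_3 eval_nat_numeral)
  show "24 * int (n choose 4) = int n * (int n - 1) * (int n - 2) * (int n - 3)"
  proof (induction n)
    case (Suc n)
    then show ?case using S[of n] binomials(2)[of n] by (simp add: algebra_simps power2_eq_square)
  qed simp
qed

context macdonald_H begin

text \<open>
  The identities below are checked by exhibiting the difference of the two sides as an explicit
  multiple of \<open>8 * \<nu> ^ 2\<close>, which is \<open>0\<close> modulo \<open>q\<close>.
\<close>

lemma E_eqI: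
  "i - i' = 8 * \<nu> ^ 2 * x \<Longrightarrow> k - k' = 8 * \<nu> ^ 2 * y \<Longrightarrow> j - j' = 8 * \<nu> ^ 2 * z \<Longrightarrow> E i k j = E i' k' j'"
  unfolding E_eq_iff using q_dvdI by blast

text \<open>
  Written with binomial coefficients, the induction step is Pascal's rule. The numbers
  \<open>pa\<close> and \<open>pb\<close> keep the coefficients integral: \<open>4 * \<nu>\<close>
  then splits off from every correction term.
\<close>

lemma E_pow:
  assumes a: "a ^ 2 - a = 2 * pa" and b: "b ^ 2 + b = 2 * pb"
  shows "E a k b [^] (n::nat) =
    E (int n * a + 4 * \<nu> * (b * pa * int (n choose 2) - a * k * int (n choose 2) + a ^ 2 * b * int (n choose 3)))
      (int n * k - a * b * int (n choose 2) - 4 * \<nu> * (a ^ 2 * b ^ 2 * int (n choose 4)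
        + a ^ 2 * pb * int (n choose 3) - a * b * k * int (n choose 3) + pa * b ^ 2 * int (n choose 3)
        + pa * pb * int (n choose 2)))
      (int n * b + 4 * \<nu> * (a * b ^ 2 * int (n choose 3) + a * pb * int (n choose 2) - k * b * int (n choose 2)))"
proof (induction n)
  case 0
  show ?case by (simp add: E_one binomial_eq_0)
next
  case (Suc n)
  define B2 B3 B4 N where "B2 = int (n choose 2)" and "B3 = int (n choose 3)" and "B4 = int (n choose 4)" and "N = int n"
  define zi where "zi = b * pa * B2 - a * k * B2 + a ^ 2 * b * B3"
  define zk where "zk = a ^ 2 * b ^ 2 * B4 + a ^ 2 * pb * B3 - a * b * k * B3 + pa * b ^ 2 * B3 + pa * pb * B2"
  define zj where "zj = a * b ^ 2 * B3 + a * pb * B2 - k * b * B2"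
  have N: "N ^ 2 = 2 * B2 + N" using binomials(1)[of n] by (simp add: B2_def N_def)
  let ?i = "N * a + 4 * \<nu> * zi" and ?k = "N * k - a * b * B2 - 4 * \<nu> * zk" and ?j = "N * b + 4 * \<nu> * zj"
  have "E a k b [^] Suc n = E ?i ?k ?j \<otimes> E a k b"
    using Suc by (simp add: B2_def B3_def B4_def N_def zi_def zk_def zj_def)
  also have "\<dots> = E (?i + a + 2 * \<nu> * ?j * (2 * pa) - 4 * \<nu> * ?k * a)
      (?k + k - a * ?j - \<nu> * (2 * pa) * (?j ^ 2 + ?j)) (?j + b + 2 * \<nu> * a * (?j ^ 2 + ?j) - 4 * \<nu> * k * ?j)"
    unfolding E_mult a ..
  also have "\<dots> = E ((N + 1) * a + 4 * \<nu> * (b * pa * (N + B2) - a * k * (N + B2) + a ^ 2 * b * (B2 + B3)))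
      ((N + 1) * k - a * b * (N + B2) - 4 * \<nu> * (a ^ 2 * b ^ 2 * (B3 + B4) + a ^ 2 * pb * (B2 + B3)
        - a * b * k * (B2 + B3) + pa * b ^ 2 * (B2 + B3) + pa * pb * (N + B2)))
      ((N + 1) * b + 4 * \<nu> * (a * b ^ 2 * (B2 + B3) + a * pb * (N + B2) - k * b * (N + B2)))"
  proof (rule E_eqI)
    have jj: "?j ^ 2 + ?j = b ^ 2 * (2 * B2) + N * (2 * pb) + 4 * \<nu> * zj * (2 * N * b + 4 * \<nu> * zj + 1)"
    proof -
      have "?j ^ 2 + ?j = b ^ 2 * N ^ 2 + N * b + 4 * \<nu> * zj * (2 * N * b + 4 * \<nu> * zj + 1)"
        by (simp add: algebra_simps power2_eq_square)
      then show ?thesis unfolding b[symmetric] N by (simp add: algebra_simps)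
    qed
    show "?i + a + 2 * \<nu> * ?j * (2 * pa) - 4 * \<nu> * ?k * a
        - ((N + 1) * a + 4 * \<nu> * (b * pa * (N + B2) - a * k * (N + B2) + a ^ 2 * b * (B2 + B3)))
        = 8 * \<nu> ^ 2 * (2 * zj * pa + 2 * zk * a)"
      by (simp add: zi_def algebra_simps power2_eq_square)
    show "?k + k - a * ?j - \<nu> * (2 * pa) * (?j ^ 2 + ?j)
        - ((N + 1) * k - a * b * (N + B2) - 4 * \<nu> * (a ^ 2 * b ^ 2 * (B3 + B4) + a ^ 2 * pb * (B2 + B3)
        - a * b * k * (B2 + B3) + pa * b ^ 2 * (B2 + B3) + pa * pb * (N + B2)))
        = 8 * \<nu> ^ 2 * (- (pa * zj * (2 * N * b + 4 * \<nu> * zj + 1)))"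
      unfolding jj by (simp add: zk_def) (simp add: zj_def algebra_simps power2_eq_square)
    show "?j + b + 2 * \<nu> * a * (?j ^ 2 + ?j) - 4 * \<nu> * k * ?j
        - ((N + 1) * b + 4 * \<nu> * (a * b ^ 2 * (B2 + B3) + a * pb * (N + B2) - k * b * (N + B2)))
        = 8 * \<nu> ^ 2 * (a * zj * (2 * N * b + 4 * \<nu> * zj + 1) - 2 * k * zj)"
      unfolding jj by (simp add: zj_def algebra_simps power2_eq_square)
  qed
  also have "\<dots> = E (int (Suc n) * a + 4 * \<nu> * (b * pa * int (Suc n choose 2) - a * k * int (Suc n choose 2) + a ^ 2 * b * int (Suc n choose 3)))
      (int (Suc n) * k - a * b * int (Suc n choose 2) - 4 * \<nu> * (a ^ 2 * b ^ 2 * int (Suc n choose 4)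
        + a ^ 2 * pb * int (Suc n choose 3) - a * b * k * int (Suc n choose 3) + pa * b ^ 2 * int (Suc n choose 3)
        + pa * pb * int (Suc n choose 2)))
      (int (Suc n) * b + 4 * \<nu> * (a * b ^ 2 * int (Suc n choose 3) + a * pb * int (Suc n choose 2) - k * b * int (Suc n choose 2)))"
    unfolding choose_Suc choose_Suc_4 B2_def B3_def B4_def N_def by (simp only: of_nat_Suc add.commute[of 1 "int n"])
  finally show ?case .
qed

lemma choose_alpha_4: "3 * int (alpha choose 4) = \<nu> * (16 * \<nu> ^ 2 - 1) * (2 * \<nu> - 1)"
proof -
  have "8 * (3 * int (alpha choose 4)) = 8 * (\<nu> * (16 * \<nu> ^ 2 - 1) * (2 * \<nu> - 1))"
    using binomial_4[of alpha] unfolding int_alpha by (simp add: algebra_simps power2_eq_square power3_eq_cube)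
  then show ?thesis by simp
qed

text \<open>
  For arbitrary exponents this coarse form suffices to derive that \<open>a * b\<close> is even,
  after which the exact form of \<open>E_pow_alpha\<close> is available.
\<close>

lemma E_pow_alpha_mod: "\<exists>z i j. E a k b [^] alpha = E i (k - 2 * \<nu> * a * b + 4 * \<nu> * z) j"
proof -
  obtain pa where pa: "a ^ 2 - a = 2 * pa" using even_square_diff[of a] by blast
  obtain pb where pb: "b ^ 2 + b = 2 * pb" using even_square_add[of b] by blast
  let ?z = "a ^ 2 * b ^ 2 * int (alpha choose 4) + a ^ 2 * pb * int (alpha choose 3) - a * b * k * int (alpha choose 3)
      + pa * b ^ 2 * int (alpha choose 3) + pa * pb * int (alpha choose 2)"
  have "int alpha * k - a * b * int (alpha choose 2) - 4 * \<nu> * ?z = k - 2 * \<nu> * a * b + 4 * \<nu> * (k - 2 * \<nu> * a * b - ?z)"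
    unfolding int_alpha choose_alpha(1) by (simp add: algebra_simps power2_eq_square)
  then show ?thesis unfolding E_pow[OF pa pb] by (metis (no_types))
qed

lemma E_pow_alpha:
  assumes "even (a * b)"
  shows "E a k b [^] alpha = E ((1 + 4 * \<nu>) * a) ((1 + 4 * \<nu>) * k - 2 * \<nu> * a * b) ((1 + 4 * \<nu>) * b)"
proof -
  obtain pa where pa: "a ^ 2 - a = 2 * pa" using even_square_diff[of a] by blast
  obtain pb where pb: "b ^ 2 + b = 2 * pb" using even_square_add[of b] by blast
  obtain h where h: "a * b = 2 * h" using assms by blast
  let ?B2 = "int (alpha choose 2)" and ?B3 = "int (alpha choose 3)" and ?B4 = "int (alpha choose 4)"
  have B3: "q dvd 4 * \<nu> * (?B3 * x)" for x
  proof (rule dvd_third(1))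
    have "3 * (4 * \<nu> * (?B3 * x)) = 4 * \<nu> * ((3 * ?B3) * x)" by simp
    also have "\<dots> = 8 * \<nu> ^ 2 * ((16 * \<nu> ^ 2 - 1) * x)" unfolding choose_alpha(2) by (simp add: power2_eq_square)
    finally show "q dvd 3 * (4 * \<nu> * (?B3 * x))" by (rule q_dvdI)
  qed
  have B4: "q dvd 16 * \<nu> * (?B4 * x)" for x
  proof (rule dvd_third(1))
    have "3 * (16 * \<nu> * (?B4 * x)) = 16 * \<nu> * ((3 * ?B4) * x)" by simp
    also have "\<dots> = 8 * \<nu> ^ 2 * (2 * (16 * \<nu> ^ 2 - 1) * (2 * \<nu> - 1) * x)" unfolding choose_alpha_4 by (simp add: power2_eq_square)
    finally show "q dvd 3 * (16 * \<nu> * (?B4 * x))" by (rule q_dvdI)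
  qed
  have B2: "q dvd 4 * \<nu> * (?B2 * x)" for x
    by (rule q_dvdI[of _ "(1 + 4 * \<nu>) * x"]) (simp add: choose_alpha power2_eq_square)
  have "q dvd 4 * \<nu> * (?B2 * (b * pa - a * k)) + 4 * \<nu> * (?B3 * (a ^ 2 * b))"
    by (rule dvd_add[OF B2 B3])
  then have i: "q dvd int alpha * a + 4 * \<nu> * (b * pa * ?B2 - a * k * ?B2 + a ^ 2 * b * ?B3) - (1 + 4 * \<nu>) * a"
    by (simp add: int_alpha algebra_simps)
  have "q dvd 4 * \<nu> * (?B3 * (a * b ^ 2)) + 4 * \<nu> * (?B2 * (a * pb - k * b))"
    by (rule dvd_add[OF B3 B2])
  then have j: "q dvd int alpha * b + 4 * \<nu> * (a * b ^ 2 * ?B3 + a * pb * ?B2 - k * b * ?B2) - (1 + 4 * \<nu>) * b"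
    by (simp add: int_alpha algebra_simps)
  have ab4: "a ^ 2 * b ^ 2 = 4 * h ^ 2" unfolding power_mult_distrib[symmetric] h by simp
  have "q dvd - (16 * \<nu> * (?B4 * h ^ 2)) - 4 * \<nu> * (?B3 * (a ^ 2 * pb - a * b * k + pa * b ^ 2)) - 4 * \<nu> * (?B2 * (pa * pb))
      - 8 * \<nu> ^ 2 * (a * b)"
    by (intro dvd_diff B3 B2 q_dvd_8nu) (simp only: dvd_minus_iff B4)
  moreover have "int alpha * k - a * b * ?B2 - 4 * \<nu> * (a ^ 2 * b ^ 2 * ?B4 + a ^ 2 * pb * ?B3 - a * b * k * ?B3
        + pa * b ^ 2 * ?B3 + pa * pb * ?B2) - ((1 + 4 * \<nu>) * k - 2 * \<nu> * a * b)
      = - (16 * \<nu> * (?B4 * h ^ 2)) - 4 * \<nu> * (?B3 * (a ^ 2 * pb - a * b * k + pa * b ^ 2)) - 4 * \<nu> * (?B2 * (pa * pb))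
      - 8 * \<nu> ^ 2 * (a * b)"
  proof -
    have 1: "a * b * ?B2 = 2 * \<nu> * a * b + 8 * \<nu> ^ 2 * (a * b)" unfolding choose_alpha by (simp add: algebra_simps power2_eq_square)
    show ?thesis unfolding ab4 int_alpha 1 by (simp add: algebra_simps)
  qed
  ultimately show ?thesis unfolding E_pow[OF pa pb] E_eq_iff using i j by (simp only:)
qed

lemma E_pow_q:
  assumes "even (a * b)"
  shows "E a k b [^] q = \<one>"
proof -
  obtain pa where pa: "a ^ 2 - a = 2 * pa" using even_square_diff[of a] by blast
  obtain pb where pb: "b ^ 2 + b = 2 * pb" using even_square_add[of b] by blast
  obtain h where h: "a * b = 2 * h" using assms by blast
  define n where "n = nat q"
  have n: "int n = q" using less_imp_le[OF positive(3)] by (simp add: n_def)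
  let ?B2 = "int (n choose 2)" and ?B3 = "int (n choose 3)" and ?B4 = "int (n choose 4)"
  have B2: "q dvd 2 * ?B2" using binomials(1)[of n] by (simp add: n power2_eq_square)
  have "q dvd 3 * (2 * ?B3)" using binomials(2)[of n] by (simp add: n mult.assoc)
  then have B3: "q dvd 2 * ?B3" by (rule dvd_third)
  have "q dvd 3 * (8 * ?B4)" using binomial_4[of n] by (simp add: n mult.assoc)
  then have B4: "q dvd 8 * ?B4" by (rule dvd_third)
  have i: "q dvd int n * a + 4 * \<nu> * (b * pa * ?B2 - a * k * ?B2 + a ^ 2 * b * ?B3) - 0"
  proof -
    have "q dvd q * a + 2 * ?B2 * (2 * \<nu> * (b * pa - a * k)) + 2 * ?B3 * (2 * \<nu> * (a ^ 2 * b))"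
      by (intro dvd_add dvd_mult2[OF B2] dvd_mult2[OF B3]) simp
    then show ?thesis by (simp add: n algebra_simps)
  qed
  have j: "q dvd int n * b + 4 * \<nu> * (a * b ^ 2 * ?B3 + a * pb * ?B2 - k * b * ?B2) - 0"
  proof -
    have "q dvd q * b + 2 * ?B2 * (2 * \<nu> * (a * pb - k * b)) + 2 * ?B3 * (2 * \<nu> * (a * b ^ 2))"
      by (intro dvd_add dvd_mult2[OF B2] dvd_mult2[OF B3]) simp
    then show ?thesis by (simp add: n algebra_simps)
  qed
  have ab4: "a ^ 2 * b ^ 2 = 4 * h ^ 2" unfolding power_mult_distrib[symmetric] h by simp
  have kk: "q dvd int n * k - a * b * ?B2 - 4 * \<nu> * (a ^ 2 * b ^ 2 * ?B4 + a ^ 2 * pb * ?B3 - a * b * k * ?B3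
        + pa * b ^ 2 * ?B3 + pa * pb * ?B2) - 0"
  proof -
    have "q dvd q * k - 2 * ?B2 * (h + 2 * \<nu> * pa * pb) - 8 * ?B4 * (2 * \<nu> * h ^ 2)
        - 2 * ?B3 * (2 * \<nu> * (a ^ 2 * pb - a * b * k + pa * b ^ 2))"
      by (intro dvd_diff dvd_mult2[OF B2] dvd_mult2[OF B3] dvd_mult2[OF B4]) simp
    also have "q * k - 2 * ?B2 * (h + 2 * \<nu> * pa * pb) - 8 * ?B4 * (2 * \<nu> * h ^ 2)
        - 2 * ?B3 * (2 * \<nu> * (a ^ 2 * pb - a * b * k + pa * b ^ 2))
      = int n * k - (2 * h) * ?B2 - 4 * \<nu> * (4 * h ^ 2 * ?B4 + a ^ 2 * pb * ?B3 - a * b * k * ?B3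
        + pa * b ^ 2 * ?B3 + pa * pb * ?B2) - 0"
      by (simp add: n algebra_simps)
    finally show ?thesis unfolding ab4 h[symmetric] .
  qed
  have "E a k b [^] n = E 0 0 0" unfolding E_pow[OF pa pb] E_eq_iff using i j kk by blast
  then show ?thesis unfolding n[symmetric] int_pow_int E_one .
qed

text \<open>
  Up to the factor \<open>4 * \<nu>\<close>, the exponents of \<open>A\<close> and
  \<open>B\<close> in the commutator of \<open>A^a C^k B^b\<close> and \<open>A^c C^(k')
  B^d\<close>.
\<close>

definition comm_exp_A where "comm_exp_A a k b c k' d = (b * (c ^ 2 - c) - d * (a ^ 2 - a)) div 2 + k' * a - k * (c::int)"
definition comm_exp_B where "comm_exp_B a k b c k' d = (c * (b ^ 2 + b) - a * (d ^ 2 + d)) div 2 + (a * d - b * c) * (b + d) - k' * b + k * (d::int)"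

text \<open>
  The exponent of \<open>C\<close> is \<open>a * d - b * c\<close> only up to a multiple of
  \<open>4 * \<nu>\<close>. That suffices, since this exponent enters the relations multiplied by
  \<open>4 * \<nu>\<close> or cancels.
\<close>

lemma comm_E: "\<exists>\<delta>. comm (E a k b) (E c k' d) = E (4 * \<nu> * comm_exp_A a k b c k' d) (a * d - b * c + 4 * \<nu> * \<delta>) (4 * \<nu> * comm_exp_B a k b c k' d)"
proof -
  obtain pa where pa: "a ^ 2 - a = 2 * pa" using even_square_diff[of a] by blast
  obtain pc where pc: "c ^ 2 - c = 2 * pc" using even_square_diff[of c] by blast
  obtain pb where pb: "b ^ 2 + b = 2 * pb" using even_square_add[of b] by blast
  obtain pd where pd: "d ^ 2 + d = 2 * pd" using even_square_add[of d] by blast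
  have "b * (2 * pc) - d * (2 * pa) = 2 * (b * pc - d * pa)" "c * (2 * pb) - a * (2 * pd) = 2 * (c * pb - a * pd)"
    by (simp_all add: algebra_simps)
  then have e: "comm_exp_A a k b c k' d = b * pc - d * pa + k' * a - k * c"
    and f: "comm_exp_B a k b c k' d = c * pb - a * pd + (a * d - b * c) * (b + d) - k' * b + k * d"
    unfolding comm_exp_A_def comm_exp_B_def pa pb pc pd by simp_all
  define e' where "e' = b * pc - d * pa + k' * a - k * c"
  define f' where "f' = c * pb - a * pd + (a * d - b * c) * (b + d) - k' * b + k * d"
  \<comment> \<open>The value of \<open>\<delta>\<close> solves the equation for the exponents of \<open>C\<close> in \<open>Y X U = X Y\<close>, where \<open>U\<close> is the commutator.\<close>
  define \<delta> where "\<delta> = pa * pd - pc * pb + e' * (b + d)"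
  define I K J where "I = c + a + 2 * \<nu> * d * (2 * pa) - 4 * \<nu> * k' * a"
    and "K = k' + k - a * d - \<nu> * (2 * pa) * (2 * pd)" and "J = d + b + 2 * \<nu> * a * (2 * pd) - 4 * \<nu> * k * d"
  obtain pJ where pJ: "J ^ 2 + J = 2 * pJ" using even_square_add[of J] by blast
  have YX: "E c k' d \<otimes> E a k b = E I K J" unfolding E_mult pa pd I_def K_def J_def ..
  have XY: "E a k b \<otimes> E c k' d = E (a + c + 2 * \<nu> * b * (2 * pc) - 4 * \<nu> * k * c)
      (k + k' - c * b - \<nu> * (2 * pc) * (2 * pb)) (b + d + 2 * \<nu> * c * (2 * pb) - 4 * \<nu> * k' * b)"
    unfolding E_mult pc pb ..
  have "E I K J \<otimes> E (4 * \<nu> * e') (a * d - b * c + 4 * \<nu> * \<delta>) (4 * \<nu> * f') = E a k b \<otimes> E c k' d"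
    unfolding XY unfolding E_mult[of I] pJ
  proof (rule E_eqI)
    show "I + 4 * \<nu> * e' + 2 * \<nu> * J * ((4 * \<nu> * e') ^ 2 - 4 * \<nu> * e') - 4 * \<nu> * K * (4 * \<nu> * e')
        - (a + c + 2 * \<nu> * b * (2 * pc) - 4 * \<nu> * k * c)
        = 8 * \<nu> ^ 2 * (J * (4 * \<nu> * e' ^ 2 - e') - 2 * K * e')"
      unfolding I_def e'_def by (simp add: algebra_simps power2_eq_square)
    show "K + (a * d - b * c + 4 * \<nu> * \<delta>) - 4 * \<nu> * e' * J - \<nu> * ((4 * \<nu> * e') ^ 2 - 4 * \<nu> * e') * (2 * pJ)
        - (k + k' - c * b - \<nu> * (2 * pc) * (2 * pb))
        = 8 * \<nu> ^ 2 * (- 2 * e' * (a * pd - k * d) - (4 * \<nu> * e' ^ 2 - e') * pJ)"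
      unfolding K_def \<delta>_def J_def by (simp add: algebra_simps power2_eq_square)
    show "J + 4 * \<nu> * f' + 2 * \<nu> * (4 * \<nu> * e') * (2 * pJ) - 4 * \<nu> * (a * d - b * c + 4 * \<nu> * \<delta>) * J
        - (b + d + 2 * \<nu> * c * (2 * pb) - 4 * \<nu> * k' * b)
        = 8 * \<nu> ^ 2 * (2 * e' * pJ - 2 * ((a * d - b * c) * (a * pd - k * d) + \<delta> * J))"
      unfolding J_def f'_def by (simp add: algebra_simps power2_eq_square)
  qed
  then have "E c k' d \<otimes> E a k b \<otimes> E (4 * \<nu> * e') (a * d - b * c + 4 * \<nu> * \<delta>) (4 * \<nu> * f')
      = E c k' d \<otimes> E a k b \<otimes> comm (E a k b) (E c k' d)"
    unfolding YX[symmetric] comm_eq[OF E_closed E_closed] .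
  then have "E (4 * \<nu> * e') (a * d - b * c + 4 * \<nu> * \<delta>) (4 * \<nu> * f') = comm (E a k b) (E c k' d)" by simp
  then have "comm (E a k b) (E c k' d) = E (4 * \<nu> * comm_exp_A a k b c k' d) (a * d - b * c + 4 * \<nu> * \<delta>) (4 * \<nu> * comm_exp_B a k b c k' d)"
    unfolding e f e'_def f'_def by simp
  then show ?thesis by blast
qed

text \<open>
  If the exponents of \<open>A\<close> and \<open>B\<close> in one factor are divisible by
  \<open>4 * \<nu>\<close>, as in a commutator, then the terms of higher degree in the
  multiplication vanish modulo \<open>q\<close>.
\<close>

lemma mult_commutator_form_right: "E a k b \<otimes> E (4 * \<nu> * e) D (4 * \<nu> * f) = E (a + 4 * \<nu> * e) (k + D - 4 * \<nu> * e * b) (b + 4 * \<nu> * f - 4 * \<nu> * D * b)"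
proof -
  obtain pb where pb: "b ^ 2 + b = 2 * pb" using even_square_add[of b] by blast
  show ?thesis unfolding E_mult pb
  proof (rule E_eqI)
    show "a + 4 * \<nu> * e + 2 * \<nu> * b * ((4 * \<nu> * e) ^ 2 - 4 * \<nu> * e) - 4 * \<nu> * k * (4 * \<nu> * e) - (a + 4 * \<nu> * e)
        = 8 * \<nu> ^ 2 * (b * (4 * \<nu> * e ^ 2 - e) - 2 * k * e)"
      by (simp add: algebra_simps power2_eq_square)
    show "k + D - 4 * \<nu> * e * b - \<nu> * ((4 * \<nu> * e) ^ 2 - 4 * \<nu> * e) * (2 * pb) - (k + D - 4 * \<nu> * e * b)
        = 8 * \<nu> ^ 2 * (- ((4 * \<nu> * e ^ 2 - e) * pb))"
      by (simp add: algebra_simps power2_eq_square)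
    show "b + 4 * \<nu> * f + 2 * \<nu> * (4 * \<nu> * e) * (2 * pb) - 4 * \<nu> * D * b - (b + 4 * \<nu> * f - 4 * \<nu> * D * b)
        = 8 * \<nu> ^ 2 * (2 * e * pb)"
      by (simp add: algebra_simps power2_eq_square)
  qed
qed

lemma mult_commutator_form_left: "E (4 * \<nu> * e) D (4 * \<nu> * f) \<otimes> E a k b = E (4 * \<nu> * e + a - 4 * \<nu> * D * a) (D + k - a * (4 * \<nu> * f)) (4 * \<nu> * f + b)"
proof -
  obtain pa where pa: "a ^ 2 - a = 2 * pa" using even_square_diff[of a] by blast
  show ?thesis unfolding E_mult pa
  proof (rule E_eqI)
    show "4 * \<nu> * e + a + 2 * \<nu> * (4 * \<nu> * f) * (2 * pa) - 4 * \<nu> * D * a - (4 * \<nu> * e + a - 4 * \<nu> * D * a) = 8 * \<nu> ^ 2 * (2 * f * pa)"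
      by (simp add: power2_eq_square)
    show "D + k - a * (4 * \<nu> * f) - \<nu> * (2 * pa) * ((4 * \<nu> * f) ^ 2 + 4 * \<nu> * f) - (D + k - a * (4 * \<nu> * f))
       = 8 * \<nu> ^ 2 * (- (pa * (4 * \<nu> * f ^ 2 + f)))"
      by (simp add: algebra_simps power2_eq_square)
    show "4 * \<nu> * f + b + 2 * \<nu> * a * ((4 * \<nu> * f) ^ 2 + 4 * \<nu> * f) - 4 * \<nu> * k * (4 * \<nu> * f) - (4 * \<nu> * f + b)
       = 8 * \<nu> ^ 2 * (a * (4 * \<nu> * f ^ 2 + f) - 2 * k * f)"
      by (simp add: algebra_simps power2_eq_square)
  qed
qed

section \<open>Pairs satisfying the relations\<close>

text \<open>
  In \<open>X[X,Y]=[X,Y]X^\<alpha>\<close> the exponents of \<open>C\<close> on the two sides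
  differ by \<open>2 * \<nu>\<close> times this polynomial, see \<open>rel_iff\<close>;
  \<open>Q_eq\<close> explains its shape.
\<close>

definition Q :: "int \<Rightarrow> int \<Rightarrow> int \<Rightarrow> int \<Rightarrow> int \<Rightarrow> int \<Rightarrow> int" where
  "Q a k b c k' d = a * (c * (b ^ 2 + b) - a * (d ^ 2 + d) + 2 * (a * d - b * c) * (b + d) - 2 * k' * b + 2 * k * d)
     - b * (b * (c ^ 2 - c) - d * (a ^ 2 - a) + 2 * (k' * a - k * c)) + a * b - 2 * k"

lemma Q_eq: "Q a k b c k' d = 2 * a * comm_exp_B a k b c k' d - 2 * b * comm_exp_A a k b c k' d + a * b - 2 * k"
proof -
  have "even (c * (b ^ 2 + b) - a * (d ^ 2 + d))" "even (b * (c ^ 2 - c) - d * (a ^ 2 - a))"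
    using even_square_add even_square_diff by simp_all
  then have "2 * comm_exp_B a k b c k' d = c * (b ^ 2 + b) - a * (d ^ 2 + d) + 2 * (a * d - b * c) * (b + d) - 2 * k' * b + 2 * k * d"
    "2 * comm_exp_A a k b c k' d = b * (c ^ 2 - c) - d * (a ^ 2 - a) + 2 * (k' * a - k * c)"
    unfolding comm_exp_B_def comm_exp_A_def by (simp_all add: algebra_simps)
  then show ?thesis unfolding Q_def by (metis (no_types) mult.assoc mult.left_commute)
qed

abbreviation rel where "rel X Y \<equiv> X \<otimes> comm X Y = comm X Y \<otimes> X [^] (1 + 4 * \<nu>)"

lemma pow_alpha: "X [^] (1 + 4 * \<nu>) = X [^] alpha"
  by (simp only: int_alpha[symmetric] int_pow_int)

text \<open>
  Compare the exponents of \<open>C\<close> modulo \<open>4 * \<nu>\<close>: the only term of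
  lower order is \<open>2 * \<nu> * a * b\<close>, which comes from \<open>X^\<alpha>\<close>.
\<close>

lemma rel_imp_even:
  assumes "rel (E a k b) (E c k' d)"
  shows "even (a * b)"
proof -
  obtain D where D: "comm (E a k b) (E c k' d) = E (4 * \<nu> * comm_exp_A a k b c k' d) D (4 * \<nu> * comm_exp_B a k b c k' d)"
    using comm_E by blast
  obtain z i j where X: "E a k b [^] alpha = E i (k - 2 * \<nu> * a * b + 4 * \<nu> * z) j" using E_pow_alpha_mod by blast
  have "q dvd k + D - 4 * \<nu> * comm_exp_A a k b c k' d * b - (D + (k - 2 * \<nu> * a * b + 4 * \<nu> * z) - i * (4 * \<nu> * comm_exp_B a k b c k' d))"
    using assms unfolding pow_alpha X D mult_commutator_form_right mult_commutator_form_left E_eq_iff by blast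
  also have "\<dots> = 2 * \<nu> * (a * b + 2 * (- comm_exp_A a k b c k' d * b - z + i * comm_exp_B a k b c k' d))"
    by (simp add: algebra_simps)
  finally have "w dvd a * b + 2 * (- comm_exp_A a k b c k' d * b - z + i * comm_exp_B a k b c k' d)"
    by (simp only: dvd_2nu_iff)
  then have "2 dvd a * b + 2 * (- comm_exp_A a k b c k' d * b - z + i * comm_exp_B a k b c k' d)"
    by (rule dvd_trans[rotated]) (simp add: w_eq)
  then show ?thesis by simp
qed

lemma rel_iff:
  assumes "even (a * b)"
  shows "rel (E a k b) (E c k' d) \<longleftrightarrow>
    s dvd a * (a * d - b * c - 1) \<and> s dvd b * (a * d - b * c + 1) \<and> w dvd Q a k b c k' d"
proof -
  let ?e = "comm_exp_A a k b c k' d" and ?f = "comm_exp_B a k b c k' d"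
  obtain \<delta> where D: "comm (E a k b) (E c k' d) = E (4 * \<nu> * ?e) (a * d - b * c + 4 * \<nu> * \<delta>) (4 * \<nu> * ?f)"
    using comm_E by blast
  let ?D = "a * d - b * c + 4 * \<nu> * \<delta>"
  have UX2: "comm (E a k b) (E c k' d) \<otimes> E a k b [^] alpha
      = E (4 * \<nu> * ?e + a + 4 * \<nu> * a - 4 * \<nu> * ?D * a) (?D + k + 4 * \<nu> * k - 2 * \<nu> * a * b - 4 * \<nu> * a * ?f)
          (4 * \<nu> * ?f + b + 4 * \<nu> * b)"
    unfolding D E_pow_alpha[OF assms] mult_commutator_form_left
    by (rule E_eqI[of _ _ "- 2 * ?D * a" _ _ "- 2 * a * ?f" _ _ 0]) (simp_all add: algebra_simps power2_eq_square)
  have 1: "a + 4 * \<nu> * ?e - (4 * \<nu> * ?e + a + 4 * \<nu> * a - 4 * \<nu> * ?D * a) = 4 * \<nu> * (a * (a * d - b * c - 1) + 4 * \<nu> * (\<delta> * a))"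
    by (simp add: algebra_simps)
  have 2: "k + ?D - 4 * \<nu> * ?e * b - (?D + k + 4 * \<nu> * k - 2 * \<nu> * a * b - 4 * \<nu> * a * ?f) = 2 * \<nu> * Q a k b c k' d"
    unfolding Q_eq by (simp add: algebra_simps)
  have 3: "b + 4 * \<nu> * ?f - 4 * \<nu> * ?D * b - (4 * \<nu> * ?f + b + 4 * \<nu> * b) = 4 * \<nu> * (- (b * (a * d - b * c + 1)) - 4 * \<nu> * (\<delta> * b))"
    by (simp add: algebra_simps)
  have s4: "s dvd 4 * \<nu> * y" for y using s_dvd_4nu by simp
  have "s dvd a * (a * d - b * c - 1) + 4 * \<nu> * (\<delta> * a) \<longleftrightarrow> s dvd a * (a * d - b * c - 1)"
    by (rule dvd_add_left_iff[OF s4])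
  moreover have "s dvd - (b * (a * d - b * c + 1)) - 4 * \<nu> * (\<delta> * b) \<longleftrightarrow> s dvd b * (a * d - b * c + 1)"
    unfolding dvd_diff_left_iff[OF s4] dvd_minus_iff ..
  ultimately show ?thesis
    unfolding pow_alpha UX2 unfolding D mult_commutator_form_right E_eq_iff 1 2 3 dvd_4nu_iff dvd_2nu_iff by blast
qed

text \<open>
  The condition \<open>X^q=Y^q=1\<close> follows from the parity conditions by
  \<open>E_pow_q\<close>.
\<close>

lemma pair_iff:
  "macdonald_pair (1 + 4 * \<nu>) q (E a k b) (E c k' d) \<longleftrightarrow> even (a * b) \<and> even (c * d)
    \<and> s dvd a * (a * d - b * c - 1) \<and> s dvd b * (a * d - b * c + 1) \<and> w dvd Q a k b c k' d
    \<and> s dvd c * (c * b - d * a - 1) \<and> s dvd d * (c * b - d * a + 1) \<and> w dvd Q c k' d a k b"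
  unfolding macdonald_pair_def
  using rel_imp_even[of a k b c k' d] rel_imp_even[of c k' d a k b] rel_iff[of a b k c k' d] rel_iff[of c d k' a k b]
    E_pow_q[of a b k] E_pow_q[of c d k'] by auto

end

context macdonald_H begin

lemma dvd_odd_cancel: "odd u \<Longrightarrow> s dvd u * x \<Longrightarrow> s dvd x"
proof -
  assume "odd u" "s dvd u * x"
  moreover have "coprime s u" using \<open>odd u\<close> by (simp add: s_def)
  ultimately show "s dvd x" by (simp add: coprime_dvd_mult_right_iff)
qed

lemma Q_cong:
  assumes "[a = a'] (mod w)" "[b = b'] (mod w)" "[c = c'] (mod w)" "[d = d'] (mod w)"
  shows "[Q a k b c k' d = Q a' k b' c' k' d'] (mod w)"
  unfolding Q_def by (intro cong_add cong_diff cong_mult cong_pow cong_refl assms)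

lemma s_eq_2: obtains t where "s = 2 * t" "w = 4 * t"
  using even_s w_eq by (metis evenE mult.assoc mult_2 numeral_Bit0 distrib_right one_add_one)

text \<open>
  Under these hypotheses almost every term of \<open>Q\<close> vanishes modulo \<open>w\<close>;
  \<open>R\<close> collects such terms, among them all that contain \<open>k\<close> or
  \<open>k'\<close>.
\<close>

lemma Q_nec_1:
  assumes "odd a" "even c" "s dvd b" "s dvd a * d - b * c - 1" "w dvd Q a k b c k' d"
  shows "w dvd a * (a * d) - 1 - b"
proof -
  obtain t where t: "s = 2 * t" "w = 4 * t" by (rule s_eq_2)
  obtain y where y: "b = s * y" using assms(3) by blast
  obtain g where g: "c = 2 * g" using assms(2) by blast
  obtain x where x: "a = 2 * x + 1" using assms(1) by (rule oddE)
  obtain z where z: "a * d - b * c - 1 = s * z" using assms(4) by blast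
  define e where "e = z + 2 * y * g"
  have P: "a * d = 1 + s * e" using z by (simp add: e_def y g algebra_simps)
  define R where "R = b ^ 2 * (c ^ 2 - c) - b * d * (a ^ 2 - a) - a * c * b ^ 2 - a * (b * c) - 2 * a * b * (a * d)
      + 2 * a * (b * c) * (b + d) + 4 * a * b * k' - 2 * k * (b * c) - 2 * k * (a * d - 1)"
  have "a * (a * d) - 1 - b = - Q a k b c k' d + ((a * d) ^ 2 - 1) + b * (a - 1) - R"
    unfolding Q_def R_def by (simp add: algebra_simps power2_eq_square)
  moreover have "w dvd (a * d) ^ 2 - 1"
  proof -
    have "(a * d) ^ 2 - 1 = w * (e * (1 + t * e))"
      unfolding P t by (simp add: algebra_simps power2_eq_square)
    then show ?thesis by simp
  qed
  moreover have "w dvd b * (a - 1)" unfolding x y t by simp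
  moreover have "w dvd R"
  proof -
    have b2: "w dvd b ^ 2" and bc: "w dvd b * c" and b2': "w dvd 2 * b"
      unfolding y g t by (simp_all add: power2_eq_square mult.assoc mult.left_commute)
    have "w dvd b * d * (a ^ 2 - a)"
    proof -
      obtain pa where pa: "a ^ 2 - a = 2 * pa" using even_square_diff[of a] by blast
      have "b * d * (a ^ 2 - a) = 2 * b * (d * pa)" unfolding pa by simp
      then show ?thesis using b2' by (simp only: dvd_mult2)
    qed
    moreover have "w dvd 2 * a * b * (a * d)" "w dvd 4 * a * b * k'"
      using dvd_mult2[OF b2', of "a * (a * d)"] dvd_mult2[OF b2', of "2 * a * k'"] by (simp_all add: ac_simps)
    moreover have "w dvd 2 * k * (a * d - 1)" unfolding P t by simp
    moreover have "w dvd 2 * a * (b * c) * (b + d)" by (rule dvd_mult2[OF dvd_mult[OF bc]])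
    ultimately show ?thesis unfolding R_def
      using b2 bc by (intro dvd_diff dvd_add) (simp_all add: mult.assoc dvd_mult dvd_mult2)
  qed
  ultimately show ?thesis using assms(5) by (simp only: dvd_add dvd_diff dvd_minus_iff)
qed

text \<open>
  The congruence from \<open>Q_nec_1\<close> gives \<open>a \<equiv> 1\<close> modulo
  \<open>s\<close>, hence \<open>a^2 \<equiv> 1\<close> modulo \<open>w\<close>, and it then
  becomes \<open>d-1 \<equiv> b\<close>. With \<open>a=1+sx\<close>, \<open>b=sy\<close>,
  \<open>c=2g\<close> and \<open>d \<equiv> 1+sy\<close>, the polynomial \<open>Q\<close> of the
  second relation reduces to \<open>sx+2g\<close>, which gives \<open>a-1 \<equiv> c\<close>.
\<close>

lemma pair_nec:
  assumes "odd a" "even b" "even c" "s dvd b"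
    and pair: "macdonald_pair (1 + 4 * \<nu>) q (E a k b) (E c k' d)"
  shows "s dvd a - 1" "s dvd c" "s dvd d - 1" "w dvd (a - 1) - c" "w dvd (d - 1) - b"
proof -
  note pr = pair[unfolded pair_iff]
  have D: "s dvd a * d - b * c - 1" using dvd_odd_cancel[OF assms(1)] pr by blast
  obtain t where t: "s = 2 * t" "w = 4 * t" by (rule s_eq_2)
  have main: "w dvd a * (a * d) - 1 - b" using pr by (intro Q_nec_1[OF assms(1,3,4) D]) blast
  then have main_s: "s dvd a * (a * d) - 1 - b" by (rule dvd_trans[OF s_dvd_w])
  have ad: "s dvd a * d - 1" using dvd_add[OF D dvd_mult2[OF assms(4), of c]] by (simp add: algebra_simps)
  show a1: "s dvd a - 1"
    using dvd_add[OF dvd_diff[OF main_s dvd_mult[OF ad, of a]] assms(4)] by (simp add: algebra_simps)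
  then obtain x where x: "a = 1 + s * x" by (metis add_diff_cancel_left' diff_add_cancel dvdE add.commute)
  have a2: "a ^ 2 - 1 = w * (x * (1 + t * x))" unfolding x t by (simp add: algebra_simps power2_eq_square)
  show wd: "w dvd (d - 1) - b"
  proof -
    have "w dvd (a * (a * d) - 1 - b) - (a ^ 2 - 1) * d"
      unfolding a2 by (rule dvd_diff[OF main dvd_mult2[OF dvd_triv_left]])
    then show ?thesis by (simp add: algebra_simps power2_eq_square)
  qed
  show "s dvd d - 1" using dvd_add[OF dvd_trans[OF s_dvd_w wd] assms(4)] by simp
  obtain y where y: "b = s * y" using assms(4) by blast
  obtain g where g: "c = 2 * g" using assms(3) by blast
  have "s dvd c * (c * b - d * a - 1)" using pr by blast
  then have "s dvd c * (c * b - d * a - 1) + c * (a * d - b * c - 1)" by (rule dvd_add[OF _ dvd_mult[OF D]])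
  then have "s dvd - (2 * c)" by (simp add: algebra_simps)
  then have "s * 2 dvd - (2 * c) * 2" by (intro mult_dvd_mono) simp_all
  then have "w dvd - (8 * g)" by (simp add: w_eq g mult.commute)
  then have wg: "w dvd 8 * g" by (simp only: dvd_minus_iff)
  have "[Q c k' d a k b = Q (2 * g) k' (1 + s * y) (1 + s * x) k (s * y)] (mod w)"
    using wd by (intro Q_cong) (simp_all add: g y x cong_iff_dvd_diff algebra_simps)
  then have Q2: "w dvd Q (2 * g) k' (1 + s * y) (1 + s * x) k (s * y)" using pr cong_dvd_iff by blast
  have "Q (2 * g) k' (1 + s * y) (1 + s * x) k (s * y) - (s * x + 2 * g) =
     w * (- 4 * g * k * y + 2 * g * k' * y - 6 * g * t * x * y - 8 * g * t * y ^ 2 - 12 * g * t ^ 2 * x * y ^ 2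
      - 3 * g * y + 16 * g ^ 2 * t * y ^ 2 + 4 * g ^ 2 * y + 2 * k' * t * x * y + k' * x + k' * y - 2 * t * x * y
      - t * x ^ 2 - 2 * t ^ 2 * x * y ^ 2 - 4 * t ^ 2 * x ^ 2 * y - 4 * t ^ 3 * x ^ 2 * y ^ 2 - x) - 8 * g * k"
    unfolding Q_def t by (simp add: algebra_simps power2_eq_square power3_eq_cube)
  moreover have "w dvd 8 * g * k" using wg by (rule dvd_mult2)
  ultimately have "w dvd Q (2 * g) k' (1 + s * y) (1 + s * x) k (s * y) - (s * x + 2 * g)"
    by (simp only: dvd_diff dvd_triv_left)
  then have "w dvd s * x + 2 * g" using Q2 by (metis dvd_diffD1 dvd_diff_commute dvd_diff_right_iff)
  then have "w dvd w * x - (s * x + 2 * g)" by (intro dvd_diff) simp_all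
  then show wc: "w dvd (a - 1) - c" by (simp add: x g w_eq algebra_simps)
  show "s dvd c" using dvd_diff[OF a1 dvd_trans[OF s_dvd_w wc]] by simp
qed

lemma pair_suf:
  assumes "s dvd a - 1" "s dvd b" "s dvd c" "s dvd d - 1" "w dvd (a - 1) - c" "w dvd (d - 1) - b"
  shows "macdonald_pair (1 + 4 * \<nu>) q (E a k b) (E c k' d)"
proof -
  obtain t where t: "s = 2 * t" "w = 4 * t" by (rule s_eq_2)
  obtain x where x: "a - 1 = s * x" using assms(1) by blast
  obtain y where y: "b = s * y" using assms(2) by blast
  have "even b" "even c" using assms(2,3) even_s dvd_trans by blast+
  obtain u where u: "d - 1 = s * u" using assms(4) by blast
  obtain v where v: "c = s * v" using assms(3) by blast
  have "a * d - b * c - 1 = s * (x * d + u - y * c)"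
    using x u y by (simp add: algebra_simps)
  then have D: "s dvd a * d - b * c - 1" by simp
  have D2: "s dvd (a * d - b * c + 1) * s * z" for z by simp
  have c: "[a = 1 + s * x] (mod w)" "[b = s * y] (mod w)" "[c = s * x] (mod w)" "[d = 1 + s * y] (mod w)"
    using assms(5,6) x y by (simp_all add: cong_iff_dvd_diff algebra_simps dvd_diff_commute)
  have "Q (1 + s * x) k (s * y) (s * x) k' (1 + s * y) = w * (4 * k * t * x * y + k * x + k * y - 4 * k' * t * x * y
      - 2 * k' * y + 7 * t * x * y + 3 * t * y ^ 2 + 10 * t ^ 2 * x * y ^ 2 + 6 * t ^ 2 * x ^ 2 * y + 2 * y)"
    unfolding Q_def t by (simp add: algebra_simps power2_eq_square)
  then have Q1: "w dvd Q a k b c k' d" using cong_dvd_iff[OF Q_cong[OF c(1,2,3,4)]] by simp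
  have "Q (s * x) k' (1 + s * y) (1 + s * x) k (s * y) = w * (- 4 * k * t * x * y - 2 * k * x + 4 * k' * t * x * y
      + k' * x + k' * y - 5 * t * x * y - t * x ^ 2 - 10 * t ^ 2 * x * y ^ 2 - 6 * t ^ 2 * x ^ 2 * y)"
    unfolding Q_def t by (simp add: algebra_simps power2_eq_square)
  then have Q2: "w dvd Q c k' d a k b" using cong_dvd_iff[OF Q_cong[OF c(3,4,1,2)]] by simp
  have "s dvd - (d * (a * d - b * c - 1))" using D by simp
  then have D4: "s dvd d * (c * b - d * a + 1)" by (simp add: algebra_simps)
  show ?thesis unfolding pair_iff
    using D D4 Q1 Q2 assms(2,3) \<open>even b\<close> \<open>even c\<close> by (simp add: dvd_mult2 dvd_mult)
qed

end

context macdonald_H begin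

section \<open>Reduction modulo w and automorphisms from pairs\<close>

text \<open>
  The map \<open>A^i C^k B^j \<mapsto> (i,j)\<close> modulo \<open>2^m\<close> is the homomorphism
  from \<open>H\<close> onto its abelianization \<open>(\<int>/2^m)^2\<close>. As a relation with
  integer representatives it needs no quotient type.
\<close>

definition ab_class :: "'a \<Rightarrow> int \<Rightarrow> int \<Rightarrow> bool" where
  "ab_class x i j \<longleftrightarrow> (\<exists>a k b. x = E a k b \<and> [a = i] (mod w) \<and> [b = j] (mod w))"

lemma ab_class_E: "ab_class (E a k b) i j \<longleftrightarrow> [a = i] (mod w) \<and> [b = j] (mod w)"
proof
  assume "ab_class (E a k b) i j"
  then obtain a' k' b' where h: "E a k b = E a' k' b'" "[a' = i] (mod w)" "[b' = j] (mod w)" unfolding ab_class_def by blast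
  then have "[a = a'] (mod w)" "[b = b'] (mod w)"
    unfolding E_eq_iff cong_iff_dvd_diff using w_dvd_q by (auto intro: dvd_trans)
  then show "[a = i] (mod w) \<and> [b = j] (mod w)" using h(2,3) cong_trans by blast
qed (auto simp: ab_class_def)

lemma ab_class_mult:
  assumes "ab_class x i j" "ab_class y i' j'"
  shows "ab_class (x \<otimes> y) (i + i') (j + j')"
proof -
  obtain a k b where x: "x = E a k b" "[a = i] (mod w)" "[b = j] (mod w)" using assms(1) unfolding ab_class_def by blast
  obtain a' k' b' where y: "y = E a' k' b'" "[a' = i'] (mod w)" "[b' = j'] (mod w)" using assms(2) unfolding ab_class_def by blast
  obtain p where p: "a' ^ 2 - a' = 2 * p" using even_square_diff[of a'] by blast
  obtain p' where p': "b ^ 2 + b = 2 * p'" using even_square_add[of b] by blast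
  have "a + a' + 2 * \<nu> * b * (2 * p) - 4 * \<nu> * k * a' - (a + a') = 4 * \<nu> * (b * p - k * a')"
    "b + b' + 2 * \<nu> * a' * (2 * p') - 4 * \<nu> * k' * b - (b + b') = 4 * \<nu> * (a' * p' - k' * b)"
    by (simp_all add: algebra_simps)
  then have "[a + a' + 2 * \<nu> * b * (2 * p) - 4 * \<nu> * k * a' = a + a'] (mod w)"
    "[b + b' + 2 * \<nu> * a' * (2 * p') - 4 * \<nu> * k' * b = b + b'] (mod w)"
    unfolding cong_iff_dvd_diff by (simp_all only: dvd_mult2[OF w_dvd])
  from cong_trans[OF this(1) cong_add[OF x(2) y(2)]] cong_trans[OF this(2) cong_add[OF x(3) y(3)]]
  show ?thesis unfolding x(1) y(1) E_mult p p' ab_class_E by blast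
qed

lemma ab_class_unique: "ab_class x i j \<Longrightarrow> ab_class x i' j' \<Longrightarrow> [i = i'] (mod w) \<and> [j = j'] (mod w)"
proof -
  assume "ab_class x i j" "ab_class x i' j'"
  then obtain a k b where "x = E a k b" "[a = i] (mod w)" "[b = j] (mod w)" unfolding ab_class_def by blast
  with \<open>ab_class x i' j'\<close> have "[a = i'] (mod w)" "[b = j'] (mod w)" by (simp_all add: ab_class_E)
  from cong_trans[OF cong_sym[OF \<open>[a = i] (mod w)\<close>] this(1)] cong_trans[OF cong_sym[OF \<open>[b = j] (mod w)\<close>] this(2)]
  show "[i = i'] (mod w) \<and> [j = j'] (mod w)" by blast
qed

lemma ab_class_cong: "ab_class x i j \<Longrightarrow> [i = i'] (mod w) \<Longrightarrow> [j = j'] (mod w) \<Longrightarrow> ab_class x i' j'"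
  unfolding ab_class_def using cong_trans by blast

lemma ab_class_one: "ab_class \<one> 0 0" and ab_class_A: "ab_class A 1 0" and ab_class_B: "ab_class B 0 1"
  unfolding E_one[symmetric] A_eq B_eq ab_class_E by simp_all

lemma ab_class_inv:
  assumes "x \<in> carrier H" "ab_class x i j"
  shows "ab_class (inv x) (- i) (- j)"
proof -
  obtain a k b where y: "inv x = E a k b" using E_cases inv_closed[OF assms(1)] by blast
  then have "ab_class (inv x) a b" by (simp add: ab_class_E)
  from ab_class_mult[OF assms(2) this] have "ab_class \<one> (i + a) (j + b)" using assms(1) by simp
  then have "[i + a = 0] (mod w)" "[j + b = 0] (mod w)" using ab_class_unique ab_class_one by blast+
  then have "[a = - i] (mod w)" "[b = - j] (mod w)" by (simp_all add: cong_iff_dvd_diff add.commute)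
  then show ?thesis by (simp add: y ab_class_E)
qed

lemma ab_class_pow:
  assumes "x \<in> carrier H" "ab_class x i j"
  shows "ab_class (x [^] (n::int)) (n * i) (n * j)"
proof -
  have nat: "ab_class (x [^] (n::nat)) (int n * i) (int n * j)" for n
  proof (induction n)
    case 0
    show ?case by (simp add: ab_class_one)
  next
    case (Suc n)
    then show ?case using ab_class_mult[OF Suc assms(2)] by (simp add: algebra_simps)
  qed
  show ?thesis
  proof (cases n rule: int_cases2)
    case (nonneg k)
    then show ?thesis using nat[of k] by (simp add: int_pow_int)
  next
    case (nonpos k)
    then show ?thesis using ab_class_inv[OF _ nat[of k]] assms(1) by (simp add: int_pow_neg_int)
  qed
qed

lemma ab_class_comm:
  assumes "x \<in> carrier H" "y \<in> carrier H" "ab_class x i j" "ab_class y i' j'"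
  shows "ab_class (comm x y) 0 0"
  using ab_class_mult[OF ab_class_mult[OF ab_class_mult[OF ab_class_inv[OF assms(1,3)] ab_class_inv[OF assms(2,4)]] assms(3)] assms(4)]
  by (simp add: comm_def)

lemma ab_class_hom:
  assumes f: "f \<in> hom H H" and "ab_class (f A) a b" "ab_class (f B) c d" "ab_class x i j"
  shows "ab_class (f x) (a * i + c * j) (b * i + d * j)"
proof -
  obtain i' k j' where x: "x = E i' k j'" "[i' = i] (mod w)" "[j' = j] (mod w)" using assms(4) unfolding ab_class_def by blast
  have c: "f A \<in> carrier H" "f B \<in> carrier H" using f by (auto simp: hom_def)
  have "ab_class (f x) (i' * a + k * 0 + j' * c) (i' * b + k * 0 + j' * d)"
    unfolding x(1) hom_E[OF is_group f]
    by (intro ab_class_mult ab_class_pow ab_class_comm[OF c assms(2,3)] c assms(2,3) comm_closed)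
  then show ?thesis
    by (rule ab_class_cong) (use x(2,3) in \<open>simp_all add: mult.commute cong_add cong_scalar_left\<close>)
qed

lemma finite_carrier: "finite (carrier H)"
proof -
  have "carrier H \<subseteq> (\<lambda>(i, k, j). E i k j) ` ({0..<q} \<times> {0..<q} \<times> {0..<q})"
  proof
    fix x assume "x \<in> carrier H"
    then obtain i k j where "x = E i k j" by (rule E_cases)
    also have "\<dots> = E (i mod q) (k mod q) (j mod q)" by (rule E_cong) (simp_all add: cong_def)
    finally show "x \<in> (\<lambda>(i, k, j). E i k j) ` ({0..<q} \<times> {0..<q} \<times> {0..<q})"
      by (intro image_eqI[of _ _ "(i mod q, k mod q, j mod q)"]) simp_all
  qed
  then show ?thesis by (rule finite_subset) simp
qed

text \<open>
  A nontrivial normal subgroup of a nilpotent group meets the centre. The proof climbs the upper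
  central series: commutators with a kernel element of one term are kernel elements of the
  previous term.
\<close>

lemma kernel_trivial_if_center_kernel_trivial:
  assumes f: "f \<in> hom H H" and z: "\<And>z. z \<in> upper_central H 1 \<Longrightarrow> f z = \<one> \<Longrightarrow> z = \<one>"
    and "x \<in> carrier H" "f x = \<one>"
  shows "x = \<one>"
proof -
  interpret f: group_hom H H f using f by unfold_locales
  have up: "x \<otimes> y \<otimes> inv x \<otimes> inv y \<in> upper_central H n"
    if x: "x \<in> upper_central H (Suc n)" and y: "y \<in> carrier H" for x y n
  proof -
    interpret N: normal "upper_central H n" H by (rule upper_central_normal)
    have xc: "x \<in> carrier H" "upper_central H n #> (x \<otimes> y) = upper_central H n #> (y \<otimes> x)"
      using x y N.rcos_in_center_iff by auto
    then have "x \<otimes> y \<in> upper_central H n #> (y \<otimes> x)" using rcos_self[OF _ N.subgroup_axioms] y by blast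
    then obtain u where u: "u \<in> upper_central H n" "x \<otimes> y = u \<otimes> (y \<otimes> x)" by (auto simp: r_coset_def)
    have uc: "u \<in> carrier H" using u(1) N.subset by blast
    have "x \<otimes> y \<otimes> inv x \<otimes> inv y = u" unfolding u(2) using uc xc y by (simp add: m_assoc)
    then show ?thesis using u(1) by simp
  qed
  have "x \<in> upper_central H (Suc n) \<Longrightarrow> f x = \<one> \<Longrightarrow> x = \<one>" for x n
  proof (induction n arbitrary: x)
    case 0
    then show ?case using z by simp
  next
    case (Suc n)
    have x: "x \<in> carrier H" using Suc.prems(1) by simp
    have comm1: "x \<otimes> y \<otimes> inv x \<otimes> inv y = \<one>" if y: "y \<in> carrier H" for y
      using Suc.IH[OF up[OF Suc.prems(1) y]] x y Suc.prems(2) by (simp add: f.hom_mult)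
    have "x \<otimes> y = y \<otimes> x" if y: "y \<in> carrier H" for y
    proof -
      have "x \<otimes> y \<otimes> inv x \<otimes> inv y \<otimes> (y \<otimes> x) = x \<otimes> y" using x y
        by (simp only: m_assoc m_closed inv_closed) (simp flip: m_assoc)
      then show ?thesis using comm1[OF y] x y by simp
    qed
    then have "x \<in> upper_central H 1"
      using x normal.rcos_in_center_iff[OF upper_central_normal[of 0] x] by simp
    then show ?case using z Suc.prems(2) by blast
  qed
  then show ?thesis using upper_central_4 assms(3,4) by (metis Suc_eq_plus1 eval_nat_numeral(2) numeral_eq_Suc)
qed

text \<open>
  The endomorphism exists by the universal property, and \<open>H\<close> is finite, so
  injectivity suffices, and by nilpotency only on the centre. Central elements are powers
  \<open>C^n\<close>, and the exponent of \<open>C\<close> in the \<open>n\<close>-th power of the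
  image of \<open>C\<close> is \<open>n\<close> times an odd number modulo \<open>q\<close>.
\<close>

lemma pair_auto:
  assumes pair: "macdonald_pair (1 + 4 * \<nu>) q (E a k b) (E c k' d)" and odd: "odd (a * d - b * c)"
  shows "\<exists>f\<in>auto H. f A = E a k b \<and> f B = E c k' d"
proof -
  obtain f where f: "f \<in> hom H H" "f A = E a k b" "f B = E c k' d" using pair_lift[OF pair] by blast
  interpret f: group_hom H H f using f(1) by unfold_locales
  obtain \<delta> where U: "comm (E a k b) (E c k' d)
      = E (4 * \<nu> * comm_exp_A a k b c k' d) (a * d - b * c + 4 * \<nu> * \<delta>) (4 * \<nu> * comm_exp_B a k b c k' d)"
    using comm_E by blast
  define e f' \<Delta> where "e = comm_exp_A a k b c k' d" and "f' = comm_exp_B a k b c k' d" and "\<Delta> = a * d - b * c + 4 * \<nu> * \<delta>"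
  have "z = \<one>" if z: "z \<in> upper_central H 1" "f z = \<one>" for z
  proof -
    obtain i l j where zE: "z = E i l j" "q dvd i" "q dvd j" using z(1) unfolding upper_central_eqs W_def by blast
    define n where "n = nat (l mod q)"
    have n: "int n = l mod q" unfolding n_def using pos_mod_sign[OF positive(3)] by simp
    have zn: "z = E 0 (int n) 0" unfolding zE(1) n
      by (rule E_cong) (use zE(2,3) in \<open>simp_all add: cong_iff_dvd_diff cong_def\<close>)
    have "f z = E (4 * \<nu> * e) \<Delta> (4 * \<nu> * f') [^] n"
      unfolding zn hom_E[OF is_group f(1)] f(2,3) U int_pow_int e_def f'_def \<Delta>_def by simp
    moreover have pa: "(4 * \<nu> * e) ^ 2 - 4 * \<nu> * e = 2 * (2 * \<nu> * (4 * \<nu> * e ^ 2 - e))"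
      and pb: "(4 * \<nu> * f') ^ 2 + 4 * \<nu> * f' = 2 * (2 * \<nu> * (4 * \<nu> * f' ^ 2 + f'))"
      by (simp_all add: algebra_simps power2_eq_square)
    ultimately have E0: "E 0 0 0 = E (4 * \<nu> * e) \<Delta> (4 * \<nu> * f') [^] n" using z(2) by (simp add: E_one)
    \<comment> \<open>\<open>R\<close> collects the terms of \<open>E_pow\<close> other than \<open>n * \<Delta>\<close> in the exponent of \<open>C\<close>; each of them contains \<open>8 * \<nu> ^ 2\<close>.\<close>
    define R where "R = 4 * \<nu> * e * (4 * \<nu> * f') * int (n choose 2) + 4 * \<nu> *
        ((4 * \<nu> * e) ^ 2 * (4 * \<nu> * f') ^ 2 * int (n choose 4)
        + (4 * \<nu> * e) ^ 2 * (2 * \<nu> * (4 * \<nu> * f' ^ 2 + f')) * int (n choose 3)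
        - 4 * \<nu> * e * (4 * \<nu> * f') * \<Delta> * int (n choose 3)
        + 2 * \<nu> * (4 * \<nu> * e ^ 2 - e) * (4 * \<nu> * f') ^ 2 * int (n choose 3)
        + 2 * \<nu> * (4 * \<nu> * e ^ 2 - e) * (2 * \<nu> * (4 * \<nu> * f' ^ 2 + f')) * int (n choose 2))"
    obtain x y where "E 0 0 0 = E x (int n * \<Delta> - R) y"
      using E0 unfolding E_pow[OF pa pb] R_def diff_diff_eq by blast
    then have nR: "q dvd 0 - (int n * \<Delta> - R)" unfolding E_eq_iff by blast
    have "q dvd R"
      unfolding R_def
      by (rule q_dvdI[of _ "2 * e * f' * int (n choose 2) + 128 * \<nu> ^ 3 * e ^ 2 * f' ^ 2 * int (n choose 4)
          + 16 * \<nu> ^ 2 * e ^ 2 * (4 * \<nu> * f' ^ 2 + f') * int (n choose 3) - 8 * \<nu> * e * f' * \<Delta> * int (n choose 3)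
          + 16 * \<nu> ^ 2 * (4 * \<nu> * e ^ 2 - e) * f' ^ 2 * int (n choose 3)
          + 2 * \<nu> * (4 * \<nu> * e ^ 2 - e) * (4 * \<nu> * f' ^ 2 + f') * int (n choose 2)"])
        (simp add: algebra_simps power2_eq_square power3_eq_cube)
    from dvd_diff[OF this nR] have "q dvd int n * \<Delta>" by simp
    moreover have "coprime q \<Delta>" using odd by (simp add: q_def \<Delta>_def)
    ultimately have "q dvd int n" by (simp add: coprime_dvd_mult_left_iff)
    then show "z = \<one>" unfolding zn E_one[symmetric] E_eq_iff by simp
  qed
  note ker = kernel_trivial_if_center_kernel_trivial[OF f(1) this]
  have "kernel H H f = {\<one>}"
    unfolding kernel_def by (intro equalityI subsetI) (use ker f.hom_one in auto)
  then have "inj_on f (carrier H)" by (simp only: f.inj_iff_trivial_ker)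
  then have "bij_betw f (carrier H) (carrier H)"
    unfolding bij_betw_def using endo_inj_surj[OF finite_carrier, of f] f.hom_closed by (simp add: image_subset_iff)
  then have "bij_betw (restrict f (carrier H)) (carrier H) (carrier H)"
    by (rule bij_betw_cong[THEN iffD1, rotated]) simp
  moreover have "restrict f (carrier H) \<in> hom H H"
    by (rule homI) simp_all
  ultimately have "restrict f (carrier H) \<in> auto H"
    by (simp only: auto_def Bij_def Int_iff mem_Collect_eq restrict_extensional simp_thms)
  moreover have "restrict f (carrier H) A = E a k b" "restrict f (carrier H) B = E c k' d"
    using f(2,3) by simp_all
  ultimately show ?thesis by blast
qed

end

context macdonald_H begin

section \<open>The automorphism group and its action on H/Z_3\<close>

abbreviation AG where "AG \<equiv> AutoGroup H"

lemma group_AG: "group AG" by (rule AutoGroup)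

lemma AG_carrier: "carrier AG = auto H" by (simp add: AutoGroup_def)

lemma autoD:
  assumes "f \<in> auto H"
  shows "f \<in> hom H H" "f \<in> extensional (carrier H)" "f ` carrier H = carrier H" "inj_on f (carrier H)"
  using assms by (auto simp: auto_def Bij_def bij_betw_def)

lemma auto_closed: "f \<in> auto H \<Longrightarrow> x \<in> carrier H \<Longrightarrow> f x \<in> carrier H"
  using autoD(1) by (auto simp: hom_def)

lemma AG_mult_apply: "f \<in> auto H \<Longrightarrow> f' \<in> auto H \<Longrightarrow> x \<in> carrier H \<Longrightarrow> (f \<otimes>\<^bsub>AG\<^esub> f') x = f (f' x)"
  by (simp add: AutoGroup_def BijGroup_def auto_def compose_def)

lemma AG_one: "\<one>\<^bsub>AG\<^esub> = (\<lambda>x\<in>carrier H. x)"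
  by (simp add: AutoGroup_def BijGroup_def)

lemma auto_eqI:
  assumes "f \<in> auto H" "f' \<in> auto H" "f A = f' A" "f B = f' B"
  shows "f = f'"
proof (rule extensionalityI[OF autoD(2)[OF assms(1)] autoD(2)[OF assms(2)]])
  fix x assume "x \<in> carrier H"
  then show "f x = f' x" by (rule hom_eqI[OF is_group autoD(1)[OF assms(1)] autoD(1)[OF assms(2)] assms(3,4)])
qed

lemma auto_sending_eqI: "f \<in> auto H \<Longrightarrow> f A = X \<Longrightarrow> f B = Y \<Longrightarrow> auto_sending H A B X Y = f"
  unfolding auto_sending_def using auto_eqI by (intro the_equality) auto

abbreviation zeta where "zeta n \<equiv> canonical_map H (upper_central H n)"

text \<open>
  Automorphisms induce the same map on \<open>H/Z_n(H)\<close> as soon as they agree there on the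
  generators.
\<close>

lemma zeta_eq_iff:
  assumes f: "f \<in> auto H" and f': "f' \<in> auto H"
  shows "zeta n f = zeta n f' \<longleftrightarrow> upper_central H n #> f A = upper_central H n #> f' A
    \<and> upper_central H n #> f B = upper_central H n #> f' B"
proof -
  let ?Z = "upper_central H n"
  interpret N: normal ?Z H by (rule upper_central_normal)
  have car: "carrier (H Mod ?Z) = (\<lambda>x. ?Z #> x) ` carrier H"
    by (auto simp: FactGroup_def RCOSETS_def)
  have val: "zeta n h (?Z #> x) = ?Z #> h x" if "h \<in> auto H" "x \<in> carrier H" for h x
    using that image_rcoset_auto[OF that(1) N.subset auto_upper_central[OF that(1)] that(2)]
    by (simp add: canonical_map_def car)
  have hom: "(\<lambda>x. ?Z #> h x) \<in> hom H (H Mod ?Z)" if "h \<in> auto H" for h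
  proof -
    interpret h: group_hom H H h using autoD(1)[OF that] by unfold_locales
    show ?thesis by (rule homI) (simp_all add: car N.rcos_sum)
  qed
  show ?thesis
  proof
    assume "zeta n f = zeta n f'"
    then show "?Z #> f A = ?Z #> f' A \<and> ?Z #> f B = ?Z #> f' B"
      using val[OF f] val[OF f'] by (metis A_closed B_closed)
  next
    assume h: "?Z #> f A = ?Z #> f' A \<and> ?Z #> f B = ?Z #> f' B"
    have eq: "?Z #> f x = ?Z #> f' x" if "x \<in> carrier H" for x
      by (rule hom_eqI[OF N.factorgroup_is_group hom[OF f] hom[OF f'] _ _ that]) (use h in auto)
    show "zeta n f = zeta n f'"
    proof
      fix X
      show "zeta n f X = zeta n f' X"
      proof (cases "X \<in> carrier (H Mod ?Z)")
        case True
        then obtain x where "X = ?Z #> x" "x \<in> carrier H" unfolding car by blast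
        then show ?thesis using val[OF f] val[OF f'] eq by simp
      qed (simp add: canonical_map_def)
    qed
  qed
qed

lemma zeta_group_hom: "group_hom AG (AutoGroup (H Mod upper_central H n)) (zeta n)"
proof -
  interpret N: normal "upper_central H n" H by (rule upper_central_normal)
  show ?thesis
    unfolding group_hom_def group_hom_axioms_def
    using canonical_map_hom group_AG group.AutoGroup[OF N.factorgroup_is_group] by blast
qed

lemma Aut_upper_iff: "f \<in> Aut_upper H n \<longleftrightarrow> f \<in> auto H \<and> zeta n f = zeta n \<one>\<^bsub>AG\<^esub>"
proof -
  interpret z: group_hom AG "AutoGroup (H Mod upper_central H n)" "zeta n" by (rule zeta_group_hom)
  show ?thesis using z.hom_one by (simp add: Aut_upper_def kernel_def AG_carrier)
qed

lemma Aut_upper_normal: "Aut_upper H n \<lhd> AG"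
  unfolding Aut_upper_def by (rule group_hom.normal_kernel[OF zeta_group_hom])

lemma factor_Aut_upper:
  assumes "f \<in> auto H" "f' \<in> auto H" "zeta n f = zeta n f'"
  shows "f \<otimes>\<^bsub>AG\<^esub> inv\<^bsub>AG\<^esub> f' \<in> Aut_upper H n"
proof -
  interpret z: group_hom AG "AutoGroup (H Mod upper_central H n)" "zeta n" by (rule zeta_group_hom)
  have c: "f \<in> carrier AG" "f' \<in> carrier AG" using assms by (simp_all add: AG_carrier)
  have "zeta n (f \<otimes>\<^bsub>AG\<^esub> inv\<^bsub>AG\<^esub> f') = zeta n f' \<otimes>\<^bsub>AutoGroup (H Mod upper_central H n)\<^esub> inv\<^bsub>AutoGroup (H Mod upper_central H n)\<^esub> zeta n f'"
    using c assms(3) by (simp only: z.hom_mult z.hom_inv z.G.inv_closed)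
  also have "\<dots> = \<one>\<^bsub>AutoGroup (H Mod upper_central H n)\<^esub>" using c by (intro z.H.r_inv z.hom_closed)
  finally show ?thesis unfolding Aut_upper_def kernel_def using c by simp
qed

lemma Z3_coset_iff:
  assumes "x \<in> carrier H" "y \<in> carrier H" "ab_class x i j" "ab_class y i' j'"
  shows "upper_central H 3 #> x = upper_central H 3 #> y \<longleftrightarrow> s dvd i - i' \<and> s dvd j - j'"
proof -
  obtain a k b where x: "x = E a k b" "[a = i] (mod s)" "[b = j] (mod s)"
    using assms(3) s_dvd_w unfolding ab_class_def by (blast intro: cong_dvd_modulus)
  obtain a' k' b' where y: "y = E a' k' b'" "[a' = i'] (mod s)" "[b' = j'] (mod s)"
    using assms(4) s_dvd_w unfolding ab_class_def by (blast intro: cong_dvd_modulus)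
  have "upper_central H 3 #> x = upper_central H 3 #> y \<longleftrightarrow> [a = a'] (mod s) \<and> [b = b'] (mod s)"
    using rcos_W_eq_iff[OF levels(4) _ assms(1,2)] upper_central_normal[of 3]
    unfolding upper_central_eqs x(1) y(1) coord_cong_E[OF levels(4)] by (simp add: cong_iff_dvd_diff)
  also have "\<dots> \<longleftrightarrow> [i = i'] (mod s) \<and> [j = j'] (mod s)"
    using x(2,3) y(2,3) cong_sym cong_trans by meson
  finally show ?thesis by (simp add: cong_iff_dvd_diff)
qed

text \<open>
  The rows are the classes of the images of \<open>A\<close> and \<open>B\<close> modulo
  \<open>2^m\<close>. This is finer than the action on \<open>H/Z_3(H)\<close>, which is the
  matrix modulo \<open>2^(m-1)\<close> by \<open>zeta_3_eq_iff\<close>.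
\<close>

definition mat :: "('a \<Rightarrow> 'a) \<Rightarrow> int \<Rightarrow> int \<Rightarrow> int \<Rightarrow> int \<Rightarrow> bool" where
  "mat f a b c d \<longleftrightarrow> ab_class (f A) a b \<and> ab_class (f B) c d"

lemma zeta_3_eq_iff:
  assumes "f \<in> auto H" "f' \<in> auto H" "mat f a b c d" "mat f' a' b' c' d'"
  shows "zeta 3 f = zeta 3 f' \<longleftrightarrow> s dvd a - a' \<and> s dvd b - b' \<and> s dvd c - c' \<and> s dvd d - d'"
proof -
  have h: "ab_class (f A) a b" "ab_class (f B) c d" "ab_class (f' A) a' b'" "ab_class (f' B) c' d'" using assms(3,4) by (simp_all add: mat_def)
  show ?thesis
    unfolding zeta_eq_iff[OF assms(1,2)]
      Z3_coset_iff[OF auto_closed[OF assms(1) A_closed] auto_closed[OF assms(2) A_closed] h(1,3)]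
      Z3_coset_iff[OF auto_closed[OF assms(1) B_closed] auto_closed[OF assms(2) B_closed] h(2,4)] by blast
qed

lemma mat_mult:
  assumes "f \<in> auto H" "f' \<in> auto H" "mat f a b c d" "mat f' a' b' c' d'"
  shows "mat (f \<otimes>\<^bsub>AG\<^esub> f') (a * a' + c * b') (b * a' + d * b') (a * c' + c * d') (b * c' + d * d')"
  using assms(3,4) unfolding mat_def AG_mult_apply[OF assms(1,2) A_closed] AG_mult_apply[OF assms(1,2) B_closed]
  using ab_class_hom[OF autoD(1)[OF assms(1)]] by blast

lemma mat_one: "mat \<one>\<^bsub>AG\<^esub> 1 0 0 1"
  by (simp add: mat_def AG_one ab_class_A ab_class_B)

lemma mat_E: "f A = E a k b \<Longrightarrow> f B = E c k' d \<Longrightarrow> mat f a b c d"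
  by (simp add: mat_def ab_class_E)

lemma auto_coords:
  assumes "f \<in> auto H"
  obtains a k b c k' d where "f A = E a k b" "f B = E c k' d"
  using E_cases[OF auto_closed[OF assms A_closed]] E_cases[OF auto_closed[OF assms B_closed]] by metis

lemma pair_sym: "macdonald_pair \<alpha> n x y \<longleftrightarrow> macdonald_pair \<alpha> n y x"
  unfolding macdonald_pair_def by blast

lemma pair_AB: "macdonald_pair (1 + 4 * \<nu>) q A B"
  unfolding A_eq B_eq by (rule pair_suf) simp_all

lemma pair_image:
  assumes "f \<in> hom H H" "macdonald_pair \<alpha> n x y"
  shows "macdonald_pair \<alpha> n (f x) (f y)"
proof -
  interpret f: group_hom H H f using assms(1) by unfold_locales
  have xy: "x \<in> carrier H" "y \<in> carrier H" and r: "x \<otimes> comm x y = comm x y \<otimes> x [^] \<alpha>"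
    "y \<otimes> comm y x = comm y x \<otimes> y [^] \<alpha>" "x [^] n = \<one>" "y [^] n = \<one>"
    using assms(2) unfolding macdonald_pair_def by blast+
  have c: "f (comm x y) = comm (f x) (f y)" "f (comm y x) = comm (f y) (f x)" using xy by (simp_all add: comm_def)
  show ?thesis unfolding macdonald_pair_def
    using arg_cong[OF r(1), of f] arg_cong[OF r(2), of f] arg_cong[OF r(3), of f] arg_cong[OF r(4), of f] xy
    by (simp add: c[symmetric] f.hom_int_pow)
qed

text \<open>
  The preimages of \<open>A\<close> and \<open>B\<close> give an inverse matrix modulo
  \<open>w\<close>.
\<close>

lemma auto_det_odd:
  assumes f: "f \<in> auto H" and m: "mat f a b c d"
  shows "odd (a * d - b * c)"
proof -
  obtain x y where xy: "x \<in> carrier H" "y \<in> carrier H" "f x = A" "f y = B"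
    using autoD(3)[OF f] A_closed B_closed by (metis imageE)
  obtain i k j where "x = E i k j" using xy(1) by (rule E_cases)
  then have x: "ab_class x i j" by (simp add: ab_class_E)
  obtain i' k' j' where "y = E i' k' j'" using xy(2) by (rule E_cases)
  then have y: "ab_class y i' j'" by (simp add: ab_class_E)
  have "ab_class A (a * i + c * j) (b * i + d * j)" "ab_class B (a * i' + c * j') (b * i' + d * j')"
    using ab_class_hom[OF autoD(1)[OF f]] m x y xy unfolding mat_def by metis+
  then have h: "[a * i + c * j = 1] (mod w)" "[b * i + d * j = 0] (mod w)"
    "[a * i' + c * j' = 0] (mod w)" "[b * i' + d * j' = 1] (mod w)"
    using ab_class_unique ab_class_A ab_class_B by blast+
  have "[(a * i + c * j) * (b * i' + d * j') - (a * i' + c * j') * (b * i + d * j) = 1 * 1 - 0 * 0] (mod w)"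
    by (intro cong_diff cong_mult h)
  then have "[(a * d - b * c) * (i * j' - i' * j) = 1] (mod w)" by (simp add: algebra_simps)
  then have "[(a * d - b * c) * (i * j' - i' * j) = 1] (mod 2)"
    by (rule cong_dvd_modulus) (simp add: w_eq)
  then have "odd ((a * d - b * c) * (i * j' - i' * j))" by (auto simp: cong_def even_iff_mod_2_eq_zero)
  then show ?thesis by simp
qed

lemma auto_from_coords:
  assumes "macdonald_pair (1 + 4 * \<nu>) q (E a k b) (E c k' d)" "odd (a * d - b * c)"
  shows "auto_sending H A B (E a k b) (E c k' d) \<in> auto H"
    "auto_sending H A B (E a k b) (E c k' d) A = E a k b"
    "auto_sending H A B (E a k b) (E c k' d) B = E c k' d"
  using pair_auto[OF assms] auto_sending_eqI by auto

definition nuH where "nuH = auto_sending H A B B A"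

lemma nuH: "nuH \<in> auto H" "nuH A = B" "nuH B = A"
proof -
  have "macdonald_pair (1 + 4 * \<nu>) q (E 0 0 1) (E 1 0 0)" using pair_AB pair_sym unfolding A_eq B_eq by blast
  from auto_from_coords[OF this, folded A_eq B_eq, folded nuH_def]
  show "nuH \<in> auto H" "nuH A = B" "nuH B = A" by simp_all
qed

lemma mat_nuH: "mat nuH 0 1 1 0" by (simp add: mat_def nuH ab_class_A ab_class_B)

lemma nuH_nuH: "nuH \<otimes>\<^bsub>AG\<^esub> nuH = \<one>\<^bsub>AG\<^esub>"
proof (rule auto_eqI)
  interpret AG: group AG by (rule group_AG)
  show "nuH \<otimes>\<^bsub>AG\<^esub> nuH \<in> auto H" "\<one>\<^bsub>AG\<^esub> \<in> auto H"
    using AG.m_closed AG.one_closed nuH(1) unfolding AG_carrier by blast+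
qed (simp_all add: AG_mult_apply nuH AG_one)

lemma A_pow: "A [^] (n::nat) = E (int n) 0 0" and B_pow: "B [^] (n::nat) = E 0 0 (int n)"
  by (simp_all add: E_def int_pow_int)

lemma int_power_s: "int (2 ^ (m - 1)) = s" by (simp add: s_def)

definition GammaH where "GammaH = auto_sending H A B (A [^] (1 + (2::nat) ^ (m - 1))) (B \<otimes> A [^] ((2::nat) ^ (m - 1)))"

lemma GammaH: "GammaH \<in> auto H" and mat_GammaH: "mat GammaH (1 + s) 0 s 1"
proof -
  obtain p where p: "s ^ 2 - s = 2 * p" using even_square_diff[of s] by blast
  have X: "A [^] (1 + (2::nat) ^ (m - 1)) = E (1 + s) 0 0" unfolding A_pow by (simp add: s_def)
  \<comment> \<open>The normal form of \<open>BA^s\<close>; modulo \<open>w\<close> its exponents of \<open>A\<close> and \<open>B\<close> are \<open>s\<close> and \<open>1\<close>.\<close>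
  have Y: "B \<otimes> A [^] ((2::nat) ^ (m - 1)) = E (s + 4 * \<nu> * p) (- s - 4 * \<nu> * p) (1 + 4 * \<nu> * s)"
    unfolding A_pow int_power_s B_eq E_mult p by (simp add: algebra_simps)
  have "macdonald_pair (1 + 4 * \<nu>) q (E (1 + s) 0 0) (E (s + 4 * \<nu> * p) (- s - 4 * \<nu> * p) (1 + 4 * \<nu> * s))"
    using s_dvd_4nu w_dvd by (intro pair_suf) simp_all
  moreover have "odd ((1 + s) * (1 + 4 * \<nu> * s) - 0 * (s + 4 * \<nu> * p))" using even_s by simp
  ultimately have "GammaH \<in> auto H" "GammaH A = E (1 + s) 0 0"
    "GammaH B = E (s + 4 * \<nu> * p) (- s - 4 * \<nu> * p) (1 + 4 * \<nu> * s)"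
    using auto_from_coords unfolding GammaH_def X Y by blast+
  then show "GammaH \<in> auto H" "mat GammaH (1 + s) 0 s 1"
    using w_dvd by (simp_all add: mat_def ab_class_E cong_iff_dvd_diff)
qed

definition r :: int where "r = 2 ^ (m - 2)"

lemma r_eq: "w = 4 * r" "s = 2 * r" by (simp_all add: r_def two_powers)

lemma even_r: "m > 2 \<Longrightarrow> even r" by (simp add: r_def)

definition SigmaH where
  "SigmaH = (if m > 2 then auto_sending H A B
      (A [^] (1 + (2::nat) ^ (m - 2)) \<otimes> B [^] ((2::nat) ^ (m - 2)))
      (B [^] (1 + (2::nat) ^ (m - 2)) \<otimes> A [^] ((2::nat) ^ (m - 2)))
    else \<one>\<^bsub>AG\<^esub>)"

text \<open>
  Here \<open>b\<close> is \<open>r\<close>, only half of \<open>s\<close>, so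
  \<open>pair_suf\<close> does not apply and \<open>pair_iff\<close> is checked directly. For
  \<open>m>2\<close> the number \<open>r = 2 * \<rho>\<close> is even, which makes both values of
  \<open>Q\<close> multiples of \<open>w\<close>.
\<close>

lemma pair_Sigma:
  assumes m: "m > 2" and c: "[a = 1 + r] (mod w)" "[b = r] (mod w)" "[c = r] (mod w)" "[d = 1 + r] (mod w)"
  shows "macdonald_pair (1 + 4 * \<nu>) q (E a k b) (E c k' d)"
proof -
  obtain \<rho> where \<rho>: "r = 2 * \<rho>" using even_r[OF m] by blast
  have wr: "w = 8 * \<rho>" by (simp add: r_eq \<rho>)
  have "Q (1 + r) k r r k' (1 + r) = w * (1 + k + 2 * k * \<rho> - k' - 2 * k' * \<rho> + 5 * \<rho> + 8 * \<rho> ^ 2)"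
    unfolding Q_def wr \<rho> by (simp add: algebra_simps power2_eq_square)
  then have Q1: "w dvd Q a k b c k' d" using cong_dvd_iff[OF Q_cong[OF c(1,2,3,4)]] by simp
  have "Q r k' (1 + r) (1 + r) k r = w * (- k - 2 * k * \<rho> + k' + 2 * k' * \<rho> - 3 * \<rho> - 8 * \<rho> ^ 2)"
    unfolding Q_def wr \<rho> by (simp add: algebra_simps power2_eq_square)
  then have Q2: "w dvd Q c k' d a k b" using cong_dvd_iff[OF Q_cong[OF c(3,4,1,2)]] by simp
  have cs: "[a = 1 + r] (mod s)" "[b = r] (mod s)" "[c = r] (mod s)" "[d = 1 + r] (mod s)"
    using c s_dvd_w by (auto intro: cong_dvd_modulus)
  have D: "[a * d - b * c - 1 = (1 + r) * (1 + r) - r * r - 1] (mod s)"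
    "[b * (a * d - b * c + 1) = r * ((1 + r) * (1 + r) - r * r + 1)] (mod s)"
    "[c * (c * b - d * a - 1) = r * (r * r - (1 + r) * (1 + r) - 1)] (mod s)"
    "[c * b - d * a + 1 = r * r - (1 + r) * (1 + r) + 1] (mod s)"
    by (intro cong_add cong_diff cong_mult cong_refl cs)+
  have "s dvd (1 + r) * (1 + r) - r * r - 1" "s dvd r * ((1 + r) * (1 + r) - r * r + 1)"
    "s dvd r * (r * r - (1 + r) * (1 + r) - 1)" "s dvd r * r - (1 + r) * (1 + r) + 1"
    unfolding r_eq(2) by (simp_all add: algebra_simps)
  with D have D': "s dvd a * d - b * c - 1" "s dvd b * (a * d - b * c + 1)" "s dvd c * (c * b - d * a - 1)"
    "s dvd c * b - d * a + 1" using cong_dvd_iff by blast+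
  have "2 dvd w" by (simp add: w_eq)
  then have "[b = r] (mod 2)" "[c = r] (mod 2)" using c(2,3) cong_dvd_modulus by blast+
  then have "even b" "even c" using even_r[OF m] cong_dvd_iff by blast+
  then show ?thesis unfolding pair_iff using D' Q1 Q2 by simp
qed

lemma SigmaH: "SigmaH \<in> auto H" and mat_SigmaH: "m > 2 \<Longrightarrow> mat SigmaH (1 + r) r r (1 + r)"
proof -
  have *: "SigmaH \<in> auto H \<and> mat SigmaH (1 + r) r r (1 + r)" if m: "m > 2"
  proof -
    have r: "int (2 ^ (m - 2)) = r" "int (1 + 2 ^ (m - 2)) = 1 + r" by (simp_all add: r_def)
    obtain p where p: "r ^ 2 - r = 2 * p" using even_square_diff[of r] by blast
    obtain p' where p': "(1 + r) ^ 2 + (1 + r) = 2 * p'" using even_square_add[of "1 + r"] by blast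
    have X: "A [^] (1 + (2::nat) ^ (m - 2)) \<otimes> B [^] ((2::nat) ^ (m - 2)) = E (1 + r) 0 r"
      unfolding A_pow B_pow r E_mult by simp
    define k c d where "k = - r * (1 + r) - \<nu> * (2 * p) * (2 * p')" and "c = r + 2 * \<nu> * (1 + r) * (2 * p)"
      and "d = (1 + r) + 2 * \<nu> * r * (2 * p')"
    have Y: "B [^] (1 + (2::nat) ^ (m - 2)) \<otimes> A [^] ((2::nat) ^ (m - 2)) = E c k d"
      unfolding A_pow B_pow r E_mult p p' k_def c_def d_def by simp
    have "c - r = 4 * \<nu> * ((1 + r) * p)" "d - (1 + r) = 4 * \<nu> * (r * p')" unfolding c_def d_def by simp_all
    then have cd: "[c = r] (mod w)" "[d = 1 + r] (mod w)"
      unfolding cong_iff_dvd_diff by (simp_all only: dvd_mult2[OF w_dvd])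
    have pair: "macdonald_pair (1 + 4 * \<nu>) q (E (1 + r) 0 r) (E c k d)"
      by (rule pair_Sigma[OF m cong_refl cong_refl cd])
    have "2 dvd w" by (simp add: w_eq)
    then have "[c = r] (mod 2)" "[d = 1 + r] (mod 2)" using cd cong_dvd_modulus by blast+
    then have "even c" "odd d" using even_r[OF m] cong_dvd_iff by (blast, metis even_add odd_one cong_dvd_iff)
    then have "odd ((1 + r) * d - r * c)" using even_r[OF m] by simp
    from auto_from_coords[OF pair this] have "SigmaH \<in> auto H" "SigmaH A = E (1 + r) 0 r" "SigmaH B = E c k d"
      unfolding SigmaH_def X Y using m by simp_all
    then show ?thesis using cd by (simp add: mat_def ab_class_E)
  qed
  then show "m > 2 \<Longrightarrow> mat SigmaH (1 + r) r r (1 + r)" by blast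
  have "\<one>\<^bsub>AG\<^esub> \<in> auto H" using group.is_monoid[OF group_AG] monoid.one_closed AG_carrier by metis
  then show "SigmaH \<in> auto H" using * by (cases "m > 2") (simp_all add: SigmaH_def)
qed

end

section \<open>Representatives modulo Aut_3\<close>

lemma (in group) set_mult_if_right_translate:
  assumes "subgroup S G" "K \<subseteq> carrier G" "\<And>f. f \<in> carrier G \<Longrightarrow> \<exists>\<sigma>\<in>S. f \<otimes> \<sigma> \<in> K"
  shows "carrier G = K <#> S"
proof (intro equalityI subsetI)
  fix f assume f: "f \<in> carrier G"
  then obtain \<sigma> where \<sigma>: "\<sigma> \<in> S" "f \<otimes> \<sigma> \<in> K" using assms(3) by blast
  have "\<sigma> \<in> carrier G" using \<sigma>(1) assms(1) by (rule subgroup.mem_carrier[rotated])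
  then have "f = (f \<otimes> \<sigma>) \<otimes> inv \<sigma>" using f by (simp add: m_assoc)
  moreover have "inv \<sigma> \<in> S" using assms(1) \<sigma>(1) by (rule subgroup.m_inv_closed)
  ultimately show "f \<in> K <#> S" using \<sigma>(2) unfolding set_mult_def by blast
next
  fix f assume "f \<in> K <#> S"
  then show "f \<in> carrier G" using assms(2) subgroup.subset[OF assms(1)] unfolding set_mult_def by blast
qed

lemma (in group) iso_klein_four:
  assumes c: "n \<in> carrier G" "t \<in> carrier G" and r: "n \<otimes> n = \<one>" "t \<otimes> t = \<one>" "n \<otimes> t = t \<otimes> n"
    and ne: "n \<noteq> \<one>" "t \<noteq> \<one>" "n \<noteq> t" and car: "carrier G \<subseteq> {\<one>, n, t, n \<otimes> t}"
  shows "G \<cong> integer_mod_group 2 \<times>\<times> integer_mod_group 2"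
proof -
  define \<phi> where "\<phi> = (\<lambda>(x::int, y::int). (if x = 1 then n else \<one>) \<otimes> (if y = 1 then t else \<one>))"
  have two: "{0..<2} = {0, 1::int}" by auto
  have dom: "carrier (integer_mod_group 2 \<times>\<times> integer_mod_group 2) = {0, 1} \<times> {0, 1}"
    by (simp add: DirProd_def carrier_integer_mod_group two)
  have x: "n \<otimes> (n \<otimes> t) = t" "t \<otimes> (n \<otimes> t) = n" "n \<otimes> t \<otimes> (n \<otimes> t) = \<one>" "n \<otimes> t \<otimes> t = n" "n \<otimes> t \<otimes> n = t" "t \<otimes> n \<otimes> t = n"
  proof -
    show 1: "n \<otimes> (n \<otimes> t) = t" using c r(1) by (simp flip: m_assoc)
    show 2: "t \<otimes> (n \<otimes> t) = n" unfolding r(3) using c r(2) by (simp flip: m_assoc)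
    show "n \<otimes> t \<otimes> (n \<otimes> t) = \<one>" using c r(1) 2 by (simp add: m_assoc)
    show "n \<otimes> t \<otimes> t = n" using c r(2) by (simp add: m_assoc)
    show "n \<otimes> t \<otimes> n = t" using c 1 by (simp add: m_assoc r(3)[symmetric])
    show "t \<otimes> n \<otimes> t = n" using c 2 by (simp add: m_assoc)
  qed
  have "n \<otimes> t \<noteq> \<one>" using c r ne by (metis inv_unique' r_cancel_one r_one m_assoc m_closed l_one)
  moreover have "n \<otimes> t \<noteq> n" "n \<otimes> t \<noteq> t" using c ne by simp_all
  ultimately have "inj_on \<phi> ({0, 1} \<times> {0, 1})"
    using c ne by (auto simp: \<phi>_def inj_on_def)
  moreover have "\<phi> ` ({0, 1} \<times> {0, 1}) = carrier G"
    using c car by (auto simp: \<phi>_def)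
  moreover have "\<phi> \<in> hom (integer_mod_group 2 \<times>\<times> integer_mod_group 2) G"
  proof (rule homI)
    fix u v assume "u \<in> carrier (integer_mod_group 2 \<times>\<times> integer_mod_group 2)"
      "v \<in> carrier (integer_mod_group 2 \<times>\<times> integer_mod_group 2)"
    then show "\<phi> (u \<otimes>\<^bsub>integer_mod_group 2 \<times>\<times> integer_mod_group 2\<^esub> v) = \<phi> u \<otimes> \<phi> v"
      unfolding dom using c r x r(3)[symmetric] by (auto simp: \<phi>_def DirProd_def)
  qed (use c in \<open>auto simp: \<phi>_def dom\<close>)
  ultimately have "\<phi> \<in> iso (integer_mod_group 2 \<times>\<times> integer_mod_group 2) G"
    unfolding iso_def bij_betw_def dom by blast
  then have "integer_mod_group 2 \<times>\<times> integer_mod_group 2 \<cong> G" unfolding is_iso_def by blast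
  then show ?thesis by (rule group.iso_sym[OF DirProd_group[OF group_integer_mod_group group_integer_mod_group]])
qed

lemma (in group) iso_cyclic_two:
  assumes c: "n \<in> carrier G" and r: "n \<otimes> n = \<one>" and ne: "n \<noteq> \<one>" and car: "carrier G \<subseteq> {\<one>, n}"
  shows "G \<cong> integer_mod_group 2"
proof -
  define \<phi> where "\<phi> = (\<lambda>x::int. if x = 1 then n else \<one>)"
  have dom: "carrier (integer_mod_group 2) = {0, 1}" by (auto simp: carrier_integer_mod_group)
  have "inj_on \<phi> {0, 1}" using ne by (auto simp: \<phi>_def inj_on_def)
  moreover have "\<phi> ` {0, 1} = carrier G" using c car by (auto simp: \<phi>_def)
  moreover have "\<phi> \<in> hom (integer_mod_group 2) G"
    by (rule homI) (use c r in \<open>auto simp: \<phi>_def dom\<close>)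
  ultimately have "\<phi> \<in> iso (integer_mod_group 2) G" by (simp add: iso_def bij_betw_def dom)
  then have "integer_mod_group 2 \<cong> G" unfolding is_iso_def by blast
  then show ?thesis by (rule group.iso_sym[OF group_integer_mod_group])
qed

context macdonald_H begin

lemma mat_coords:
  assumes "f \<in> auto H" "mat f a b c d"
  obtains a' k b' c' k' d' where "f A = E a' k b'" "f B = E c' k' d'"
    "[a' = a] (mod w)" "[b' = b] (mod w)" "[c' = c] (mod w)" "[d' = d] (mod w)"
    "macdonald_pair (1 + 4 * \<nu>) q (E a' k b') (E c' k' d')"
proof -
  obtain a' k b' c' k' d' where 1: "f A = E a' k b'" "f B = E c' k' d'"
    "[a' = a] (mod w)" "[b' = b] (mod w)" "[c' = c] (mod w)" "[d' = d] (mod w)"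
    using assms(2) unfolding mat_def ab_class_def by blast
  moreover have "macdonald_pair (1 + 4 * \<nu>) q (E a' k b') (E c' k' d')"
    using pair_image[OF autoD(1)[OF assms(1)] pair_AB] 1 by simp
  ultimately show thesis by (rule that)
qed

lemma cong_w_even: "[x = y] (mod w) \<Longrightarrow> even x = even (y::int)"
proof -
  assume "[x = y] (mod w)"
  then have "[x = y] (mod 2)" by (rule cong_dvd_modulus) (simp add: w_eq)
  then show "even x = even y" by (rule cong_dvd_iff)
qed

lemma cong_w_s: "[x = y] (mod w) \<Longrightarrow> [x = y] (mod s)"
  using s_dvd_w by (rule cong_dvd_modulus[rotated])

text \<open>
  The only matrices modulo \<open>2\<close> with odd determinant and with \<open>a * b\<close> and
  \<open>c * d\<close> even are the identity and the swap.
\<close>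

lemma auto_parity:
  assumes "f \<in> auto H" "mat f a b c d"
  shows "odd a \<and> even b \<and> even c \<and> odd d \<or> even a \<and> odd b \<and> odd c \<and> even d"
proof -
  obtain a' k b' c' k' d' where h: "f A = E a' k b'" "f B = E c' k' d'"
    "[a' = a] (mod w)" "[b' = b] (mod w)" "[c' = c] (mod w)" "[d' = d] (mod w)"
    "macdonald_pair (1 + 4 * \<nu>) q (E a' k b') (E c' k' d')" using assms by (rule mat_coords)
  have "even (a' * b')" "even (c' * d')" using h(7) unfolding pair_iff by blast+
  then have "even (a * b)" "even (c * d)" using h(3-6)[THEN cong_w_even] by simp_all
  moreover have "odd (a * d - b * c)" using auto_det_odd[OF assms] .
  ultimately show ?thesis by auto
qed

text \<open>
  The first claim follows by subtracting the two conditions on \<open>a * d - b * c\<close> in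
  \<open>pair_iff\<close>, after cancelling the odd number \<open>a\<close>.
\<close>

lemma auto_nec:
  assumes "f \<in> auto H" "mat f a b c d" "odd a"
  shows "s dvd 2 * b"
    and "s dvd b \<Longrightarrow> s dvd a - 1 \<and> s dvd c \<and> s dvd d - 1 \<and> w dvd (a - 1) - c \<and> w dvd (d - 1) - b"
proof -
  obtain a' k b' c' k' d' where h: "f A = E a' k b'" "f B = E c' k' d'"
    "[a' = a] (mod w)" "[b' = b] (mod w)" "[c' = c] (mod w)" "[d' = d] (mod w)"
    and pair: "macdonald_pair (1 + 4 * \<nu>) q (E a' k b') (E c' k' d')" using assms(1,2) by (rule mat_coords)
  have par: "odd a'" "even b'" "even c'"
    using auto_parity[OF assms(1,2)] assms(3) h(3-5)[THEN cong_w_even] by simp_all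
  have hs: "[a' = a] (mod s)" "[b' = b] (mod s)" "[c' = c] (mod s)" "[d' = d] (mod s)"
    using h(3-6) cong_w_s by blast+
  have D: "s dvd a' * (a' * d' - b' * c' - 1)" and D': "s dvd b' * (a' * d' - b' * c' + 1)"
    using pair unfolding pair_iff by blast+
  have "s dvd b' * (a' * d' - b' * c' + 1) - b' * (a' * d' - b' * c' - 1)"
    using D' dvd_odd_cancel[OF par(1) D] by (intro dvd_diff) simp_all
  then have "s dvd 2 * b'" by (simp add: algebra_simps)
  then show "s dvd 2 * b" using cong_dvd_iff[OF cong_mult[OF cong_refl hs(2), of 2]] by simp
  assume "s dvd b"
  then have "s dvd b'" using cong_dvd_iff[OF hs(2)] by simp
  note n = pair_nec[OF par this pair]
  have c: "[a' - 1 = a - 1] (mod s)" "[d' - 1 = d - 1] (mod s)" "[a' - 1 - c' = a - 1 - c] (mod w)"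
    "[d' - 1 - b' = d - 1 - b] (mod w)"
    by (intro cong_diff cong_refl hs h)+
  show "s dvd a - 1 \<and> s dvd c \<and> s dvd d - 1 \<and> w dvd (a - 1) - c \<and> w dvd (d - 1) - b"
    using n cong_dvd_iff[OF c(1)] cong_dvd_iff[OF c(2)] cong_dvd_iff[OF c(3)] cong_dvd_iff[OF c(4)]
      cong_dvd_iff[OF hs(3)] by blast
qed

abbreviation Aut3 where "Aut3 \<equiv> Aut_upper H 3"

lemma one_auto: "\<one>\<^bsub>AG\<^esub> \<in> auto H"
  using monoid.one_closed[OF group.is_monoid[OF group_AG]] unfolding AG_carrier .

lemma mult_auto: "f \<in> auto H \<Longrightarrow> f' \<in> auto H \<Longrightarrow> f \<otimes>\<^bsub>AG\<^esub> f' \<in> auto H"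
  using monoid.m_closed[OF group.is_monoid[OF group_AG]] unfolding AG_carrier by blast

lemma Aut3_iff:
  assumes "f \<in> auto H" "mat f a b c d"
  shows "f \<in> Aut3 \<longleftrightarrow> s dvd a - 1 \<and> s dvd b \<and> s dvd c \<and> s dvd d - 1"
  unfolding Aut_upper_iff using zeta_3_eq_iff[OF assms(1) one_auto assms(2) mat_one] assms(1) by simp

lemma auto_mat: "f \<in> auto H \<Longrightarrow> \<exists>a b c d. mat f a b c d"
  using auto_coords mat_E by metis

text \<open>
  If the diagonal is odd and \<open>s\<close> does not divide \<open>b\<close>, then
  \<open>b\<close> is an odd multiple of \<open>r\<close> by \<open>auto_nec\<close>; since
  \<open>b\<close> is even this forces \<open>m > 2\<close>, so that \<open>\<Sigma>\<close> is
  available. Composing with it replaces \<open>b\<close> by a sum of two odd multiples of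
  \<open>r\<close>.
\<close>

lemma right_translate_into_Aut3:
  assumes f: "f \<in> auto H"
  shows "\<exists>\<sigma> \<in> {\<one>\<^bsub>AG\<^esub>, nuH, SigmaH, nuH \<otimes>\<^bsub>AG\<^esub> SigmaH}. f \<otimes>\<^bsub>AG\<^esub> \<sigma> \<in> Aut3"
proof -
  interpret AG: group AG by (rule group_AG)
  have diag: "f \<in> Aut3 \<or> f \<otimes>\<^bsub>AG\<^esub> SigmaH \<in> Aut3" if f: "f \<in> auto H" and m: "mat f a b c d" and a: "odd a" for f a b c d
  proof (cases "s dvd b")
    case True
    then show ?thesis using auto_nec(2)[OF f m a] Aut3_iff[OF f m] by blast
  next
    case False
    have par: "even b" "even c" "odd d" using auto_parity[OF f m] a by auto
    have sb: "s dvd 2 * b" by (rule auto_nec(1)[OF f m a])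
    then obtain b0 where "2 * b = s * b0" by blast
    then have b0: "b = r * b0" by (simp add: r_eq)
    have "odd b0" using False b0 by (auto simp: r_eq elim!: evenE)
    have m2: "m > 2"
    proof (rule ccontr)
      assume "\<not> m > 2"
      then have "m - 1 = 1" using m_ge_2 by simp
      then have "s = 2" unfolding s_def by simp
      then show False using False par(1) by simp
    qed
    let ?f = "f \<otimes>\<^bsub>AG\<^esub> SigmaH"
    have f': "?f \<in> auto H" by (rule mult_auto[OF f SigmaH])
    have m': "mat ?f (a * (1 + r) + c * r) (b * (1 + r) + d * r) (a * r + c * (1 + r)) (b * r + d * (1 + r))"
      by (rule mat_mult[OF f SigmaH m mat_SigmaH[OF m2]])
    have a': "odd (a * (1 + r) + c * r)" using a even_r[OF m2] by simp
    have "b * (1 + r) + d * r = r * (b0 * (1 + r) + d)" by (simp add: b0 algebra_simps)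
    moreover obtain u where "b0 * (1 + r) + d = 2 * u"
      using \<open>odd b0\<close> par(3) even_r[OF m2] by (metis even_add even_mult_iff odd_one evenE)
    ultimately have "s dvd b * (1 + r) + d * r" by (simp add: r_eq)
    then show ?thesis using auto_nec(2)[OF f' m' a'] Aut3_iff[OF f' m'] by blast
  qed
  obtain a b c d where m: "mat f a b c d" using auto_mat[OF f] by blast
  show ?thesis
  proof (cases "odd a")
    case True
    then show ?thesis using diag[OF f m] AG.r_one[of f] f by (auto simp: AG_carrier)
  next
    case False
    then have "odd c" using auto_parity[OF f m] by blast
    have f': "f \<otimes>\<^bsub>AG\<^esub> nuH \<in> auto H" by (rule mult_auto[OF f nuH(1)])
    have m': "mat (f \<otimes>\<^bsub>AG\<^esub> nuH) c d a b" using mat_mult[OF f nuH(1) m mat_nuH] by simp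
    have "f \<otimes>\<^bsub>AG\<^esub> nuH \<otimes>\<^bsub>AG\<^esub> SigmaH = f \<otimes>\<^bsub>AG\<^esub> (nuH \<otimes>\<^bsub>AG\<^esub> SigmaH)"
      using f nuH(1) SigmaH by (intro AG.m_assoc) (simp_all add: AG_carrier)
    then show ?thesis using diag[OF f' m' \<open>odd c\<close>] by auto
  qed
qed

abbreviation S where "S \<equiv> generate AG {SigmaH, nuH}"

lemma subgroup_generate: "X \<subseteq> auto H \<Longrightarrow> subgroup (generate AG X) AG"
  using group.generate_is_subgroup[OF group_AG] by (simp add: AG_carrier)

lemma translations_in_S: "{\<one>\<^bsub>AG\<^esub>, nuH, SigmaH, nuH \<otimes>\<^bsub>AG\<^esub> SigmaH} \<subseteq> S"
  by (simp add: generate.one generate.incl generate.eng)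

lemma Aut_upper_subset: "Aut_upper H n \<subseteq> auto H"
  using Aut_upper_iff by blast

lemma auto_eq_Aut3_S: "auto H = Aut3 <#>\<^bsub>AG\<^esub> S"
proof -
  have "carrier AG = Aut3 <#>\<^bsub>AG\<^esub> S"
  proof (rule group.set_mult_if_right_translate[OF group_AG subgroup_generate])
    show "{SigmaH, nuH} \<subseteq> auto H" using SigmaH nuH(1) by simp
    show "Aut3 \<subseteq> carrier AG" using Aut_upper_subset by (simp only: AG_carrier)
    show "\<exists>\<sigma>\<in>S. f \<otimes>\<^bsub>AG\<^esub> \<sigma> \<in> Aut3" if "f \<in> carrier AG" for f
      using right_translate_into_Aut3 that translations_in_S unfolding AG_carrier by (meson subsetD)
  qed
  then show ?thesis by (simp only: AG_carrier)
qed

lemma zeta_image: "zeta 3 ` auto H = zeta 3 ` S"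
proof -
  interpret z: group_hom AG "AutoGroup (H Mod upper_central H 3)" "zeta 3" by (rule zeta_group_hom)
  have S: "S \<subseteq> auto H" using subgroup.subset[OF subgroup_generate] SigmaH nuH(1) by (simp add: AG_carrier)
  have "zeta 3 f \<in> zeta 3 ` S" if f: "f \<in> auto H" for f
  proof -
    have "f \<in> Aut3 <#>\<^bsub>AG\<^esub> S" using f auto_eq_Aut3_S by (simp only:)
    then obtain k \<sigma> where k: "k \<in> Aut3" "\<sigma> \<in> S" "f = k \<otimes>\<^bsub>AG\<^esub> \<sigma>" unfolding set_mult_def by blast
    have c: "k \<in> carrier AG" "\<sigma> \<in> carrier AG" using k(1,2) Aut_upper_subset S by (auto simp: AG_carrier)
    have "zeta 3 f = zeta 3 k \<otimes>\<^bsub>AutoGroup (H Mod upper_central H 3)\<^esub> zeta 3 \<sigma>"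
      unfolding k(3) using c by (rule z.hom_mult)
    also have "zeta 3 k = \<one>\<^bsub>AutoGroup (H Mod upper_central H 3)\<^esub>" using k(1) by (simp add: Aut_upper_def kernel_def)
    also have "\<one>\<^bsub>AutoGroup (H Mod upper_central H 3)\<^esub> \<otimes>\<^bsub>AutoGroup (H Mod upper_central H 3)\<^esub> zeta 3 \<sigma> = zeta 3 \<sigma>"
      using c by (intro z.H.l_one z.hom_closed)
    finally show ?thesis using k(2) by blast
  qed
  then show ?thesis using S by blast
qed

end

context macdonald_H begin

section \<open>The quotient and the order of Aut(H)\<close>

definition QQ where "QQ = AG Mod Aut3"

definition coset3 where "coset3 f = Aut3 #>\<^bsub>AG\<^esub> f"

lemma group_QQ: "group QQ"
  unfolding QQ_def by (rule normal.factorgroup_is_group[OF Aut_upper_normal])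

lemma carrier_QQ: "carrier QQ = coset3 ` auto H"
  unfolding QQ_def coset3_def AG_carrier[symmetric] by (auto simp: FactGroup_def RCOSETS_def)

lemma coset3_mult: "f \<in> auto H \<Longrightarrow> f' \<in> auto H \<Longrightarrow> coset3 f \<otimes>\<^bsub>QQ\<^esub> coset3 f' = coset3 (f \<otimes>\<^bsub>AG\<^esub> f')"
  using normal.rcos_sum[OF Aut_upper_normal[of 3]]
  unfolding QQ_def coset3_def AG_carrier[symmetric] by (simp add: FactGroup_def)

lemma coset3_one: "\<one>\<^bsub>QQ\<^esub> = coset3 \<one>\<^bsub>AG\<^esub>"
proof -
  have "Aut3 \<subseteq> carrier AG" using Aut_upper_subset unfolding AG_carrier .
  then have "coset3 \<one>\<^bsub>AG\<^esub> = Aut3" unfolding coset3_def by (rule group.coset_mult_one[OF group_AG])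
  then show ?thesis by (simp add: QQ_def FactGroup_def)
qed

lemma coset3_Aut3: "f \<in> Aut3 \<Longrightarrow> coset3 f = \<one>\<^bsub>QQ\<^esub>"
proof -
  assume f: "f \<in> Aut3"
  have sub: "subgroup Aut3 AG" using Aut_upper_normal normal_imp_subgroup by blast
  have "f \<in> carrier AG" using f Aut_upper_subset unfolding AG_carrier by blast
  then have "coset3 f = Aut3" unfolding coset3_def using group.coset_join2[OF group_AG _ sub f] by blast
  then show ?thesis by (simp add: QQ_def FactGroup_def)
qed

lemma coset3_eq_iff:
  assumes "f \<in> auto H" "f' \<in> auto H"
  shows "coset3 f = coset3 f' \<longleftrightarrow> zeta 3 f = zeta 3 f'"
proof
  interpret AG: group AG by (rule group_AG)
  interpret z: group_hom AG "AutoGroup (H Mod upper_central H 3)" "zeta 3" by (rule zeta_group_hom)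
  have c: "f \<in> carrier AG" "f' \<in> carrier AG" using assms unfolding AG_carrier .
  have sub: "subgroup Aut3 AG" using Aut_upper_normal normal_imp_subgroup by blast
  {
    assume "coset3 f = coset3 f'"
    then have "f \<in> Aut3 #>\<^bsub>AG\<^esub> f'" using AG.rcos_self[OF c(1) sub] unfolding coset3_def by (simp only:)
    then obtain k where k: "k \<in> Aut3" "f = k \<otimes>\<^bsub>AG\<^esub> f'" unfolding r_coset_def by blast
    have kc: "k \<in> carrier AG" using k(1) Aut_upper_subset unfolding AG_carrier by blast
    have "zeta 3 f = zeta 3 k \<otimes>\<^bsub>AutoGroup (H Mod upper_central H 3)\<^esub> zeta 3 f'"
      unfolding k(2) using kc c(2) by (rule z.hom_mult)
    also have "zeta 3 k = \<one>\<^bsub>AutoGroup (H Mod upper_central H 3)\<^esub>" using k(1) by (simp add: Aut_upper_def kernel_def)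
    also have "\<one>\<^bsub>AutoGroup (H Mod upper_central H 3)\<^esub> \<otimes>\<^bsub>AutoGroup (H Mod upper_central H 3)\<^esub> zeta 3 f' = zeta 3 f'"
      using c by (intro z.H.l_one z.hom_closed)
    finally show "zeta 3 f = zeta 3 f'" .
  next
    assume "zeta 3 f = zeta 3 f'"
    then have k: "f \<otimes>\<^bsub>AG\<^esub> inv\<^bsub>AG\<^esub> f' \<in> Aut3" by (rule factor_Aut_upper[OF assms])
    have "f = (f \<otimes>\<^bsub>AG\<^esub> inv\<^bsub>AG\<^esub> f') \<otimes>\<^bsub>AG\<^esub> f'" using c by (simp add: AG.m_assoc)
    then have "f \<in> Aut3 #>\<^bsub>AG\<^esub> f'" using k unfolding r_coset_def by blast
    then show "coset3 f = coset3 f'" unfolding coset3_def using AG.repr_independence[OF _ c(2) sub] by (simp only:)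
  }
qed

lemma coset3_eq_iff_mat:
  assumes "f \<in> auto H" "f' \<in> auto H" "mat f a b c d" "mat f' a' b' c' d'"
  shows "coset3 f = coset3 f' \<longleftrightarrow> s dvd a - a' \<and> s dvd b - b' \<and> s dvd c - c' \<and> s dvd d - d'"
  unfolding coset3_eq_iff[OF assms(1,2)] zeta_3_eq_iff[OF assms] ..

lemma coset3_nuH: "coset3 nuH \<in> carrier QQ" "coset3 nuH \<otimes>\<^bsub>QQ\<^esub> coset3 nuH = \<one>\<^bsub>QQ\<^esub>" "coset3 nuH \<noteq> \<one>\<^bsub>QQ\<^esub>"
proof -
  show "coset3 nuH \<in> carrier QQ" unfolding carrier_QQ using nuH(1) by blast
  show "coset3 nuH \<otimes>\<^bsub>QQ\<^esub> coset3 nuH = \<one>\<^bsub>QQ\<^esub>" unfolding coset3_mult[OF nuH(1) nuH(1)] nuH_nuH coset3_one ..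
  have "\<not> s dvd 0 - 1"
  proof
    assume "s dvd 0 - 1"
    then have "even (0 - 1 :: int)" by (rule dvd_trans[OF even_s])
    then show False by simp
  qed
  then show "coset3 nuH \<noteq> \<one>\<^bsub>QQ\<^esub>" unfolding coset3_one coset3_eq_iff_mat[OF nuH(1) one_auto mat_nuH mat_one] by blast
qed

text \<open>
  The four representatives are involutions modulo \<open>Aut3\<close>, so the existence of a right
  translate in \<open>Aut3\<close> says that they represent all cosets.
\<close>

lemma coset3_translate: "f \<in> auto H \<Longrightarrow> \<exists>\<sigma> \<in> {\<one>\<^bsub>AG\<^esub>, nuH, SigmaH, nuH \<otimes>\<^bsub>AG\<^esub> SigmaH}. \<sigma> \<in> auto H \<and> coset3 f \<otimes>\<^bsub>QQ\<^esub> coset3 \<sigma> = \<one>\<^bsub>QQ\<^esub>"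
proof -
  assume f: "f \<in> auto H"
  then obtain \<sigma> where \<sigma>: "\<sigma> \<in> {\<one>\<^bsub>AG\<^esub>, nuH, SigmaH, nuH \<otimes>\<^bsub>AG\<^esub> SigmaH}" "f \<otimes>\<^bsub>AG\<^esub> \<sigma> \<in> Aut3"
    using right_translate_into_Aut3 by blast
  have "\<sigma> \<in> auto H" using \<sigma>(1) one_auto nuH(1) SigmaH mult_auto[OF nuH(1) SigmaH] by (elim insertE) simp_all
  moreover from this have "coset3 f \<otimes>\<^bsub>QQ\<^esub> coset3 \<sigma> = \<one>\<^bsub>QQ\<^esub>" unfolding coset3_mult[OF f \<open>\<sigma> \<in> auto H\<close>] by (intro coset3_Aut3 \<sigma>(2))
  ultimately show ?thesis using \<sigma>(1) by blast
qed

lemma quotient_m_2: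
  assumes "m = 2"
  shows "QQ \<cong> integer_mod_group 2"
proof (rule group.iso_cyclic_two[OF group_QQ coset3_nuH])
  interpret QQ: group QQ by (rule group_QQ)
  interpret AG: group AG by (rule group_AG)
  have "\<not> m > 2" using assms by simp
  then have Sig: "SigmaH = \<one>\<^bsub>AG\<^esub>" unfolding SigmaH_def by (simp only: if_False)
  have nu1: "nuH \<otimes>\<^bsub>AG\<^esub> \<one>\<^bsub>AG\<^esub> = nuH" using nuH(1) by (intro AG.r_one) (simp only: AG_carrier)
  show "carrier QQ \<subseteq> {\<one>\<^bsub>QQ\<^esub>, coset3 nuH}"
  proof
    fix x assume "x \<in> carrier QQ"
    then obtain f where f: "f \<in> auto H" "x = coset3 f" unfolding carrier_QQ by blast
    obtain \<sigma> where \<sigma>: "\<sigma> = \<one>\<^bsub>AG\<^esub> \<or> \<sigma> = nuH" "coset3 f \<otimes>\<^bsub>QQ\<^esub> coset3 \<sigma> = \<one>\<^bsub>QQ\<^esub>"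
      using coset3_translate[OF f(1)] unfolding Sig nu1 by blast
    have "coset3 \<sigma> = \<one>\<^bsub>QQ\<^esub> \<or> coset3 \<sigma> = coset3 nuH" using \<sigma>(1) coset3_one by auto
    then have "coset3 \<sigma> \<otimes>\<^bsub>QQ\<^esub> coset3 \<sigma> = \<one>\<^bsub>QQ\<^esub>" "coset3 \<sigma> \<in> carrier QQ"
      using coset3_nuH(1,2) QQ.one_closed QQ.l_one[OF QQ.one_closed] by (elim disjE; simp only:)+
    then have "coset3 f \<otimes>\<^bsub>QQ\<^esub> coset3 \<sigma> = coset3 \<sigma> \<otimes>\<^bsub>QQ\<^esub> coset3 \<sigma>" using \<sigma>(2) by (simp only:)
    then have "coset3 f = coset3 \<sigma>"
      using QQ.right_cancel[OF \<open>coset3 \<sigma> \<in> carrier QQ\<close>] \<open>x \<in> carrier QQ\<close> \<open>coset3 \<sigma> \<in> carrier QQ\<close> unfolding f(2) by blast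
    then show "x \<in> {\<one>\<^bsub>QQ\<^esub>, coset3 nuH}" using f(2) \<sigma>(1) coset3_one by auto
  qed
qed

lemma quotient_m_gt_2:
  assumes m: "m > 2"
  shows "QQ \<cong> integer_mod_group 2 \<times>\<times> integer_mod_group 2"
proof -
  interpret QQ: group QQ by (rule group_QQ)
  have t: "coset3 SigmaH \<in> carrier QQ" unfolding carrier_QQ using SigmaH by blast
  note mS = mat_SigmaH[OF m]
  have tt: "coset3 SigmaH \<otimes>\<^bsub>QQ\<^esub> coset3 SigmaH = \<one>\<^bsub>QQ\<^esub>"
  proof -
    have "(1 + r) * (1 + r) + r * r - 1 = s * (1 + r)" "r * (1 + r) + (1 + r) * r - 0 = s * (1 + r)"
      "(1 + r) * r + r * (1 + r) - 0 = s * (1 + r)" "r * r + (1 + r) * (1 + r) - 1 = s * (1 + r)"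
      by (simp_all add: r_eq algebra_simps)
    then show ?thesis
      unfolding coset3_mult[OF SigmaH SigmaH] coset3_one
        coset3_eq_iff_mat[OF mult_auto[OF SigmaH SigmaH] one_auto mat_mult[OF SigmaH SigmaH mS mS] mat_one]
      by (simp only: dvd_triv_left simp_thms)
  qed
  have nt: "coset3 nuH \<otimes>\<^bsub>QQ\<^esub> coset3 SigmaH = coset3 SigmaH \<otimes>\<^bsub>QQ\<^esub> coset3 nuH"
    unfolding coset3_mult[OF SigmaH nuH(1)] coset3_mult[OF nuH(1) SigmaH]
      coset3_eq_iff_mat[OF mult_auto[OF nuH(1) SigmaH] mult_auto[OF SigmaH nuH(1)]
        mat_mult[OF nuH(1) SigmaH mat_nuH mS] mat_mult[OF SigmaH nuH(1) mS mat_nuH]]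
    by simp
  have rpos: "r > 0" by (simp add: r_def)
  have "\<not> s dvd r - 0" using rpos zdvd_not_zless[of r s] by (simp add: r_eq)
  then have t1: "coset3 SigmaH \<noteq> \<one>\<^bsub>QQ\<^esub>"
    unfolding coset3_one coset3_eq_iff_mat[OF SigmaH one_auto mS mat_one] by blast
  have "\<not> s dvd 0 - (1 + r)"
  proof
    assume "s dvd 0 - (1 + r)"
    then have "even (0 - (1 + r))" using even_s by (rule dvd_trans[rotated])
    then show False using even_r[OF m] by simp
  qed
  then have nt1: "coset3 nuH \<noteq> coset3 SigmaH"
    unfolding coset3_eq_iff_mat[OF nuH(1) SigmaH mat_nuH mS] by blast
  show ?thesis
  proof (rule group.iso_klein_four[OF group_QQ coset3_nuH(1) t coset3_nuH(2) tt nt coset3_nuH(3) t1 nt1], rule subsetI)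
    fix x assume x: "x \<in> carrier QQ"
    then obtain f where f: "f \<in> auto H" "x = coset3 f" unfolding carrier_QQ by blast
    obtain \<sigma> where \<sigma>: "\<sigma> \<in> {\<one>\<^bsub>AG\<^esub>, nuH, SigmaH, nuH \<otimes>\<^bsub>AG\<^esub> SigmaH}" "coset3 f \<otimes>\<^bsub>QQ\<^esub> coset3 \<sigma> = \<one>\<^bsub>QQ\<^esub>"
      using coset3_translate[OF f(1)] by blast
    have ntm: "coset3 nuH \<otimes>\<^bsub>QQ\<^esub> coset3 SigmaH = coset3 (nuH \<otimes>\<^bsub>AG\<^esub> SigmaH)" by (rule coset3_mult[OF nuH(1) SigmaH])
    have c: "coset3 \<sigma> \<in> {\<one>\<^bsub>QQ\<^esub>, coset3 nuH, coset3 SigmaH, coset3 nuH \<otimes>\<^bsub>QQ\<^esub> coset3 SigmaH}"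
      using \<sigma>(1) unfolding ntm coset3_one by blast
    have "(coset3 nuH \<otimes>\<^bsub>QQ\<^esub> coset3 SigmaH) \<otimes>\<^bsub>QQ\<^esub> (coset3 nuH \<otimes>\<^bsub>QQ\<^esub> coset3 SigmaH)
        = (coset3 nuH \<otimes>\<^bsub>QQ\<^esub> coset3 SigmaH) \<otimes>\<^bsub>QQ\<^esub> (coset3 SigmaH \<otimes>\<^bsub>QQ\<^esub> coset3 nuH)" by (simp only: nt)
    also have "\<dots> = coset3 nuH \<otimes>\<^bsub>QQ\<^esub> (coset3 SigmaH \<otimes>\<^bsub>QQ\<^esub> coset3 SigmaH) \<otimes>\<^bsub>QQ\<^esub> coset3 nuH"
      using t coset3_nuH(1) by (simp only: QQ.m_assoc QQ.m_closed)
    also have "\<dots> = \<one>\<^bsub>QQ\<^esub>" using coset3_nuH(1,2) by (simp only: tt QQ.r_one)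
    finally have nt2: "(coset3 nuH \<otimes>\<^bsub>QQ\<^esub> coset3 SigmaH) \<otimes>\<^bsub>QQ\<^esub> (coset3 nuH \<otimes>\<^bsub>QQ\<^esub> coset3 SigmaH) = \<one>\<^bsub>QQ\<^esub>" .
    have "coset3 \<sigma> \<otimes>\<^bsub>QQ\<^esub> coset3 \<sigma> = \<one>\<^bsub>QQ\<^esub>" "coset3 \<sigma> \<in> carrier QQ"
      using c nt2 tt coset3_nuH(1,2) t QQ.m_closed[OF coset3_nuH(1) t] QQ.one_closed QQ.l_one[OF QQ.one_closed]
      by (elim insertE emptyE; simp only:)+
    then have "x \<otimes>\<^bsub>QQ\<^esub> coset3 \<sigma> = coset3 \<sigma> \<otimes>\<^bsub>QQ\<^esub> coset3 \<sigma>" using \<sigma>(2) unfolding f(2) by (simp only:)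
    then have "x = coset3 \<sigma>" using QQ.right_cancel[OF \<open>coset3 \<sigma> \<in> carrier QQ\<close> x \<open>coset3 \<sigma> \<in> carrier QQ\<close>] by blast
    then show "x \<in> {\<one>\<^bsub>QQ\<^esub>, coset3 nuH, coset3 SigmaH, coset3 nuH \<otimes>\<^bsub>QQ\<^esub> coset3 SigmaH}" using c by (simp only:)
  qed
qed

lemma order_AG: "order AG = card (carrier QQ) * card Aut3"
proof -
  have "subgroup Aut3 AG" using Aut_upper_normal normal_imp_subgroup by blast
  then show ?thesis using group.lagrange[OF group_AG, of Aut3] by (simp add: QQ_def FactGroup_def)
qed

lemma card_QQ: "m > 2 \<Longrightarrow> card (carrier QQ) = 4" "m = 2 \<Longrightarrow> card (carrier QQ) = 2"
proof -
  have two: "card (carrier (integer_mod_group 2)) = 2" by (simp add: carrier_integer_mod_group)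
  show "m = 2 \<Longrightarrow> card (carrier QQ) = 2" using iso_same_card[OF quotient_m_2] two by (simp only:)
  have "card (carrier (integer_mod_group 2 \<times>\<times> integer_mod_group 2)) = 4"
    by (simp only: carrier_DirProd card_cartesian_product two)
  then show "m > 2 \<Longrightarrow> card (carrier QQ) = 4" using iso_same_card[OF quotient_m_gt_2] by (simp only:)
qed

text \<open>
  The general solution of the congruences in \<open>pair_suf\<close>. The entries are determined
  modulo \<open>q\<close> by \<open>x,y\<close> modulo \<open>w\<close> and \<open>z,z'\<close>
  modulo \<open>s\<close>, because \<open>q = s * w\<close>; \<open>k,k'\<close> are free modulo
  \<open>q\<close>. This gives \<open>(ws)^2q^2=q^4\<close> automorphisms.
\<close>

definition param :: "int \<times> int \<times> int \<times> int \<times> int \<times> int \<Rightarrow> 'a \<Rightarrow> 'a" where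
  "param = (\<lambda>(x, z, y, z', k, k'). auto_sending H A B (E (1 + s * x) k (s * y + w * z')) (E (s * x + w * z) k' (1 + s * y)))"

lemma param:
  "param (x, z, y, z', k, k') \<in> Aut3" "param (x, z, y, z', k, k') A = E (1 + s * x) k (s * y + w * z')"
  "param (x, z, y, z', k, k') B = E (s * x + w * z) k' (1 + s * y)"
proof -
  have sw: "s dvd s * y + w * z'" "s dvd s * x + w * z" using s_dvd_w by simp_all
  have pair: "macdonald_pair (1 + 4 * \<nu>) q (E (1 + s * x) k (s * y + w * z')) (E (s * x + w * z) k' (1 + s * y))"
    using sw by (intro pair_suf) simp_all
  have "odd ((1 + s * x) * (1 + s * y) - (s * y + w * z') * (s * x + w * z))"
    using even_s by (simp add: w_eq)
  from auto_from_coords[OF pair this] have f: "param (x, z, y, z', k, k') \<in> auto H"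
    "param (x, z, y, z', k, k') A = E (1 + s * x) k (s * y + w * z')"
    "param (x, z, y, z', k, k') B = E (s * x + w * z) k' (1 + s * y)"
    by (simp_all add: param_def)
  then show "param (x, z, y, z', k, k') A = E (1 + s * x) k (s * y + w * z')"
    "param (x, z, y, z', k, k') B = E (s * x + w * z) k' (1 + s * y)" by blast+
  show "param (x, z, y, z', k, k') \<in> Aut3" unfolding Aut3_iff[OF f(1) mat_E[OF f(2,3)]] using sw by simp
qed

lemma Aut3_nec:
  assumes f: "f \<in> Aut3" and m: "mat f a b c d"
  shows "s dvd a - 1" "s dvd b" "s dvd c" "s dvd d - 1" "w dvd (a - 1) - c" "w dvd (d - 1) - b"
proof -
  have fa: "f \<in> auto H" using f Aut_upper_subset by blast
  have k: "s dvd a - 1" "s dvd b" using f unfolding Aut3_iff[OF fa m] by blast+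
  have "even (a - 1)" using even_s k(1) by (rule dvd_trans)
  then have "odd a" by simp
  then show "s dvd a - 1" "s dvd b" "s dvd c" "s dvd d - 1" "w dvd (a - 1) - c" "w dvd (d - 1) - b"
    using auto_nec(2)[OF fa m _ k(2)] k by blast+
qed

lemma box_unique:
  assumes "x \<in> {0..<n}" "y \<in> {0..<n}" "(n::int) dvd x - y"
  shows "x = y"
  using assms by (metis atLeastLessThan_iff cong_iff_dvd_diff cong_less_imp_eq_int)

lemma card_Aut3: "card Aut3 = nat q ^ 4"
proof -
  let ?X = "{0..<w} \<times> {0..<s} \<times> {0..<w} \<times> {0..<s} \<times> {0..<q} \<times> {0..<q}"
  have qsw: "q = s * w" by (simp add: q_eq)
  have "bij_betw param ?X Aut3"
  proof (rule bij_betw_imageI)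
    show "inj_on param ?X"
    proof (rule inj_onI)
      fix u v assume u: "u \<in> ?X" and v: "v \<in> ?X" and eq: "param u = param v"
      obtain x z y z' k k' where u': "u = (x, z, y, z', k, k')" by (cases u)
      obtain x2 z2 y2 z2' k2 k2' where v': "v = (x2, z2, y2, z2', k2, k2')" by (cases v)
      have A: "E (1 + s * x) k (s * y + w * z') = E (1 + s * x2) k2 (s * y2 + w * z2')"
        and B: "E (s * x + w * z) k' (1 + s * y) = E (s * x2 + w * z2) k2' (1 + s * y2)"
        using eq param(2,3) unfolding u' v' by metis+
      have "s * w dvd s * (x - x2)" "s * w dvd s * (y - y2)" "q dvd k - k2" "q dvd k' - k2'"
        using A B unfolding E_eq_iff qsw by (simp_all add: right_diff_distrib)
      then have "w dvd x - x2" "w dvd y - y2" "q dvd k - k2" "q dvd k' - k2'"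
        by (simp_all only: dvd_mult_cancel_left nonzero simp_thms)
      then have e: "x = x2" "y = y2" "k = k2" "k' = k2'"
        using u v box_unique unfolding u' v' by (simp_all only: mem_Times_iff fst_conv snd_conv) blast+
      have "w * s dvd w * (z - z2)" "w * s dvd w * (z' - z2')"
        using A B unfolding E_eq_iff q_eq e by (simp_all add: right_diff_distrib)
      then have "s dvd z - z2" "s dvd z' - z2'"
        by (simp_all only: dvd_mult_cancel_left nonzero simp_thms)
      then have "z = z2" "z' = z2'"
        using u v box_unique unfolding u' v' by (simp_all only: mem_Times_iff fst_conv snd_conv) blast+
      then show "u = v" unfolding u' v' using e by simp
    qed
    show "param ` ?X = Aut3"
    proof (intro equalityI subsetI)
      fix f assume "f \<in> param ` ?X"
      then show "f \<in> Aut3" using param(1) by auto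
    next
      fix f assume f: "f \<in> Aut3"
      have fa: "f \<in> auto H" using f Aut_upper_subset by blast
      obtain a k b c k' d where co: "f A = E a k b" "f B = E c k' d" using auto_coords[OF fa] by metis
      note n = Aut3_nec[OF f mat_E[OF co]]
      obtain x0 where x0: "a - 1 = s * x0" using n(1) by blast
      obtain y0 where y0: "d - 1 = s * y0" using n(4) by blast
      define x y where "x = x0 mod w" and "y = y0 mod w"
      have "w dvd x0 - x" "w dvd y0 - y" by (simp_all add: x_def y_def)
      then have "s * w dvd s * (x0 - x)" "s * w dvd s * (y0 - y)" by simp_all
      then have ax: "q dvd a - (1 + s * x)" "q dvd d - (1 + s * y)"
        using x0 y0 by (simp_all add: qsw algebra_simps)
      have "w dvd c - s * x" "w dvd b - s * y"
      proof -
        have "w dvd (a - (1 + s * x)) - ((a - 1) - c)" "w dvd (d - (1 + s * y)) - ((d - 1) - b)"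
          using n(5,6) dvd_trans[OF w_dvd_q ax(1)] dvd_trans[OF w_dvd_q ax(2)] by (blast intro: dvd_diff)+
        then show "w dvd c - s * x" "w dvd b - s * y" by simp_all
      qed
      then obtain z0 z0' where z0: "c - s * x = w * z0" "b - s * y = w * z0'" by (auto elim!: dvdE)
      define z z' where "z = z0 mod s" and "z' = z0' mod s"
      have "s dvd z0 - z" "s dvd z0' - z'" by (simp_all add: z_def z'_def)
      then have "w * s dvd w * (z0 - z)" "w * s dvd w * (z0' - z')" by simp_all
      then have cz: "q dvd c - (s * x + w * z)" "q dvd b - (s * y + w * z')"
        using z0 by (simp_all add: q_eq algebra_simps)
      have "f = param (x, z, y, z', k mod q, k' mod q)"
      proof (rule auto_eqI[OF fa])
        show "param (x, z, y, z', k mod q, k' mod q) \<in> auto H" using param(1) Aut_upper_subset by blast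
        show "f A = param (x, z, y, z', k mod q, k' mod q) A" "f B = param (x, z, y, z', k mod q, k' mod q) B"
          unfolding co param E_eq_iff using ax cz by simp_all
      qed
      moreover have "(x, z, y, z', k mod q, k' mod q) \<in> ?X"
        by (simp add: x_def y_def z_def z'_def)
      ultimately show "f \<in> param ` ?X" by blast
    qed
  qed
  then have "card Aut3 = card ?X" by (rule bij_betw_same_card[symmetric])
  also have "\<dots> = nat w * (nat s * (nat w * (nat s * (nat q * nat q))))"
    by (simp only: card_cartesian_product card_atLeastLessThan_int diff_zero)
  also have "nat q = nat w * nat s" by (simp add: q_eq nat_mult_distrib less_imp_le[OF positive(1)])
  finally show ?thesis by (simp add: \<open>nat q = nat w * nat s\<close> power4_eq_xxxx ac_simps)
qed

lemma order_AutoGroup: "m > 2 \<Longrightarrow> order AG = 2 ^ (8 * m - 2)" "m = 2 \<Longrightarrow> order AG = 2 ^ 13"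
proof -
  have "q = int (2 ^ (2 * m - 1))" by (simp add: q_def)
  then have "nat q = 2 ^ (2 * m - 1)" by (simp only: nat_int)
  then have "card Aut3 = 2 ^ ((2 * m - 1) * 4)" unfolding card_Aut3 by (simp only: power_mult)
  moreover have "(2 * m - 1) * 4 = 8 * m - 4" by simp
  ultimately have K: "card Aut3 = 2 ^ (8 * m - 4)" by (simp only:)
  show "order AG = 2 ^ (8 * m - 2)" if "m > 2"
  proof -
    have "8 * m - 2 = 2 + (8 * m - 4)" using that by simp
    then have "(2::nat) ^ (8 * m - 2) = 2 ^ 2 * 2 ^ (8 * m - 4)" by (simp only: power_add)
    then show ?thesis unfolding order_AG card_QQ(1)[OF that] K by simp
  qed
  show "order AG = 2 ^ 13" if "m = 2" unfolding order_AG card_QQ(2)[OF that] K by (simp add: that)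
qed

end

section \<open>Reduction to Aut_2 and inner automorphisms\<close>

lemma (in group) conjugation_auto:
  assumes a: "a \<in> carrier G"
  shows "(\<lambda>x\<in>carrier G. inv a \<otimes> x \<otimes> a) \<in> auto G"
proof -
  let ?f = "\<lambda>x\<in>carrier G. inv a \<otimes> x \<otimes> a"
  have "inv a \<otimes> (x \<otimes> y) \<otimes> a = (inv a \<otimes> x \<otimes> a) \<otimes> (inv a \<otimes> y \<otimes> a)" if "x \<in> carrier G" "y \<in> carrier G" for x y
  proof -
    have "(inv a \<otimes> x \<otimes> a) \<otimes> (inv a \<otimes> y \<otimes> a) = inv a \<otimes> x \<otimes> (a \<otimes> inv a) \<otimes> (y \<otimes> a)"
      using a that by (simp only: m_assoc m_closed inv_closed)
    also have "\<dots> = inv a \<otimes> (x \<otimes> y) \<otimes> a" using a that by (simp add: m_assoc)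
    finally show ?thesis by simp
  qed
  then have "?f \<in> hom G G" using a by (intro homI) simp_all
  moreover have "bij_betw ?f (carrier G) (carrier G)"
  proof (rule bij_betw_byWitness[where f' = "\<lambda>x. a \<otimes> x \<otimes> inv a"])
    have "a \<otimes> (inv a \<otimes> x \<otimes> a) \<otimes> inv a = x" "inv a \<otimes> (a \<otimes> x \<otimes> inv a) \<otimes> a = x" if "x \<in> carrier G" for x
    proof -
      have "a \<otimes> (inv a \<otimes> x \<otimes> a) \<otimes> inv a = (a \<otimes> inv a) \<otimes> x \<otimes> (a \<otimes> inv a)"
        "inv a \<otimes> (a \<otimes> x \<otimes> inv a) \<otimes> a = (inv a \<otimes> a) \<otimes> x \<otimes> (inv a \<otimes> a)"
        using a that by (simp_all only: m_assoc m_closed inv_closed)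
      then show "a \<otimes> (inv a \<otimes> x \<otimes> a) \<otimes> inv a = x" "inv a \<otimes> (a \<otimes> x \<otimes> inv a) \<otimes> a = x"
        using a that by simp_all
    qed
    then show "\<forall>x\<in>carrier G. a \<otimes> ?f x \<otimes> inv a = x" "\<forall>x\<in>carrier G. ?f (a \<otimes> x \<otimes> inv a) = x"
      using a by simp_all
  qed (use a in auto)
  ultimately show ?thesis by (simp only: auto_def Bij_def Int_iff mem_Collect_eq restrict_extensional simp_thms)
qed

context macdonald_H begin

lemma mat_cong:
  assumes "mat f a b c d" "[a = a'] (mod w)" "[b = b'] (mod w)" "[c = c'] (mod w)" "[d = d'] (mod w)"
  shows "mat f a' b' c' d'"
  using assms ab_class_cong unfolding mat_def by blast

lemma Aut3_mult: "f \<in> Aut3 \<Longrightarrow> f' \<in> Aut3 \<Longrightarrow> f \<otimes>\<^bsub>AG\<^esub> f' \<in> Aut3"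
  using subgroup.m_closed[OF normal_imp_subgroup[OF Aut_upper_normal]] .

lemma GammaH_Aut3: "GammaH \<in> Aut3"
  unfolding Aut3_iff[OF GammaH mat_GammaH] by simp

definition GammaH_conj where "GammaH_conj = nuH \<otimes>\<^bsub>AG\<^esub> GammaH \<otimes>\<^bsub>AG\<^esub> nuH"

lemma GammaH_conj: "GammaH_conj \<in> auto H" "mat GammaH_conj 1 s 0 (1 + s)"
proof -
  have ng: "nuH \<otimes>\<^bsub>AG\<^esub> GammaH \<in> auto H" by (rule mult_auto[OF nuH(1) GammaH])
  show "GammaH_conj \<in> auto H" unfolding GammaH_conj_def by (rule mult_auto[OF ng nuH(1)])
  have "mat (nuH \<otimes>\<^bsub>AG\<^esub> GammaH) 0 (1 + s) 1 s"
    using mat_mult[OF nuH(1) GammaH mat_nuH mat_GammaH] by simp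
  from mat_mult[OF ng nuH(1) this mat_nuH] show "mat GammaH_conj 1 s 0 (1 + s)"
    unfolding GammaH_conj_def by simp
qed

lemma GammaH_conj_Aut3: "GammaH_conj \<in> Aut3"
  unfolding Aut3_iff[OF GammaH_conj] by simp

lemma s_odd_sum: "odd x \<Longrightarrow> odd y \<Longrightarrow> w dvd s * x + s * y"
proof -
  assume "odd x" "odd y"
  then have "even (x + y)" by simp
  then obtain z where "x + y = 2 * z" by blast
  then have "s * x + s * y = w * z" by (simp add: w_eq flip: distrib_left)
  then show ?thesis by simp
qed

lemma odd_quotient: "s dvd x \<Longrightarrow> \<not> w dvd x \<Longrightarrow> \<exists>y. odd y \<and> x = s * y"
proof -
  assume "s dvd x" "\<not> w dvd x"
  then obtain y where y: "x = s * y" by blast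
  have "odd y"
  proof
    assume "even y"
    then have "s * 2 dvd s * y" by simp
    then show False using \<open>\<not> w dvd x\<close> by (simp add: y w_eq mult.commute)
  qed
  then show ?thesis using y by blast
qed

text \<open>
  In \<open>Aut3\<close> the number \<open>a-1\<close> is \<open>0\<close> or \<open>s\<close>
  modulo \<open>w\<close> and \<open>c\<close> follows it. Composition with
  \<open>\<Gamma>\<close> changes both by \<open>s\<close> modulo \<open>w\<close>.
\<close>

lemma clear_first_column:
  assumes "f \<in> Aut3"
  shows "\<exists>\<tau> \<in> {\<one>\<^bsub>AG\<^esub>, GammaH}. \<exists>b d. f \<otimes>\<^bsub>AG\<^esub> \<tau> \<in> Aut3 \<and> mat (f \<otimes>\<^bsub>AG\<^esub> \<tau>) 1 b 0 d"
proof -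
  have f: "f \<in> auto H" using assms Aut_upper_subset by blast
  obtain a b c d where m: "mat f a b c d" using auto_mat[OF f] by blast
  note n = Aut3_nec[OF assms m]
  show ?thesis
  proof (cases "w dvd a - 1")
    case True
    have "w dvd (a - 1) - ((a - 1) - c)" using True n(5) by (rule dvd_diff)
    then have "mat f 1 b 0 d" using m True by (intro mat_cong[OF m]) (simp_all add: cong_iff_dvd_diff)
    moreover have "f \<otimes>\<^bsub>AG\<^esub> \<one>\<^bsub>AG\<^esub> = f" using f by (intro monoid.r_one[OF group.is_monoid[OF group_AG]]) (simp only: AG_carrier)
    ultimately show ?thesis using assms by auto
  next
    case False
    have "even (a - 1)" using even_s n(1) by (rule dvd_trans)
    then have "odd a" by simp
    obtain x where x: "odd x" "a - 1 = s * x" using odd_quotient[OF n(1) False] by blast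
    have a1: "w dvd a * (1 + s) + c * 0 - 1"
    proof -
      have "w dvd s * x + s * a" using x(1) \<open>odd a\<close> by (rule s_odd_sum)
      then show ?thesis using x(2) by (simp add: algebra_simps)
    qed
    have "w dvd (a * (1 + s) + c * 0 - 1) - ((a - 1) - c)" using a1 n(5) by (rule dvd_diff)
    then have c0: "w dvd a * s + c * 1 - 0" by (simp add: algebra_simps)
    have "mat (f \<otimes>\<^bsub>AG\<^esub> GammaH) 1 (b * (1 + s) + d * 0) 0 (b * s + d * 1)"
      using a1 c0 by (intro mat_cong[OF mat_mult[OF f GammaH m mat_GammaH]]) (simp_all only: cong_iff_dvd_diff diff_self dvd_0_right)
    then show ?thesis using Aut3_mult[OF assms GammaH_Aut3] by blast
  qed
qed

text \<open>
  The conjugate of \<open>\<Gamma>\<close> under \<open>\<nu>\<close> does for \<open>b\<close>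
  and \<open>d\<close> what \<open>\<Gamma>\<close> does for \<open>a\<close> and
  \<open>c\<close>, and it keeps the column that is already cleared.
\<close>

lemma clear_second_column:
  assumes "f \<in> Aut3" and m: "mat f 1 b 0 d"
  shows "\<exists>\<tau> \<in> {\<one>\<^bsub>AG\<^esub>, GammaH_conj}. f \<otimes>\<^bsub>AG\<^esub> \<tau> \<in> Aut3 \<and> mat (f \<otimes>\<^bsub>AG\<^esub> \<tau>) 1 0 0 1"
proof -
  have f: "f \<in> auto H" using assms Aut_upper_subset by blast
  note n = Aut3_nec[OF assms(1) m]
  show ?thesis
  proof (cases "w dvd b")
    case True
    have "w dvd (d - 1 - b) + b" using n(6) True by (rule dvd_add)
    then have "mat f 1 0 0 1" using m True by (intro mat_cong[OF m]) (simp_all add: cong_iff_dvd_diff)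
    moreover have "f \<otimes>\<^bsub>AG\<^esub> \<one>\<^bsub>AG\<^esub> = f" using f by (intro monoid.r_one[OF group.is_monoid[OF group_AG]]) (simp only: AG_carrier)
    ultimately show ?thesis using assms by auto
  next
    case False
    have "even (d - 1)" using even_s n(4) by (rule dvd_trans)
    then have "odd d" by simp
    obtain y where y: "odd y" "b = s * y" using odd_quotient[OF n(2) False] by blast
    have b0: "w dvd b * 1 + d * s - 0"
      using s_odd_sum[OF y(1) \<open>odd d\<close>] by (simp add: y(2) mult.commute)
    have "w dvd (b * 1 + d * s - 0) + ((d - 1) - b)" using b0 n(6) by (rule dvd_add)
    then have d1: "w dvd b * 0 + d * (1 + s) - 1" by (simp add: algebra_simps)
    have "mat (f \<otimes>\<^bsub>AG\<^esub> GammaH_conj) 1 0 0 1"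
      using b0 d1 by (intro mat_cong[OF mat_mult[OF f GammaH_conj(1) m GammaH_conj(2)]]) (simp_all add: cong_iff_dvd_diff)
    then show ?thesis using Aut3_mult[OF assms(1) GammaH_conj_Aut3] by blast
  qed
qed

text \<open>
  Conjugation by \<open>u=A^(-k') B^k\<close> multiplies \<open>A\<close> by \<open>C^k\<close>
  and \<open>B\<close> by \<open>C^(k')\<close> modulo \<open>Z_2(H)\<close>, and these are the
  exponents of \<open>C\<close> in the images of \<open>A\<close> and \<open>B\<close> under
  \<open>f\<close>.
\<close>

lemma near_identity:
  assumes f: "f \<in> auto H" and m: "mat f 1 0 0 1"
  shows "f \<in> Aut_upper H 2 <#>\<^bsub>AG\<^esub> Inn H"
proof -
  interpret AG: group AG by (rule group_AG)
  let ?Z = "upper_central H 2"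
  interpret N: normal ?Z H by (rule upper_central_normal)
  interpret Quot: group "H Mod ?Z" by (rule N.factorgroup_is_group)
  obtain a k b c k' d where co: "f A = E a k b" "f B = E c k' d" "[a = 1] (mod w)" "[b = 0] (mod w)"
    "[c = 0] (mod w)" "[d = 1] (mod w)"
    using m unfolding mat_def ab_class_def by blast
  define u where "u = E (- k') 0 k"
  define \<iota> where "\<iota> = (\<lambda>x\<in>carrier H. inv u \<otimes> x \<otimes> u)"
  have u: "u \<in> carrier H" by (simp add: u_def)
  have \<iota>: "\<iota> \<in> auto H" "\<iota> \<in> Inn H" unfolding \<iota>_def using conjugation_auto[OF u] u by (auto simp: Inn_def)
  have coset: "?Z #> x = ?Z #> y \<longleftrightarrow> coord_cong w s x y" if "x \<in> carrier H" "y \<in> carrier H" for x y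
    using rcos_W_eq_iff[OF levels(3) _ that] upper_central_normal[of 2] unfolding upper_central_eqs by blast
  have cancel: "?Z #> x = ?Z #> \<iota> y" if x: "x \<in> carrier H" and y: "y \<in> carrier H" and c: "coord_cong w s (u \<otimes> x) (y \<otimes> u)" for x y
  proof -
    have \<iota>y: "\<iota> y \<in> carrier H" "u \<otimes> \<iota> y = y \<otimes> u" using y u by (simp_all add: \<iota>_def m_assoc[symmetric])
    have "?Z #> (u \<otimes> x) = ?Z #> (u \<otimes> \<iota> y)" using coset[of "u \<otimes> x" "y \<otimes> u"] c x y u \<iota>y by simp
    then have "(?Z #> u) <#> (?Z #> x) = (?Z #> u) <#> (?Z #> \<iota> y)" using u x \<iota>y by (simp add: N.rcos_sum)
    then have "(?Z #> u) \<otimes>\<^bsub>H Mod ?Z\<^esub> (?Z #> x) = (?Z #> u) \<otimes>\<^bsub>H Mod ?Z\<^esub> (?Z #> \<iota> y)" by (simp add: FactGroup_def)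
    moreover have "?Z #> v \<in> carrier (H Mod ?Z)" if "v \<in> carrier H" for v
      using that by (auto simp: FactGroup_def RCOSETS_def)
    ultimately show ?thesis
      using Quot.Units_l_cancel[of "?Z #> u" "?Z #> x" "?Z #> \<iota> y"] Quot.Units_eq u x \<iota>y(1) by blast
  qed
  obtain pa where pa: "a ^ 2 - a = 2 * pa" using even_square_diff[of a] by blast
  obtain pc where pc: "c ^ 2 - c = 2 * pc" using even_square_diff[of c] by blast
  obtain pk where pk: "k ^ 2 + k = 2 * pk" using even_square_add[of k] by blast
  obtain pu where pu: "(- k') ^ 2 - (- k') = 2 * pu" using even_square_diff[of "- k'"] by blast
  have wn: "w dvd 4 * \<nu> * x" and sn: "s dvd 4 * \<nu> * x" for x
    using dvd_mult2[OF w_dvd] dvd_mult2[OF s_dvd_4nu] by blast+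
  have ab: "w dvd a - 1" "w dvd b" "w dvd c" "w dvd d - 1" using co(3-6) by (simp_all add: cong_iff_dvd_diff)
  have abs: "s dvd a - 1" "s dvd c" using ab dvd_trans[OF s_dvd_w] by blast+
  have "coord_cong w s (u \<otimes> E a k b) (A \<otimes> u)"
    unfolding u_def A_eq E_mult coord_cong_E[OF levels(3)] pa pk
  proof (intro conjI)
    have "w dvd (a - 1) + 4 * \<nu> * (k * pa)" by (rule dvd_add[OF ab(1) wn])
    then show "w dvd - k' + a + 2 * \<nu> * k * (2 * pa) - 4 * \<nu> * 0 * a
        - (1 + - k' + 2 * \<nu> * 0 * ((- k') ^ 2 - - k') - 4 * \<nu> * 0 * - k')" by (simp add: algebra_simps)
    have "s dvd - ((a - 1) * k) - 4 * \<nu> * (pa * pk)" by (rule dvd_diff[OF _ sn]) (simp add: abs)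
    then show "s dvd 0 + k - a * k - \<nu> * (2 * pa) * (2 * pk)
        - (0 + 0 - - k' * 0 - \<nu> * ((- k') ^ 2 - - k') * (0 ^ 2 + 0))" by (simp add: algebra_simps)
    have "w dvd b + 4 * \<nu> * (a * pk - k * k)" by (rule dvd_add[OF ab(2) wn])
    then show "w dvd k + b + 2 * \<nu> * a * (2 * pk) - 4 * \<nu> * k * k
        - (0 + k + 2 * \<nu> * - k' * (0 ^ 2 + 0) - 4 * \<nu> * 0 * 0)" by (simp add: algebra_simps)
  qed
  then have 1: "?Z #> f A = ?Z #> \<iota> A" unfolding co by (intro cancel) simp_all
  have "coord_cong w s (u \<otimes> E c k' d) (B \<otimes> u)"
    unfolding u_def B_eq E_mult coord_cong_E[OF levels(3)] pc pk pu
  proof (intro conjI)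
    have "w dvd c + 4 * \<nu> * (k * pc - pu)" by (rule dvd_add[OF ab(3) wn])
    then show "w dvd - k' + c + 2 * \<nu> * k * (2 * pc) - 4 * \<nu> * 0 * c
        - (0 + - k' + 2 * \<nu> * 1 * (2 * pu) - 4 * \<nu> * 0 * - k')" by (simp add: algebra_simps)
    have "s dvd - (c * k) + 4 * \<nu> * (pu - pc * pk)" by (rule dvd_add[OF _ sn]) (simp add: abs)
    then show "s dvd 0 + k' - c * k - \<nu> * (2 * pc) * (2 * pk)
        - (0 + 0 - - k' * 1 - \<nu> * (2 * pu) * (1 ^ 2 + 1))" by (simp add: algebra_simps)
    have "w dvd (d - 1) + 4 * \<nu> * (c * pk - k' * k + k')" by (rule dvd_add[OF ab(4) wn])
    then show "w dvd k + d + 2 * \<nu> * c * (2 * pk) - 4 * \<nu> * k' * k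
        - (1 + k + 2 * \<nu> * - k' * (1 ^ 2 + 1) - 4 * \<nu> * 0 * 1)" by (simp add: algebra_simps)
  qed
  then have 2: "?Z #> f B = ?Z #> \<iota> B" unfolding co by (intro cancel) simp_all
  have "zeta 2 f = zeta 2 \<iota>" unfolding zeta_eq_iff[OF f \<iota>(1)] using 1 2 by blast
  from factor_Aut_upper[OF f \<iota>(1) this] have "f \<otimes>\<^bsub>AG\<^esub> inv\<^bsub>AG\<^esub> \<iota> \<in> Aut_upper H 2" .
  moreover have "f = (f \<otimes>\<^bsub>AG\<^esub> inv\<^bsub>AG\<^esub> \<iota>) \<otimes>\<^bsub>AG\<^esub> \<iota>"
    using f \<iota>(1) unfolding AG_carrier[symmetric] by (simp add: AG.m_assoc)
  ultimately show ?thesis using \<iota>(2) unfolding set_mult_def by blast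
qed

lemma auto_eq_Aut2_Inn_S:
  "auto H = Aut_upper H 2 <#>\<^bsub>AG\<^esub> Inn H <#>\<^bsub>AG\<^esub> generate AG {GammaH, SigmaH, nuH}"
proof -
  interpret AG: group AG by (rule group_AG)
  let ?T = "generate AG {GammaH, SigmaH, nuH}"
  have gens: "{GammaH, SigmaH, nuH} \<subseteq> auto H" using GammaH SigmaH nuH(1) by simp
  have T: "{\<one>\<^bsub>AG\<^esub>, nuH, SigmaH, nuH \<otimes>\<^bsub>AG\<^esub> SigmaH} \<subseteq> ?T" "{\<one>\<^bsub>AG\<^esub>, GammaH} \<subseteq> ?T" "{\<one>\<^bsub>AG\<^esub>, GammaH_conj} \<subseteq> ?T"
    by (simp_all add: generate.one generate.incl generate.eng GammaH_conj_def)
  have Tc: "?T \<subseteq> carrier AG" using subgroup.subset[OF subgroup_generate[OF gens]] .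
  have "carrier AG = Aut_upper H 2 <#>\<^bsub>AG\<^esub> Inn H <#>\<^bsub>AG\<^esub> ?T"
  proof (rule AG.set_mult_if_right_translate[OF subgroup_generate[OF gens]])
    have "Inn H \<subseteq> auto H" unfolding Inn_def using conjugation_auto by blast
    then show "Aut_upper H 2 <#>\<^bsub>AG\<^esub> Inn H \<subseteq> carrier AG"
      using Aut_upper_subset[of 2] mult_auto unfolding AG_carrier set_mult_def by blast
    fix f assume "f \<in> carrier AG"
    then have f: "f \<in> auto H" unfolding AG_carrier .
    obtain \<sigma> where \<sigma>: "\<sigma> \<in> ?T" "f \<otimes>\<^bsub>AG\<^esub> \<sigma> \<in> Aut3" using right_translate_into_Aut3[OF f] T(1) by (meson subsetD)
    obtain \<tau> b d where \<tau>: "\<tau> \<in> ?T" "f \<otimes>\<^bsub>AG\<^esub> \<sigma> \<otimes>\<^bsub>AG\<^esub> \<tau> \<in> Aut3" "mat (f \<otimes>\<^bsub>AG\<^esub> \<sigma> \<otimes>\<^bsub>AG\<^esub> \<tau>) 1 b 0 d"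
      using clear_first_column[OF \<sigma>(2)] T(2) by (meson subsetD)
    obtain \<tau>' where \<tau>': "\<tau>' \<in> ?T" "f \<otimes>\<^bsub>AG\<^esub> \<sigma> \<otimes>\<^bsub>AG\<^esub> \<tau> \<otimes>\<^bsub>AG\<^esub> \<tau>' \<in> Aut3" "mat (f \<otimes>\<^bsub>AG\<^esub> \<sigma> \<otimes>\<^bsub>AG\<^esub> \<tau> \<otimes>\<^bsub>AG\<^esub> \<tau>') 1 0 0 1"
      using clear_second_column[OF \<tau>(2,3)] T(3) by (meson subsetD)
    have "f \<otimes>\<^bsub>AG\<^esub> \<sigma> \<otimes>\<^bsub>AG\<^esub> \<tau> \<otimes>\<^bsub>AG\<^esub> \<tau>' \<in> Aut_upper H 2 <#>\<^bsub>AG\<^esub> Inn H"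
      using near_identity[OF _ \<tau>'(3)] \<tau>'(2) Aut_upper_subset by blast
    moreover have "f \<otimes>\<^bsub>AG\<^esub> \<sigma> \<otimes>\<^bsub>AG\<^esub> \<tau> \<otimes>\<^bsub>AG\<^esub> \<tau>' = f \<otimes>\<^bsub>AG\<^esub> (\<sigma> \<otimes>\<^bsub>AG\<^esub> \<tau> \<otimes>\<^bsub>AG\<^esub> \<tau>')"
      using \<open>f \<in> carrier AG\<close> \<sigma>(1) \<tau>(1) \<tau>'(1) Tc by (simp add: AG.m_assoc subset_iff)
    moreover have "\<sigma> \<otimes>\<^bsub>AG\<^esub> \<tau> \<otimes>\<^bsub>AG\<^esub> \<tau>' \<in> ?T" by (intro generate.eng \<sigma>(1) \<tau>(1) \<tau>'(1))
    ultimately show "\<exists>\<sigma>\<in>?T. f \<otimes>\<^bsub>AG\<^esub> \<sigma> \<in> Aut_upper H 2 <#>\<^bsub>AG\<^esub> Inn H" by metis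
  qed
  then show ?thesis by (simp only: AG_carrier)
qed

end

theorem theorem6p14:
  fixes m :: nat and l :: int
  assumes "m > 1" and "odd l"
  defines "H \<equiv> H_group m l"
  defines "\<zeta> \<equiv> canonical_map H (upper_central H 3)"
  shows
    "kernel (AutoGroup H) (AutoGroup (H Mod upper_central H 3)) \<zeta> = Aut_upper H 3
     \<and> \<zeta> ` auto H = \<zeta> ` generate (AutoGroup H) {Sigma1 m l, nu m l}
     \<and> auto H = Aut_upper H 3 <#>\<^bsub>AutoGroup H\<^esub> generate (AutoGroup H) {Sigma1 m l, nu m l}
     \<and> auto H = Aut_upper H 2 <#>\<^bsub>AutoGroup H\<^esub> Inn H
                  <#>\<^bsub>AutoGroup H\<^esub> generate (AutoGroup H) {Gamma m l, Sigma1 m l, nu m l}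
     \<and> (m > 2 \<longrightarrow> AutoGroup H Mod Aut_upper H 3
                     \<cong> integer_mod_group 2 \<times>\<times> integer_mod_group 2)
     \<and> (m = 2 \<longrightarrow> AutoGroup H Mod Aut_upper H 3 \<cong> integer_mod_group 2)
     \<and> (m > 2 \<longrightarrow> order (AutoGroup H) = 2 ^ (8 * m - 2))
     \<and> (m = 2 \<longrightarrow> order (AutoGroup H) = 2 ^ 13)"
proof -
  \<comment> \<open>Replacing \<open>l\<close> by its residue changes \<open>\<alpha>\<close> by a multiple of \<open>2^(3m)\<close> and makes the parameter positive.\<close>
  define h :: int where "h = l mod 2 ^ (2 * m)"
  define \<nu> :: int where "\<nu> = 2 ^ (m - 2) * h"
  have "even (2 ^ (2 * m) :: int)" using assms(1) by simp
  then have "odd h" using assms(2) unfolding h_def by (simp add: dvd_mod_iff)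
  moreover have "h \<ge> 0" by (simp add: h_def)
  ultimately have "h > 0" by (metis dvd_0_right order_le_less)
  then have params: "macdonald_params m \<nu>"
    using assms(1) \<open>odd h\<close> by unfold_locales (auto simp: \<nu>_def)
  interpret macdonald_params m \<nu> by (rule params)
  have "J_alpha m l - (1 + 4 * \<nu>) = 2 ^ m * (l - h)"
    using two_powers(1) by (simp add: J_alpha_def \<nu>_def w_def algebra_simps)
  moreover have "(2::int) ^ (2 * m) dvd l - h" by (simp add: h_def)
  then have "2 ^ m * 2 ^ (2 * m) dvd 2 ^ m * (l - h)" by simp
  moreover have "M dvd 2 ^ m * 2 ^ (2 * m)" unfolding M_def power_add[symmetric] by (intro le_imp_power_dvd) simp
  ultimately have "M dvd J_alpha m l - (1 + 4 * \<nu>)" using dvd_trans by metis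
  then have "[J_alpha m l = 1 + 4 * \<nu>] (mod M)" by (simp only: cong_iff_dvd_diff)
  then obtain E where "macdonald_H m \<nu> (H_group m l) (H_gen m l GenA) (H_gen m l GenB) E"
    using macdonald_H_H_group[OF params] by blast
  then interpret macdonald_H m \<nu> H "H_gen m l GenA" "H_gen m l GenB" E unfolding H_def .
  have autos: "nu m l = nuH" "Gamma m l = GammaH" "Sigma1 m l = SigmaH"
    unfolding nuH_def GammaH_def SigmaH_def
    unfolding nu_def Gamma_def Sigma1_def H_auto_def Let_def H_def by - (rule HOL.refl)+
  show ?thesis
    unfolding autos \<zeta>_def
    using zeta_image auto_eq_Aut3_S auto_eq_Aut2_Inn_S quotient_m_2 quotient_m_gt_2 order_AutoGroup
    unfolding QQ_def by (simp add: Aut_upper_def)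
qed

end
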